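(* Let $\xi_1, \ldots, \xi_n$ be independent centered real random variables with variances at least $1$ and subgaussian moments bounded by $B$. Let $A$ be an $n \times n$ matrix whose rows are independent copies of the random vector $(\xi_1,\ldots,\xi_n)$. Then for every $\varepsilon \ge 0$ one has $$\mathbb{P} \big( s_n(A) \le \varepsilon n^{-1/2} \big) \le C\varepsilon + c^n,$$ where $C > 0$ and $c \in (0,1)$ depend (polynomially) only on $B$.
   Context: For a real $n\times n$ matrix $A$, $s_n(A) = \inf_{x \in \mathbb{R}^n,\ \|x\|_2 = 1} \|Ax\|_2$ denotes its smallest singular value. A random variable $\xi$ is called subgaussian if there exists $B>0$ such that $\mathbb{P}(|\xi| > t) \le 2\exp(-t^2/B^2)$ for all $t>0$; the minimal such $B$ is called the subgaussian moment of $\xi$. "Centered" means mean zero.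
   Formalization: "Polynomially" means C ≤ poly(B) for all n, but 1/(1-c) ≤ poly(B) only for n ≥ n0(B), n0 ≤ poly(B); for smaller n, c depends on B with no polynomial control, as uniformity in n is false. Constants are formally fixed per pair of sample-space types (transfer laws to one type). *)

theory Defs
  imports
    "HOL-Probability.Probability"
    "HOL-Computational_Algebra.Polynomial"
    "Jordan_Normal_Form.Matrix"
begin

definition subgaussian_bound :: "'a measure \<Rightarrow> ('a \<Rightarrow> real) \<Rightarrow> real \<Rightarrow> bool" where
  "subgaussian_bound M X B \<longleftrightarrow>
     B > 0 \<and> (\<forall>t>0. measure M {\<omega> \<in> space M. \<bar>X \<omega>\<bar> > t} \<le> 2 * exp (- t\<^sup>2 / B\<^sup>2))"

definition subgaussian :: "'a measure \<Rightarrow> ('a \<Rightarrow> real) \<Rightarrow> bool" where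
  "subgaussian M X \<longleftrightarrow> (\<exists>B. subgaussian_bound M X B)"

(* The infimum is attained unless X = 0 almost surely, so for random variables of positive
   variance this is the minimal B. It is meaningful only under "subgaussian M X". *)
definition subgaussian_moment :: "'a measure \<Rightarrow> ('a \<Rightarrow> real) \<Rightarrow> real" where
  "subgaussian_moment M X = Inf {B. subgaussian_bound M X B}"

definition vec_norm2 :: "real vec \<Rightarrow> real" where
  "vec_norm2 x = L2_set (vec_index x) {..<dim_vec x}"

(* The paper's s_n(A), for n = dim_col A > 0 (for n = 0 there is no unit vector). *)
definition smallest_singular_value :: "real mat \<Rightarrow> real" where
  "smallest_singular_value A =
     (INF x \<in> {x \<in> carrier_vec (dim_col A). vec_norm2 x = 1}. vec_norm2 (A *\<^sub>v x))"

(* Random vectors of length n are random elements of the product of n copies of the Borel line,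
   so that joint laws and independence of vectors are expressible with the library's notions. *)
abbreviation borel_vec :: "nat \<Rightarrow> (nat \<Rightarrow> real) measure" where
  "borel_vec n \<equiv> (\<Pi>\<^sub>M j\<in>{..<n}. borel)"

definition rv_vector :: "nat \<Rightarrow> (nat \<Rightarrow> 'a \<Rightarrow> real) \<Rightarrow> 'a \<Rightarrow> (nat \<Rightarrow> real)" where
  "rv_vector n \<xi> \<omega> = (\<lambda>j\<in>{..<n}. \<xi> j \<omega>)"

definition row_vector :: "nat \<Rightarrow> ('a \<Rightarrow> real mat) \<Rightarrow> nat \<Rightarrow> 'a \<Rightarrow> (nat \<Rightarrow> real)" where
  "row_vector n A i \<omega> = (\<lambda>j\<in>{..<n}. A \<omega> $$ (i, j))"

(* The vector xi may live on a probability space N other than the space M carrying the matrix. *)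
definition rows_independent_copies ::
  "'a measure \<Rightarrow> nat \<Rightarrow> ('a \<Rightarrow> real mat) \<Rightarrow> 'b measure \<Rightarrow> (nat \<Rightarrow> 'b \<Rightarrow> real) \<Rightarrow> bool" where
  "rows_independent_copies M n A N \<xi> \<longleftrightarrow>
     (\<forall>\<omega> \<in> space M. A \<omega> \<in> carrier_mat n n) \<and>
     prob_space.indep_vars M (\<lambda>_. borel_vec n) (row_vector n A) {..<n} \<and>
     (\<forall>i<n. distr M (borel_vec n) (row_vector n A i) = distr N (borel_vec n) (rv_vector n \<xi>))"

(* "Depends polynomially on B": C(B) is at most a polynomial in B; for a rate c(B) in (0,1) the
   relevant quantity is 1/(1 - c(B)). For a rate valid in every dimension n, polynomial growth of
   1/(1 - c(B)) is impossible: let the variables be +-sqrt n with probability 1/(2n) each and 0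
   otherwise. They have variance 1 and B^2 = n / ln (2n), while A has a zero row with probability
   at least 1 - (3/4)^n (n >= 2), whence 1 - c(B) <= (3/4)^n. The polynomial rate therefore goes
   with dimensions n >= n0(B), where n0 is itself polynomially bounded. *)
definition polynomially_bounded :: "(real \<Rightarrow> real) \<Rightarrow> bool" where
  "polynomially_bounded f \<longleftrightarrow> (\<exists>p :: real poly. \<forall>B>0. f B \<le> poly p B)"

end

theory Submission
  imports Defs "Jordan_Normal_Form.Determinant"
begin

text \<open>The argument is that of Rudelson and Vershynin. Unit vectors are split into compressible ones, close to a sparse
  vector, and incompressible ones. On the former, \<open>A\<close> is bounded below by a net argument. An incompressible
  vector has many coordinates of order \<open>1 / sqrt n\<close>, so if \<open>A\<close> maps it to a vector of norm less than
  \<open>t / sqrt n\<close>, then many columns lie within \<open>O(t)\<close> of the span of the others; by Markov's inequality it is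
  enough to bound the probability that one given column does. With \<open>a\<close> a unit normal of the other columns this is a
  small ball probability for a sum of independent copies weighted by \<open>a\<close>. It is \<open>O(t)\<close> up to the inverse of the
  least common denominator of \<open>a\<close>, which is exponentially large with high probability: a smaller value would place
  \<open>a\<close> near a lattice direction, and there are too few of these to compete with the small ball estimate,
  tensorized over the rows.

  Every Fourier estimate goes through \<open>exp (- x\<^sup>2 / 2) = E cos (g x)\<close> with \<open>g\<close> Gaussian, which replaces
  Esseen's inequality and tensorizes. Every net consists of points of an integer lattice.

  In dimensions below a polynomial threshold the rate is not controlled, but the constant \<open>C\<close> is: with positive probability
  \<open>A\<close> is close to an explicitly invertible staircase matrix whose inverse is polynomially bounded.\<close>

section \<open>Subgaussian variables and their sums\<close>

text \<open>The entries of one row may have different laws; only the entries of one column share a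
  law. This decides where the Fourier method is available. Compressible vectors are treated with
  \<open>spread\<close> alone, for arbitrary independent entries. The small ball estimate is applied
  only to combinations of entries of a single column: column \<open>k\<close> paired with the normal
  vector, and the rows of the transposed matrix when the normal vector itself is studied.
  Measurability shapes the definitions. A statement about all unit vectors quantifies over an
  uncountable set, so every exceptional event is a finite or countable union indexed by integer
  data, and the event of a small singular value is merely enclosed in a measurable set
  \<open>W\<close>. All constants are functions of \<open>b = B + 1\<close>: the shift allows for an
  infimum that is not attained, and it makes \<open>b\<close> at least 1.\<close>

lemma exp_le_add_exp_square: "exp x \<le> x + exp (x\<^sup>2)" for x :: real
proof -
  have sq: "1 + x\<^sup>2 \<le> exp (x\<^sup>2)" by (rule exp_ge_add_one_self)
  consider "x \<ge> 1" | "0 \<le> x" "x < 1" | "x < 0" by linarith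
  then show ?thesis
  proof cases
    case 1
    then have "exp x \<le> exp (x\<^sup>2)" by (simp add: power2_eq_square)
    with 1 show ?thesis by linarith
  next
    case 2
    then show ?thesis using exp_bound[of x] sq by linarith
  next
    case 3
    have "exp (-x) \<ge> 1 - x" using exp_ge_add_one_self[of "-x"] by simp
    then have "exp x \<le> 1 / (1 - x)" using 3 by (simp add: exp_minus field_simps)
    also have "\<dots> \<le> 1 + x + x\<^sup>2"
    proof -
      have "x ^ 3 < 0" using 3 by (simp add: power3_eq_cube mult_neg_neg mult_pos_neg)
      then have "1 \<le> (1 + x + x\<^sup>2) * (1 - x)"
        by (simp add: power2_eq_square power3_eq_cube algebra_simps)
      then show ?thesis using 3 by (simp add: pos_divide_le_eq)
    qed
    finally show ?thesis using sq by linarith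
  qed
qed

text \<open>For a centered variable the second moment is the variance. The parameter
  \<open>b\<close> is common to all entries and need not be the subgaussian moment of any of
  them.\<close>

definition sg_var :: "'a measure \<Rightarrow> real \<Rightarrow> ('a \<Rightarrow> real) \<Rightarrow> bool" where
  "sg_var M b Y \<longleftrightarrow> Y \<in> borel_measurable M \<and> integral\<^sup>L M Y = 0 \<and> 1 \<le> integral\<^sup>L M (\<lambda>\<omega>. (Y \<omega>)\<^sup>2)
     \<and> subgaussian_bound M Y b"

text \<open>Layer-cake sum: with \<open>u = (Y \<omega>)\<^sup>2 / b\<^sup>2\<close>, the value
  \<open>exp (u / 2)\<close> is at most 1 plus the sum of \<open>exp ((k + 1) / 2)\<close> over the
  integers \<open>k < u\<close>. Since \<open>u > k\<close> has probability at most
  \<open>2 * exp (- k)\<close>, a geometric series with ratio \<open>exp (- 1/2)\<close>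
  remains.\<close>

lemma (in prob_space) subgaussian_square_exp_moment:
  assumes [measurable]: "Y \<in> borel_measurable M" and sg: "subgaussian_bound M Y b"
  shows "(\<integral>\<^sup>+\<omega>. ennreal (exp ((Y \<omega>)\<^sup>2 / (2 * b\<^sup>2))) \<partial>M) \<le> 12"
proof -
  have b: "b > 0" and tail: "\<And>t. t > 0 \<Longrightarrow> prob {\<omega> \<in> space M. \<bar>Y \<omega>\<bar> > t} \<le> 2 * exp (- t\<^sup>2 / b\<^sup>2)"
    using sg by (auto simp: subgaussian_bound_def)
  define S where "S k = {\<omega> \<in> space M. \<bar>Y \<omega>\<bar> > sqrt (real k) * b}" for k :: nat
  have Sm[measurable]: "S k \<in> sets M" for k unfolding S_def by measurable
  have PS: "emeasure M (S k) \<le> ennreal (2 * exp (- real k))" for k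
  proof (cases "k = 0")
    case True
    have "prob (S k) \<le> 2 * exp (- real k)" using True by (auto intro: order_trans[OF prob_le_1])
    then show ?thesis by (simp add: emeasure_eq_measure ennreal_leI)
  next
    case False
    have "prob (S k) \<le> 2 * exp (- (sqrt (real k) * b)\<^sup>2 / b\<^sup>2)"
      unfolding S_def using False b by (intro tail) auto
    also have "\<dots> = 2 * exp (- real k)" using b by (simp add: power_mult_distrib)
    finally show ?thesis by (simp add: emeasure_eq_measure ennreal_leI)
  qed
  have pw: "ennreal (exp ((Y \<omega>)\<^sup>2 / (2 * b\<^sup>2))) \<le>
      1 + (\<Sum>k. ennreal (exp ((real k + 1) / 2)) * indicator (S k) \<omega>)" if "\<omega> \<in> space M" for \<omega>
  proof (cases "Y \<omega> = 0")
    case True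
    then show ?thesis by simp
  next
    case False
    define u where "u = (Y \<omega>)\<^sup>2 / b\<^sup>2"
    have u: "u > 0" using False b by (simp add: u_def)
    define k where "k = nat (\<lceil>u\<rceil> - 1)"
    have k: "real k < u" "u \<le> real k + 1"
      using u unfolding k_def by linarith+
    have "real k * b\<^sup>2 < (Y \<omega>)\<^sup>2" using k b by (simp add: u_def field_simps)
    then have "sqrt (real k * b\<^sup>2) < sqrt ((Y \<omega>)\<^sup>2)" by (rule real_sqrt_less_mono)
    then have "\<omega> \<in> S k" using that b by (simp add: S_def real_sqrt_mult)
    have "ennreal (exp ((Y \<omega>)\<^sup>2 / (2 * b\<^sup>2))) = ennreal (exp (u/2))" by (simp add: u_def)
    also have "\<dots> \<le> ennreal (exp ((real k + 1) / 2)) * indicator (S k) \<omega>"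
      using k \<open>\<omega> \<in> S k\<close> by (simp add: ennreal_leI)
    also have "\<dots> \<le> (\<Sum>k. ennreal (exp ((real k + 1) / 2)) * indicator (S k) \<omega>)"
      using sum_le_suminf[OF summableI, of "{k}"] by simp
    finally show ?thesis by (simp add: add_increasing)
  qed
  define r where "r = exp (- (1/2::real))"
  have r: "0 < r" "r < 1" by (auto simp: r_def)
  have "(\<integral>\<^sup>+\<omega>. ennreal (exp ((Y \<omega>)\<^sup>2 / (2 * b\<^sup>2))) \<partial>M) \<le>
     (\<integral>\<^sup>+\<omega>. 1 + (\<Sum>k. ennreal (exp ((real k + 1) / 2)) * indicator (S k) \<omega>) \<partial>M)"
    by (intro nn_integral_mono pw)
  also have "\<dots> = 1 + (\<Sum>k. ennreal (exp ((real k + 1) / 2)) * emeasure M (S k))"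
    by (subst nn_integral_add) (auto simp: nn_integral_suminf nn_integral_cmult emeasure_space_1)
  also have "\<dots> \<le> 1 + (\<Sum>k. ennreal (exp ((real k + 1) / 2)) * ennreal (2 * exp (- real k)))"
    by (intro add_mono suminf_le mult_left_mono PS) auto
  also have "(\<lambda>k. ennreal (exp ((real k + 1) / 2)) * ennreal (2 * exp (- real k))) = (\<lambda>k. ennreal (2 * exp (1/2) * r ^ k))"
    by (auto simp: ennreal_mult'[symmetric] r_def exp_of_nat_mult[symmetric] exp_add[symmetric] mult_ac field_simps intro!: ext)
  also have "(\<Sum>k. ennreal (2 * exp (1/2) * r ^ k)) = ennreal (2 * exp (1/2) * (1 / (1 - r)))"
    using r by (intro suminf_ennreal_eq sums_mult geometric_sums) auto
  also have "1 + \<dots> = ennreal (1 + 2 * exp (1/2) * (1 / (1 - r)))"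
    using r by (simp add: ennreal_plus)
  also have "\<dots> \<le> ennreal 12"
  proof (intro ennreal_leI)
    have e: "exp (1/2 :: real) \<le> 7/4" using exp_bound[of "1/2::real"] by (simp add: power2_eq_square)
    have e1: "3/2 \<le> exp (1/2 :: real)"
      using exp_ge_add_one_self[of "1/2::real"] by simp
    then have "r \<le> 2/3" by (simp add: r_def exp_minus field_simps)
    then have "1 / (1 - r) \<le> 3" using r by (simp add: field_simps)
    then have "exp (1/2) * (1 / (1 - r)) \<le> 7/4 * 3" using e r by (intro mult_mono) auto
    then show "1 + 2 * exp (1/2) * (1 / (1 - r)) \<le> 12" by (simp only: mult.assoc)
  qed
  finally show ?thesis by simp
qed

lemma sg_varD:
  assumes "sg_var M b Y"
  shows "Y \<in> borel_measurable M" "integral\<^sup>L M Y = 0" "1 \<le> integral\<^sup>L M (\<lambda>\<omega>. (Y \<omega>)\<^sup>2)"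
    "subgaussian_bound M Y b" "b > 0"
  using assms by (auto simp: sg_var_def subgaussian_bound_def)

lemma (in prob_space) sg_var_integrable:
  assumes sg: "sg_var M b Y"
  shows "integrable M (\<lambda>\<omega>. exp ((Y \<omega>)\<^sup>2 / (2 * b\<^sup>2)))"
    and "expectation (\<lambda>\<omega>. exp ((Y \<omega>)\<^sup>2 / (2 * b\<^sup>2))) \<le> 12"
    and "integrable M (\<lambda>\<omega>. (Y \<omega>)\<^sup>2)" and "integrable M Y"
proof -
  note [measurable] = sg_varD(1)[OF sg]
  note b = sg_varD(5)[OF sg]
  let ?W = "\<lambda>\<omega>. exp ((Y \<omega>)\<^sup>2 / (2 * b\<^sup>2))"
  have nn: "(\<integral>\<^sup>+\<omega>. ennreal (?W \<omega>) \<partial>M) \<le> 12"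
    using subgaussian_square_exp_moment sg_varD[OF sg] by blast
  also have "(12::ennreal) < \<infinity>" by simp
  finally show iW: "integrable M ?W" by (intro integrableI_nonneg) auto
  show "expectation ?W \<le> 12"
    using nn nn_integral_eq_integral[OF iW] by (simp flip: ennreal_numeral)
  have "(Y \<omega>)\<^sup>2 \<le> 2 * b\<^sup>2 * ?W \<omega>" for \<omega>
  proof -
    have "(Y \<omega>)\<^sup>2 = 2 * b\<^sup>2 * ((Y \<omega>)\<^sup>2 / (2 * b\<^sup>2))" using b by simp
    also have "\<dots> \<le> 2 * b\<^sup>2 * ?W \<omega>"
      using less_imp_le[OF less_le_trans[OF less_add_one exp_ge_add_one_self[of "(Y \<omega>)\<^sup>2 / (2 * b\<^sup>2)", unfolded add.commute[of 1]]]]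
      by (intro mult_left_mono) auto
    finally show ?thesis .
  qed
  then show i2: "integrable M (\<lambda>\<omega>. (Y \<omega>)\<^sup>2)"
    by (intro Bochner_Integration.integrable_bound[OF integrable_mult_right[OF iW, of "2 * b\<^sup>2"]]) (auto intro!: AE_I2)
  then show "integrable M Y" by (rule square_integrable_imp_integrable[rotated]) measurable
qed

text \<open>For \<open>\<theta> \<le> 1\<close>, the mean zero removes the linear term of
  \<open>exp_le_add_exp_square\<close>, and the chord of the exponential over the unit interval
  reduces the other term to the square-exponential moment, with total
  \<open>1 + 11 * \<theta>\<close>. For larger \<open>\<theta>\<close> the product
  \<open>s * Y\<close> is split by completing a square, and the factor 12 is absorbed by
  \<open>exp (10 * \<theta>)\<close>.\<close>

lemma (in prob_space) sg_var_mgf: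
  assumes sg: "sg_var M b Y"
  shows "(\<integral>\<^sup>+\<omega>. ennreal (exp (s * Y \<omega>)) \<partial>M) \<le> ennreal (exp (22 * b\<^sup>2 * s\<^sup>2))"
proof -
  note [measurable] = sg_varD(1)[OF sg]
  note b = sg_varD(5)[OF sg]
  define W where "W \<omega> = exp ((Y \<omega>)\<^sup>2 / (2 * b\<^sup>2))" for \<omega>
  note I = sg_var_integrable[OF sg, folded W_def]
  define \<theta> where "\<theta> = 2 * b\<^sup>2 * s\<^sup>2"
  have \<theta>0: "\<theta> \<ge> 0" by (simp add: \<theta>_def)
  show ?thesis
  proof (cases "\<theta> \<le> 1")
    case True
    have cv: "exp (\<theta> * v) \<le> 1 - \<theta> + \<theta> * exp v" for v :: real
      using convex_onD[OF convex_on_exp[of 1], of \<theta> 0 v] True \<theta>0 by simp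
    have pw: "exp (s * Y \<omega>) \<le> s * Y \<omega> + (1 - \<theta>) + \<theta> * W \<omega>" for \<omega>
    proof -
      have "(s * Y \<omega>)\<^sup>2 = \<theta> * ((Y \<omega>)\<^sup>2 / (2 * b\<^sup>2))" using b by (simp add: \<theta>_def power_mult_distrib)
      then show ?thesis
        using exp_le_add_exp_square[of "s * Y \<omega>"] cv[of "(Y \<omega>)\<^sup>2 / (2 * b\<^sup>2)"] by (simp add: W_def)
    qed
    have i: "integrable M (\<lambda>\<omega>. s * Y \<omega> + (1 - \<theta>) + \<theta> * W \<omega>)" using I by auto
    have "(\<integral>\<^sup>+\<omega>. ennreal (exp (s * Y \<omega>)) \<partial>M) \<le> (\<integral>\<^sup>+\<omega>. ennreal (s * Y \<omega> + (1 - \<theta>) + \<theta> * W \<omega>) \<partial>M)"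
      by (intro nn_integral_mono ennreal_leI pw)
    also have "\<dots> = ennreal (expectation (\<lambda>\<omega>. s * Y \<omega> + (1 - \<theta>) + \<theta> * W \<omega>))"
      using order_trans[OF less_imp_le[OF exp_gt_zero] pw] by (intro nn_integral_eq_integral[OF i] AE_I2)
    also have "expectation (\<lambda>\<omega>. s * Y \<omega> + (1 - \<theta>) + \<theta> * W \<omega>) = 1 - \<theta> + \<theta> * expectation W"
      using I sg_varD(2)[OF sg] by (simp add: prob_space)
    also have "\<dots> \<le> 1 + 11 * \<theta>" using mult_left_mono[OF I(2) \<theta>0] by simp
    also have "\<dots> \<le> exp (11 * \<theta>)" by (rule exp_ge_add_one_self)
    finally show ?thesis by (simp add: \<theta>_def ennreal_leI mult_ac)
  next
    case False
    have pw: "exp (s * Y \<omega>) \<le> exp (\<theta> / 4) * W \<omega>" for \<omega>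
    proof -
      have "0 \<le> (b * s - Y \<omega> / b)\<^sup>2" by simp
      also have "\<dots> = \<theta> / 2 - 2 * s * Y \<omega> + (Y \<omega>)\<^sup>2 / b\<^sup>2"
        using b by (simp add: power2_diff power_mult_distrib power_divide \<theta>_def)
      finally have "s * Y \<omega> \<le> \<theta> / 4 + (Y \<omega>)\<^sup>2 / (2 * b\<^sup>2)" by simp
      then show ?thesis by (simp add: W_def flip: exp_add)
    qed
    have "(\<integral>\<^sup>+\<omega>. ennreal (exp (s * Y \<omega>)) \<partial>M) \<le> (\<integral>\<^sup>+\<omega>. ennreal (exp (\<theta> / 4) * W \<omega>) \<partial>M)"
      by (intro nn_integral_mono ennreal_leI pw)
    also have "\<dots> = ennreal (expectation (\<lambda>\<omega>. exp (\<theta> / 4) * W \<omega>))"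
      using I by (intro nn_integral_eq_integral) (auto simp: W_def)
    also have "expectation (\<lambda>\<omega>. exp (\<theta> / 4) * W \<omega>) \<le> exp (\<theta> / 4) * 12" using I by simp
    also have "\<dots> \<le> exp (\<theta> / 4) * exp (10 * \<theta>)"
    proof (intro mult_left_mono)
      have "1 < \<theta>" using False by simp
      moreover from this have "1 < \<theta>\<^sup>2" by (intro one_less_power) auto
      moreover have "(10 * \<theta>)\<^sup>2 = 100 * \<theta>\<^sup>2" by (simp add: power_mult_distrib)
      ultimately have "12 \<le> 1 + 10 * \<theta> + (10 * \<theta>)\<^sup>2 / 2" by linarith
      also have "\<dots> \<le> exp (10 * \<theta>)" using \<theta>0 by (intro exp_lower_Taylor_quadratic) auto
      finally show "12 \<le> exp (10 * \<theta>)" .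
    qed auto
    also have "\<dots> \<le> exp (11 * \<theta>)" using \<theta>0 by (simp flip: exp_add)
    finally show ?thesis by (simp add: \<theta>_def ennreal_leI mult_ac)
  qed
qed

lemma (in prob_space) sg_sum_mgf:
  assumes I: "finite I" and ind: "indep_vars (\<lambda>_. borel) Y I" and sg: "\<And>i. i \<in> I \<Longrightarrow> sg_var M b (Y i)"
  shows "(\<integral>\<^sup>+\<omega>. ennreal (exp (\<Sum>i\<in>I. w i * Y i \<omega>)) \<partial>M) \<le> ennreal (exp (22 * b\<^sup>2 * (\<Sum>i\<in>I. (w i)\<^sup>2)))"
proof -
  have "(\<integral>\<^sup>+\<omega>. ennreal (exp (\<Sum>i\<in>I. w i * Y i \<omega>)) \<partial>M) = (\<integral>\<^sup>+\<omega>. (\<Prod>i\<in>I. ennreal (exp (w i * Y i \<omega>))) \<partial>M)"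
    by (simp add: exp_sum I prod_ennreal)
  also have "\<dots> = (\<Prod>i\<in>I. \<integral>\<^sup>+\<omega>. ennreal (exp (w i * Y i \<omega>)) \<partial>M)"
    by (intro indep_vars_nn_integral I indep_vars_compose2[OF ind]) auto
  also have "\<dots> \<le> (\<Prod>i\<in>I. ennreal (exp (22 * b\<^sup>2 * (w i)\<^sup>2)))"
    by (intro prod_mono_ennreal sg_var_mgf sg)
  also have "\<dots> = ennreal (exp (22 * b\<^sup>2 * (\<Sum>i\<in>I. (w i)\<^sup>2)))"
    by (simp add: prod_ennreal exp_sum I sum_distrib_left)
  finally show ?thesis .
qed

lemma (in prob_space) sg_sum_square:
  assumes I: "finite I" and ind: "indep_vars (\<lambda>_. borel) Y I" and sg: "\<And>i. i \<in> I \<Longrightarrow> sg_var M b (Y i)"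
  shows "integrable M (\<lambda>\<omega>. (\<Sum>i\<in>I. w i * Y i \<omega>)\<^sup>2)"
    and "(\<Sum>i\<in>I. (w i)\<^sup>2) \<le> expectation (\<lambda>\<omega>. (\<Sum>i\<in>I. w i * Y i \<omega>)\<^sup>2)"
proof -
  have c: "integrable M (\<lambda>\<omega>. Y i \<omega> * Y j \<omega>) \<and> (if i = j then 1 else 0) \<le> expectation (\<lambda>\<omega>. Y i \<omega> * Y j \<omega>)
      \<and> (i \<noteq> j \<longrightarrow> expectation (\<lambda>\<omega>. Y i \<omega> * Y j \<omega>) = 0)"
    if "i \<in> I" "j \<in> I" for i j
  proof (cases "i = j")
    case True
    then show ?thesis using sg_var_integrable[OF sg[OF \<open>i \<in> I\<close>]] sg_varD[OF sg[OF \<open>i \<in> I\<close>]]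
      by (simp add: power2_eq_square)
  next
    case False
    have "indep_var borel (Y i) borel (Y j)"
      using indep_vars_sum[of "{j}" i Y] indep_vars_subset[OF ind, of "{i, j}"] that False by simp
    then show ?thesis
      using indep_var_integrable[of "Y i" "Y j"] indep_var_lebesgue_integral[of "Y i" "Y j"] False
        sg_var_integrable(4)[OF sg[OF \<open>i \<in> I\<close>]] sg_var_integrable(4)[OF sg[OF \<open>j \<in> I\<close>]]
        sg_varD(2)[OF sg[OF \<open>i \<in> I\<close>]]
      by simp
  qed
  have eq: "(\<Sum>i\<in>I. w i * Y i \<omega>)\<^sup>2 = (\<Sum>i\<in>I. \<Sum>j\<in>I. w i * w j * (Y i \<omega> * Y j \<omega>))" for \<omega>
    by (simp add: power2_eq_square sum_product mult_ac)
  show "integrable M (\<lambda>\<omega>. (\<Sum>i\<in>I. w i * Y i \<omega>)\<^sup>2)"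
    unfolding eq using c by (intro Bochner_Integration.integrable_sum integrable_mult_right) auto
  have "(\<Sum>i\<in>I. (w i)\<^sup>2) = (\<Sum>i\<in>I. \<Sum>j\<in>I. if i = j then (w i)\<^sup>2 else 0)"
    using I by simp
  also have "\<dots> \<le> (\<Sum>i\<in>I. \<Sum>j\<in>I. w i * w j * expectation (\<lambda>\<omega>. Y i \<omega> * Y j \<omega>))"
  proof (intro sum_mono)
    fix i j assume "i \<in> I" "j \<in> I"
    note cij = c[OF this]
    show "(if i = j then (w i)\<^sup>2 else 0) \<le> w i * w j * expectation (\<lambda>\<omega>. Y i \<omega> * Y j \<omega>)"
    proof (cases "i = j")
      case True
      have "(w i * w i) * 1 \<le> (w i * w i) * expectation (\<lambda>\<omega>. Y i \<omega> * Y j \<omega>)"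
        using cij True by (intro mult_left_mono) auto
      then show ?thesis using True by (simp add: power2_eq_square)
    qed (use cij in simp)
  qed
  also have "\<dots> = expectation (\<lambda>\<omega>. (\<Sum>i\<in>I. w i * Y i \<omega>)\<^sup>2)"
    unfolding eq using c by (simp add: Bochner_Integration.integral_sum)
  finally show "(\<Sum>i\<in>I. (w i)\<^sup>2) \<le> expectation (\<lambda>\<omega>. (\<Sum>i\<in>I. w i * Y i \<omega>)\<^sup>2)" .
qed

text \<open>The value comes from the Paley--Zygmund argument below, with fourth moment at most \<open>512 exp 22 b\<^sup>4\<close>.\<close>

definition spread :: "real \<Rightarrow> real" where
  "spread b = 1 / (4096 * exp 22 * b ^ 4)"

lemma (in prob_space) sg_sum_spread:
  assumes I: "finite I" and ind: "indep_vars (\<lambda>_. borel) Y I" and sg: "\<And>i. i \<in> I \<Longrightarrow> sg_var M b (Y i)"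
    and w: "(\<Sum>i\<in>I. (w i)\<^sup>2) = 1"
  shows "spread b \<le> prob {\<omega> \<in> space M. 1/2 \<le> \<bar>\<Sum>i\<in>I. w i * Y i \<omega>\<bar>}"
proof -
  define S where "S \<omega> = (\<Sum>i\<in>I. w i * Y i \<omega>)" for \<omega>
  have [measurable]: "i \<in> I \<Longrightarrow> Y i \<in> borel_measurable M" for i using sg sg_varD(1) by blast
  have [measurable]: "S \<in> borel_measurable M" unfolding S_def by measurable
  have "I \<noteq> {}" using w by auto
  then have b: "b > 0" using sg sg_varD(5) by blast
  \<comment> \<open>Four times the bound on the fourth moment. The last term of the truncation
    inequality below then costs at most 1/4, and \<open>spread b\<close> is
    \<open>1 / (2 * T)\<close>.\<close>
  define T where "T = 2048 * exp 22 * b ^ 4"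
  have T: "T > 0" using b by (simp add: T_def)
  have mgf: "(\<integral>\<^sup>+\<omega>. ennreal (exp (e * S \<omega> / b)) \<partial>M) \<le> ennreal (exp 22)" if "e\<^sup>2 = 1" for e :: real
  proof -
    have "(\<integral>\<^sup>+\<omega>. ennreal (exp (e * S \<omega> / b)) \<partial>M) = (\<integral>\<^sup>+\<omega>. ennreal (exp (\<Sum>i\<in>I. (e * w i / b) * Y i \<omega>)) \<partial>M)"
      by (simp add: S_def sum_distrib_left sum_divide_distrib mult_ac)
    also have "\<dots> \<le> ennreal (exp (22 * b\<^sup>2 * (\<Sum>i\<in>I. (e * w i / b)\<^sup>2)))"
      by (intro sg_sum_mgf I ind sg)
    also have "(\<Sum>i\<in>I. (e * w i / b)\<^sup>2) = (\<Sum>i\<in>I. (w i)\<^sup>2) / b\<^sup>2"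
      using that by (simp add: power_mult_distrib power_divide sum_divide_distrib)
    finally show ?thesis using b w by simp
  qed
  have pw: "(S \<omega>) ^ 4 \<le> 256 * b ^ 4 * (exp (1 * S \<omega> / b) + exp (- 1 * S \<omega> / b))" for \<omega>
  proof -
    define a where "a = \<bar>S \<omega> / b\<bar>"
    have "a \<ge> 0" by (simp add: a_def)
    then have "(a / 4) ^ 4 \<le> (1 + a / real 4) ^ 4" by (intro power_mono) auto
    also have "\<dots> \<le> exp a" using \<open>a \<ge> 0\<close> by (intro exp_ge_one_plus_x_over_n_power_n) auto
    also have "\<dots> \<le> exp (1 * S \<omega> / b) + exp (- 1 * S \<omega> / b)" by (auto simp: a_def abs_real_def)
    finally have "a ^ 4 \<le> 256 * (exp (1 * S \<omega> / b) + exp (- 1 * S \<omega> / b))" by (simp add: power_divide)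
    moreover have "a ^ 4 = (S \<omega>) ^ 4 / b ^ 4" by (simp add: a_def power_even_abs power_divide)
    ultimately show ?thesis using b by (simp add: field_simps)
  qed
  have "(\<integral>\<^sup>+\<omega>. ennreal ((S \<omega>) ^ 4) \<partial>M) \<le>
      (\<integral>\<^sup>+\<omega>. ennreal (256 * b ^ 4) * (ennreal (exp (1 * S \<omega> / b)) + ennreal (exp (- 1 * S \<omega> / b))) \<partial>M)"
    using b by (intro nn_integral_mono) (auto simp flip: ennreal_plus ennreal_mult' intro!: ennreal_leI pw[simplified])
  also have "\<dots> = ennreal (256 * b ^ 4) *
      ((\<integral>\<^sup>+\<omega>. ennreal (exp (1 * S \<omega> / b)) \<partial>M) + (\<integral>\<^sup>+\<omega>. ennreal (exp (- 1 * S \<omega> / b)) \<partial>M))"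
    by (subst nn_integral_cmult) (auto simp: nn_integral_add)
  also have "\<dots> \<le> ennreal (256 * b ^ 4) * (ennreal (exp 22) + ennreal (exp 22))"
    by (intro mult_left_mono add_mono mgf) auto
  also have "\<dots> = ennreal (T / 4)"
    using b by (simp add: T_def mult_ac flip: ennreal_plus ennreal_mult')
  finally have n4: "(\<integral>\<^sup>+\<omega>. ennreal ((S \<omega>) ^ 4) \<partial>M) \<le> ennreal (T / 4)" .
  then have i4: "integrable M (\<lambda>\<omega>. (S \<omega>) ^ 4)"
    by (intro integrableI_nonneg) (auto simp: less_top[symmetric] top_unique)
  have e4: "expectation (\<lambda>\<omega>. (S \<omega>) ^ 4) \<le> T / 4"
    using n4 T nn_integral_eq_integral[OF i4] by (simp add: integral_nonneg_AE)
  define A where "A = {\<omega> \<in> space M. 1/2 \<le> \<bar>S \<omega>\<bar>}"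
  have [measurable]: "A \<in> sets M" unfolding A_def by measurable
  have iA: "integrable M (indicat_real A)"
    by (intro integrable_real_indicator) (auto simp: emeasure_eq_measure)
  \<comment> \<open>The square is at most 1/4 off \<open>A\<close>; on \<open>A\<close> it is at
    most \<open>T\<close> or is dominated by the fourth moment term. Integrating against a second
    moment of at least 1 leaves 1/2 for \<open>T * prob A\<close>.\<close>
  have p: "(S \<omega>)\<^sup>2 \<le> 1/4 + T * indicator A \<omega> + (S \<omega>) ^ 4 / T" if "\<omega> \<in> space M" for \<omega>
  proof (cases "\<omega> \<in> A")
    case False
    then have "\<bar>S \<omega>\<bar> \<le> 1/2" using that by (auto simp: A_def)
    then have "\<bar>S \<omega>\<bar>\<^sup>2 \<le> (1/2)\<^sup>2" by (intro power_mono) auto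
    moreover have "0 \<le> (S \<omega>) ^ 4 / T" using T by simp
    ultimately show ?thesis using False by (simp add: power2_eq_square)
  next
    case True
    have "(S \<omega>)\<^sup>2 \<le> T + (S \<omega>) ^ 4 / T"
    proof (cases "(S \<omega>)\<^sup>2 \<le> T")
      case True
      then show ?thesis using T by (simp add: add_increasing2)
    next
      case False
      have "(S \<omega>)\<^sup>2 * T \<le> (S \<omega>)\<^sup>2 * (S \<omega>)\<^sup>2" using False by (intro mult_left_mono) auto
      then have "(S \<omega>)\<^sup>2 \<le> (S \<omega>) ^ 4 / T" using T by (simp add: field_simps flip: power_add)
      then show ?thesis using T by simp
    qed
    then show ?thesis using True by simp
  qed
  have "1 \<le> expectation (\<lambda>\<omega>. (S \<omega>)\<^sup>2)"
    using sg_sum_square(2)[OF I ind sg, of w] w by (simp add: S_def)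
  also have "\<dots> \<le> expectation (\<lambda>\<omega>. 1/4 + T * indicator A \<omega> + (S \<omega>) ^ 4 / T)"
  proof (rule integral_mono)
    show "integrable M (\<lambda>\<omega>. (S \<omega>)\<^sup>2)" using sg_sum_square(1)[OF I ind sg, of w] by (simp add: S_def)
    show "integrable M (\<lambda>\<omega>. 1/4 + T * indicator A \<omega> + (S \<omega>) ^ 4 / T)"
      by (intro Bochner_Integration.integrable_add integrable_mult_right integrable_divide i4 iA) auto
  qed (rule p)
  also have "\<dots> = 1/4 + T * prob A + expectation (\<lambda>\<omega>. (S \<omega>) ^ 4) / T"
    using i4 iA by (subst Bochner_Integration.integral_add) (auto simp: prob_space)
  also have "expectation (\<lambda>\<omega>. (S \<omega>) ^ 4) / T \<le> 1/4" using e4 T by (simp add: field_simps)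
  finally have "1 / (2 * T) \<le> prob A" using T by (simp add: field_simps)
  then show ?thesis by (simp add: A_def S_def T_def spread_def mult_ac)
qed

lemma spread_bounds: "b \<ge> 1 \<Longrightarrow> 0 < spread b" "b \<ge> 1 \<Longrightarrow> spread b \<le> 1"
proof -
  assume b: "b \<ge> 1"
  then show "0 < spread b" by (simp add: spread_def)
  have "1 * (1 * 1) \<le> 4096 * (exp 22 * b ^ 4)" using b by (intro mult_mono) auto
  then show "spread b \<le> 1" using b by (simp add: spread_def field_simps mult_ac)
qed

section \<open>Matrices with independent entries\<close>

lemma (in prob_space) union_bound:
  fixes e :: real
  assumes "finite N" "\<And>p. p \<in> N \<Longrightarrow> {\<omega> \<in> space M. P p \<omega>} \<in> events"
    and "\<And>p. p \<in> N \<Longrightarrow> prob {\<omega> \<in> space M. P p \<omega>} \<le> e"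
  shows "prob {\<omega> \<in> space M. \<exists>p\<in>N. P p \<omega>} \<le> card N * e"
proof -
  have eq: "{\<omega> \<in> space M. \<exists>p\<in>N. P p \<omega>} = (\<Union>p\<in>N. {\<omega> \<in> space M. P p \<omega>})" by auto
  have "prob (\<Union>p\<in>N. {\<omega> \<in> space M. P p \<omega>}) \<le> (\<Sum>p\<in>N. prob {\<omega> \<in> space M. P p \<omega>})"
    using assms by (intro finite_measure_subadditive_finite) auto
  also have "\<dots> \<le> (\<Sum>p\<in>N. e)" by (intro sum_mono assms)
  finally show ?thesis unfolding eq by simp
qed

lemma (in prob_space) indep_vars_reindex:
  assumes ind: "indep_vars (\<lambda>_. N) X I" and f: "inj_on f J" "f ` J \<subseteq> I"
  shows "indep_vars (\<lambda>_. N) (\<lambda>j. X (f j)) J"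
proof -
  have "indep_vars (\<lambda>j. PiM {f j} (\<lambda>_. N)) (\<lambda>j \<omega>. restrict (\<lambda>i. X i \<omega>) {f j}) J"
    using f by (intro indep_vars_restrict[OF ind]) (auto simp: disjoint_family_on_def inj_on_def)
  then have "indep_vars (\<lambda>_. N) (\<lambda>j \<omega>. (\<lambda>g. g (f j)) (restrict (\<lambda>i. X i \<omega>) {f j})) J"
    by (rule indep_vars_compose2) auto
  then show ?thesis by simp
qed

abbreviation indep_matrix :: "'a measure \<Rightarrow> nat set \<Rightarrow> nat set \<Rightarrow> (nat \<times> nat \<Rightarrow> 'a \<Rightarrow> real) \<Rightarrow> bool" where
  "indep_matrix M I J G \<equiv> prob_space.indep_vars M (\<lambda>_. borel) G (I \<times> J)"

lemma (in prob_space) indep_matrix_row: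
  assumes "indep_matrix M I J G" "i \<in> I"
  shows "indep_vars (\<lambda>_. borel) (\<lambda>j. G (i, j)) J"
  using assms by (intro indep_vars_reindex[where f = "Pair i" and I = "I \<times> J"]) (auto simp: inj_on_def)

text \<open>The matrix-vector product, for a matrix given as a function on index pairs. Rows and
  columns can be deleted by changing the index sets, and the matrix is transposed by composing with
  \<open>prod.swap\<close>, without any reindexing.\<close>

definition mv :: "nat set \<Rightarrow> (nat \<times> nat \<Rightarrow> real) \<Rightarrow> (nat \<Rightarrow> real) \<Rightarrow> nat \<Rightarrow> real" where
  "mv J g x i = (\<Sum>j\<in>J. x j * g (i, j))"

lemma (in prob_space) indep_matrix_mv:
  assumes "indep_matrix M I J G" "finite J"
  shows "indep_vars (\<lambda>_. borel) (\<lambda>i \<omega>. mv J (\<lambda>p. G p \<omega>) x i) I"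
proof -
  have "indep_vars (\<lambda>i. PiM ({i} \<times> J) (\<lambda>_. borel)) (\<lambda>i \<omega>. restrict (\<lambda>p. G p \<omega>) ({i} \<times> J)) I"
    by (intro indep_vars_restrict[OF assms(1)]) (auto simp: disjoint_family_on_def)
  then have "indep_vars (\<lambda>_. borel) (\<lambda>i \<omega>. (\<lambda>g. mv J g x i) (restrict (\<lambda>p. G p \<omega>) ({i} \<times> J))) I"
    by (rule indep_vars_compose2) (auto simp: mv_def)
  then show ?thesis by (simp add: mv_def cong: sum.cong)
qed

text \<open>Tensorization: in the Chernoff bound for a sum of independent squares the Laplace
  transform factorizes. For this reason the small ball estimates are stated as bounds on the
  expectation of \<open>exp (- l * S\<^sup>2)\<close> and not as probabilities.\<close>

lemma (in prob_space) indep_square_sum_small: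
  assumes I: "finite I" and ind: "indep_vars (\<lambda>_. borel) S I" and q: "q \<ge> 0" and l: "l > 0"
    and le: "\<And>i. i \<in> I \<Longrightarrow> (\<integral>\<^sup>+\<omega>. ennreal (exp (- l * (S i \<omega>)\<^sup>2)) \<partial>M) \<le> ennreal q"
  shows "prob {\<omega> \<in> space M. (\<Sum>i\<in>I. (S i \<omega>)\<^sup>2) \<le> u} \<le> exp (l * u) * q ^ card I"
proof -
  have [measurable]: "i \<in> I \<Longrightarrow> S i \<in> borel_measurable M" for i using ind by (auto simp: indep_vars_def)
  have "emeasure M {\<omega> \<in> space M. (\<Sum>i\<in>I. (S i \<omega>)\<^sup>2) \<le> u} \<le>
     ennreal (exp (l * u)) * (\<integral>\<^sup>+\<omega>. ennreal (exp (- l * (\<Sum>i\<in>I. (S i \<omega>)\<^sup>2))) * indicator (space M) \<omega> \<partial>M)"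
    by (intro Chernoff_ineq_nn_integral_le l) measurable
  also have "(\<integral>\<^sup>+\<omega>. ennreal (exp (- l * (\<Sum>i\<in>I. (S i \<omega>)\<^sup>2))) * indicator (space M) \<omega> \<partial>M)
      = (\<integral>\<^sup>+\<omega>. (\<Prod>i\<in>I. ennreal (exp (- l * (S i \<omega>)\<^sup>2))) \<partial>M)"
  proof (intro nn_integral_cong)
    fix \<omega> assume "\<omega> \<in> space M"
    have "- l * (\<Sum>i\<in>I. (S i \<omega>)\<^sup>2) = (\<Sum>i\<in>I. - l * (S i \<omega>)\<^sup>2)" by (rule sum_distrib_left)
    then show "ennreal (exp (- l * (\<Sum>i\<in>I. (S i \<omega>)\<^sup>2))) * indicator (space M) \<omega> = (\<Prod>i\<in>I. ennreal (exp (- l * (S i \<omega>)\<^sup>2)))"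
      using \<open>\<omega> \<in> space M\<close> by (simp only: exp_sum[OF I]) (simp add: prod_ennreal)
  qed
  also have "\<dots> = (\<Prod>i\<in>I. \<integral>\<^sup>+\<omega>. ennreal (exp (- l * (S i \<omega>)\<^sup>2)) \<partial>M)"
    by (intro indep_vars_nn_integral I indep_vars_compose2[OF ind]) auto
  also have "\<dots> \<le> (\<Prod>i\<in>I. ennreal q)" by (intro prod_mono_ennreal le)
  also have "(\<Prod>i\<in>I. ennreal q) = ennreal (q ^ card I)" using q by (simp add: ennreal_power)
  finally have "emeasure M {\<omega> \<in> space M. (\<Sum>i\<in>I. (S i \<omega>)\<^sup>2) \<le> u} \<le> ennreal (exp (l * u) * q ^ card I)"
    by (simp add: ennreal_mult' mult_left_mono)
  then show ?thesis using q by (simp add: emeasure_eq_measure)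
qed

text \<open>On the event of \<open>sg_sum_spread\<close> the integrand is at most
  \<open>exp (- 1)\<close>, hence at most 1/2, and elsewhere it is at most 1.\<close>

lemma (in prob_space) sg_sum_laplace:
  assumes I: "finite I" and ind: "indep_vars (\<lambda>_. borel) Y I" and sg: "\<And>i. i \<in> I \<Longrightarrow> sg_var M b (Y i)"
    and w: "(\<Sum>i\<in>I. (w i)\<^sup>2) = 1"
  shows "(\<integral>\<^sup>+\<omega>. ennreal (exp (- 4 * (\<Sum>i\<in>I. w i * Y i \<omega>)\<^sup>2)) \<partial>M) \<le> ennreal (exp (- spread b / 2))"
proof -
  define S where "S \<omega> = (\<Sum>i\<in>I. w i * Y i \<omega>)" for \<omega>
  have [measurable]: "i \<in> I \<Longrightarrow> Y i \<in> borel_measurable M" for i using sg sg_varD(1) by blast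
  have [measurable]: "S \<in> borel_measurable M" unfolding S_def by measurable
  define A where "A = {\<omega> \<in> space M. 1/2 \<le> \<bar>S \<omega>\<bar>}"
  have [measurable]: "A \<in> sets M" unfolding A_def by measurable
  have iA: "integrable M (indicat_real A)"
    by (intro integrable_real_indicator) (auto simp: emeasure_eq_measure)
  have p: "exp (- 4 * (S \<omega>)\<^sup>2) \<le> 1 - indicator A \<omega> / 2" for \<omega>
  proof (cases "\<omega> \<in> A")
    case True
    then have "(1/2)\<^sup>2 \<le> \<bar>S \<omega>\<bar>\<^sup>2" by (intro power_mono) (auto simp: A_def)
    then have "exp (- 4 * (S \<omega>)\<^sup>2) \<le> exp (-1)" by (simp add: power2_eq_square)
    also have "exp (-1 :: real) \<le> 1/2" using exp_ge_add_one_self[of "1::real"] by (simp add: exp_minus field_simps)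
    finally show ?thesis using True by simp
  qed simp
  have "(\<integral>\<^sup>+\<omega>. ennreal (exp (- 4 * (S \<omega>)\<^sup>2)) \<partial>M) \<le> (\<integral>\<^sup>+\<omega>. ennreal (1 - indicator A \<omega> / 2) \<partial>M)"
    by (intro nn_integral_mono ennreal_leI p)
  also have "\<dots> = ennreal (expectation (\<lambda>\<omega>. 1 - indicator A \<omega> / 2))"
    using iA by (intro nn_integral_eq_integral Bochner_Integration.integrable_diff) (auto split: split_indicator)
  also have "expectation (\<lambda>\<omega>. 1 - indicator A \<omega> / 2) = 1 - prob A / 2"
    using iA by (subst Bochner_Integration.integral_diff) (auto simp: prob_space)
  also have "\<dots> \<le> 1 + (- spread b / 2)"
    using sg_sum_spread[OF I ind sg w] by (simp add: A_def S_def)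
  also have "\<dots> \<le> exp (- spread b / 2)" by (rule exp_ge_add_one_self)
  finally show ?thesis by (simp add: S_def ennreal_leI)
qed

text \<open>Normalizing \<open>x\<close> reduces this to tensorization with \<open>l = 4\<close>.
  The fraction 1/16 is chosen so that the factor \<open>exp (4 * u)\<close> consumes exactly half of
  the exponent gained from the rows.\<close>

lemma (in prob_space) mv_small_prob:
  assumes fin: "finite I" "finite J" and ind: "indep_matrix M I J G"
    and sg: "\<And>p. p \<in> I \<times> J \<Longrightarrow> sg_var M b (G p)" and q: "(\<Sum>j\<in>J. (x j)\<^sup>2) = r" and r: "r > 0"
  shows "prob {\<omega> \<in> space M. (\<Sum>i\<in>I. (mv J (\<lambda>p. G p \<omega>) x i)\<^sup>2) \<le> r * (spread b * card I / 16)}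
    \<le> exp (- spread b * card I / 4)"
proof -
  define y where "y j = x j / sqrt r" for j
  have y: "(\<Sum>j\<in>J. (y j)\<^sup>2) = 1"
    using q r by (simp add: y_def power_divide flip: sum_divide_distrib)
  have mvy: "(mv J g x i)\<^sup>2 = r * (mv J g y i)\<^sup>2" for g i
  proof -
    have "mv J g x i = sqrt r * mv J g y i"
      unfolding mv_def sum_distrib_left using r by (intro sum.cong) (auto simp: y_def)
    then show ?thesis using r by (simp add: power_mult_distrib)
  qed
  have "prob {\<omega> \<in> space M. (\<Sum>i\<in>I. (mv J (\<lambda>p. G p \<omega>) y i)\<^sup>2) \<le> spread b * card I / 16}
     \<le> exp (4 * (spread b * card I / 16)) * exp (- spread b / 2) ^ card I"
  proof (intro indep_square_sum_small fin)
    show "indep_vars (\<lambda>_. borel) (\<lambda>i \<omega>. mv J (\<lambda>p. G p \<omega>) y i) I"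
      by (intro indep_matrix_mv ind fin)
    fix i assume "i \<in> I"
    then show "(\<integral>\<^sup>+\<omega>. ennreal (exp (- 4 * (mv J (\<lambda>p. G p \<omega>) y i)\<^sup>2)) \<partial>M) \<le> ennreal (exp (- spread b / 2))"
      unfolding mv_def by (intro sg_sum_laplace fin indep_matrix_row[OF ind] sg y) auto
  qed auto
  also have "exp (4 * (spread b * card I / 16)) * exp (- spread b / 2) ^ card I = exp (- spread b * card I / 4)"
    by (simp flip: exp_add exp_of_nat_mult add: field_simps)
  finally show ?thesis
    using r by (simp add: mvy flip: sum_distrib_left)
qed

section \<open>Lattice nets and the operator norm\<close>

lemma sum_geometric_int:
  fixes x :: real
  assumes "0 < x" "x < 1" "0 \<le> v"
  shows "(\<Sum>k\<in>{- int m..int m}. (if k = 0 then 1 else v) * x ^ nat \<bar>k\<bar>) \<le> 1 + 2 * v * x / (1 - x)"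
proof -
  have "(\<Sum>k\<in>{- int m..int m}. (if k = 0 then 1 else v) * x ^ nat \<bar>k\<bar>) = 1 + 2 * v * (x - x ^ Suc m) / (1 - x)"
  proof (induction m)
    case (Suc m)
    have "{- int (Suc m)..int (Suc m)} = insert (- int (Suc m)) (insert (int (Suc m)) {- int m..int m})" by auto
    then have "(\<Sum>k\<in>{- int (Suc m)..int (Suc m)}. (if k = 0 then 1 else v) * x ^ nat \<bar>k\<bar>)
      = 2 * v * x ^ Suc m + (1 + 2 * v * (x - x ^ Suc m) / (1 - x))"
      using Suc by (simp add: nat_add_distrib nat_minus_as_int)
    also have "\<dots> = 1 + 2 * v * (x - x ^ Suc (Suc m)) / (1 - x)"
      using assms by (simp add: field_simps)
    finally show ?case .
  qed simp
  also have "\<dots> \<le> 1 + 2 * v * x / (1 - x)"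
    using assms by (intro add_left_mono divide_right_mono mult_left_mono) auto
  finally show ?thesis .
qed

text \<open>Exponential weights: each point of \<open>T\<close> has weight at least \<open>v powr k * x powr L\<close>, and the total weight of the
  lattice factorizes over the coordinates.\<close>

lemma card_lattice_points:
  fixes T :: "('i \<Rightarrow> int) set" and x v k L :: real
  assumes A: "finite A" and T: "T \<subseteq> A \<rightarrow>\<^sub>E UNIV"
    and k: "\<And>p. p \<in> T \<Longrightarrow> card {i \<in> A. p i \<noteq> 0} \<le> k"
    and L: "\<And>p. p \<in> T \<Longrightarrow> (\<Sum>i\<in>A. \<bar>real_of_int (p i)\<bar>) \<le> L"
    and x: "0 < x" "x < 1" and v: "0 < v" "v \<le> 1"
  shows "finite T" and "card T \<le> v powr (- k) * x powr (- L) * (1 + 2 * v * x / (1 - x)) ^ card A"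
proof -
  \<comment> \<open>Every coordinate of a point of \<open>T\<close> is at most \<open>L\<close> in
    absolute value. The box makes the generating sum finite, and its bound does not depend on
    \<open>m\<close>.\<close>
  define m where "m = nat \<lfloor>L\<rfloor>"
  define B where "B = A \<rightarrow>\<^sub>E {- int m..int m}"
  have TB: "T \<subseteq> B"
  proof
    fix p assume p: "p \<in> T"
    have "p i \<in> {- int m..int m}" if "i \<in> A" for i
    proof -
      have "\<bar>real_of_int (p i)\<bar> \<le> (\<Sum>i\<in>A. \<bar>real_of_int (p i)\<bar>)" using A that by (intro member_le_sum) auto
      with L[OF p] have "real_of_int \<bar>p i\<bar> \<le> L" by simp
      then show ?thesis unfolding m_def by (auto simp: abs_le_iff) linarith+
    qed
    then show "p \<in> B" using p T by (auto simp: B_def PiE_iff)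
  qed
  have finB: "finite B" unfolding B_def by (intro finite_PiE A) auto
  then show "finite T" using TB finite_subset by blast
  define g :: "int \<Rightarrow> real" where "g k = (if k = 0 then 1 else v) * x ^ nat \<bar>k\<bar>" for k
  have g0: "g k \<ge> 0" for k using x v by (simp add: g_def)
  have low: "v powr k * x powr L \<le> (\<Prod>i\<in>A. g (p i))" if p: "p \<in> T" for p
  proof -
    have "(\<Prod>i\<in>A. g (p i)) = (\<Prod>i\<in>A. if p i \<noteq> 0 then v else 1) * (\<Prod>i\<in>A. x ^ nat \<bar>p i\<bar>)"
      unfolding g_def prod.distrib by (intro arg_cong2[where f = "(*)"] prod.cong) auto
    also have "(\<Prod>i\<in>A. if p i \<noteq> 0 then v else 1) = v powr real (card {i \<in> A. p i \<noteq> 0})"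
      using A v by (simp add: prod.inter_filter[symmetric] powr_realpow)
    also have "(\<Prod>i\<in>A. x ^ nat \<bar>p i\<bar>) = x powr real (\<Sum>i\<in>A. nat \<bar>p i\<bar>)"
      using powr_realpow[OF x(1), of "\<Sum>i\<in>A. nat \<bar>p i\<bar>"] by (simp only: power_sum)
    also have "real (\<Sum>i\<in>A. nat \<bar>p i\<bar>) = (\<Sum>i\<in>A. \<bar>real_of_int (p i)\<bar>)" by simp
    finally have e: "(\<Prod>i\<in>A. g (p i)) = v powr real (card {i \<in> A. p i \<noteq> 0}) * x powr (\<Sum>i\<in>A. \<bar>real_of_int (p i)\<bar>)" .
    show ?thesis unfolding e using k[OF p] L[OF p] x v
      by (intro mult_mono powr_mono') auto
  qed
  have "card T * (v powr k * x powr L) = (\<Sum>p\<in>T. v powr k * x powr L)" by simp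
  also have "\<dots> \<le> (\<Sum>p\<in>T. \<Prod>i\<in>A. g (p i))" by (intro sum_mono low)
  also have "\<dots> \<le> (\<Sum>p\<in>B. \<Prod>i\<in>A. g (p i))"
    by (intro sum_mono2 finB TB prod_nonneg ballI g0)
  also have "\<dots> = (\<Prod>i\<in>A. \<Sum>k\<in>{- int m..int m}. g k)"
    unfolding B_def by (intro prod_sum_PiE[symmetric] A) auto
  also have "\<dots> = (\<Sum>k\<in>{- int m..int m}. g k) ^ card A" by simp
  also have "\<dots> \<le> (1 + 2 * v * x / (1 - x)) ^ card A"
    unfolding g_def using x v by (intro power_mono sum_geometric_int sum_nonneg) auto
  finally show "card T \<le> v powr (- k) * x powr (- L) * (1 + 2 * v * x / (1 - x)) ^ card A"
    using x v by (simp add: powr_minus field_simps)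
qed

text \<open>The radius is \<open>2 * sqrt n\<close>: a vector of length at most
  \<open>sqrt n\<close> with at most \<open>n\<close> coordinates moves by at most
  \<open>sqrt n\<close> when each coordinate is rounded.\<close>

definition netpts :: "nat set \<Rightarrow> nat \<Rightarrow> (nat \<Rightarrow> int) set" where
  "netpts A n = {p \<in> A \<rightarrow>\<^sub>E UNIV. (\<Sum>i\<in>A. (p i)\<^sup>2) \<le> 4 * int n}"

text \<open>Cauchy-Schwarz on the support. It turns sparsity into a smaller sum of absolute values,
  the quantity through which \<open>card_lattice_points\<close> counts.\<close>

lemma sum_abs_le_sqrt:
  fixes p :: "'i \<Rightarrow> int" and s u :: real
  assumes "finite A" "card {i \<in> A. p i \<noteq> 0} \<le> s" "(\<Sum>i\<in>A. (real_of_int (p i))\<^sup>2) \<le> u\<^sup>2" "u \<ge> 0"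
  shows "(\<Sum>i\<in>A. \<bar>real_of_int (p i)\<bar>) \<le> sqrt s * u"
proof -
  let ?S = "{i \<in> A. p i \<noteq> 0}"
  have s: "s \<ge> 0" using assms(2) by linarith
  have "(\<Sum>i\<in>A. \<bar>real_of_int (p i)\<bar>) = (\<Sum>i\<in>?S. \<bar>real_of_int (p i)\<bar>)"
    using assms(1) by (intro sum.mono_neutral_right) auto
  then have "(\<Sum>i\<in>A. \<bar>real_of_int (p i)\<bar>)\<^sup>2 = (\<Sum>i\<in>?S. \<bar>real_of_int (p i)\<bar>)\<^sup>2" by simp
  also have "\<dots> \<le> (\<Sum>i\<in>?S. \<bar>real_of_int (p i)\<bar>\<^sup>2) * card ?S"
    by (rule sum_squared_le_sum_of_squares)
  also have "(\<Sum>i\<in>?S. \<bar>real_of_int (p i)\<bar>\<^sup>2) = (\<Sum>i\<in>A. (real_of_int (p i))\<^sup>2)"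
    using assms(1) by (intro sum.mono_neutral_cong_left) auto
  also have "\<dots> * card ?S \<le> u\<^sup>2 * s"
    using assms by (intro mult_mono sum_nonneg) auto
  also have "\<dots> = (sqrt s * u)\<^sup>2"
    using s by (simp add: power_mult_distrib)
  finally show ?thesis by (rule power2_le_imp_le) (use assms(4) s in simp)
qed

lemma netpts:
  assumes A: "finite A" "card A \<le> n"
  shows "finite (netpts A n)" "card (netpts A n) \<le> (12::real) ^ n"
proof -
  have k: "card {i \<in> A. p i \<noteq> 0} \<le> real n" for p :: "nat \<Rightarrow> int"
    using card_mono[of A "{i \<in> A. p i \<noteq> 0}"] A by auto
  have L: "(\<Sum>i\<in>A. \<bar>real_of_int (p i)\<bar>) \<le> 2 * real n" if "p \<in> netpts A n" for p
  proof -
    have "real_of_int (\<Sum>i\<in>A. (p i)\<^sup>2) \<le> of_int (4 * int n)"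
      using that by (simp add: netpts_def del: of_int_sum)
    then have "(\<Sum>i\<in>A. \<bar>real_of_int (p i)\<bar>) \<le> sqrt (real n) * (2 * sqrt (real n))"
      by (intro sum_abs_le_sqrt A k) (auto simp: power_mult_distrib)
    also have "\<dots> = 2 * real n" by simp
    finally show ?thesis .
  qed
  have T: "netpts A n \<subseteq> A \<rightarrow>\<^sub>E UNIV" by (auto simp: netpts_def)
  \<comment> \<open>With weight 1/2 the bound \<open>2 * n\<close> on the sum of absolute values
    costs \<open>4 ^ n\<close>, and each coordinate contributes a factor 3.\<close>
  note * = card_lattice_points[OF A(1) T k L, where x = "1/2" and v = 1]
  show "finite (netpts A n)" by (rule *) auto
  have "card (netpts A n) \<le> (1/2) powr (- (2 * real n)) * 3 ^ card A" using *(2) by simp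
  also have "(1/2::real) powr (- (2 * real n)) = 4 ^ n"
    by (simp add: powr_minus powr_divide powr_realpow[symmetric] powr_powr[symmetric])
  also have "4 ^ n * 3 ^ card A \<le> 4 ^ n * (3::real) ^ n" using A by (intro mult_left_mono power_increasing) auto
  also have "\<dots> = 12 ^ n" by (simp flip: power_mult_distrib)
  finally show "card (netpts A n) \<le> (12::real) ^ n" by simp
qed

section \<open>The operator norm through rounding of bilinear forms\<close>

lemma L2_set_square: "(L2_set f A)\<^sup>2 = (\<Sum>i\<in>A. (f i)\<^sup>2)"
  unfolding L2_set_def by (simp add: sum_nonneg)

text \<open>Rounding each coordinate in the direction of the sign of its coefficient never decreases a linear form. Applied to each
  argument of a bilinear form, this bounds its norm by its maximum on the net, without an approximation argument.\<close>

lemma round_linear: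
  fixes c x :: "nat \<Rightarrow> real"
  assumes A: "finite A" "card A \<le> n" and x: "(\<Sum>i\<in>A. (x i)\<^sup>2) \<le> n"
  shows "\<exists>p\<in>netpts A n. (\<Sum>i\<in>A. c i * x i) \<le> (\<Sum>i\<in>A. c i * p i)"
proof -
  define p where "p = (\<lambda>i\<in>A. if c i \<ge> 0 then \<lceil>x i\<rceil> else \<lfloor>x i\<rfloor>)"
  have d: "\<bar>real_of_int (p i) - x i\<bar> \<le> 1" "c i * x i \<le> c i * p i" if "i \<in> A" for i
    using that by (auto simp: p_def mult_left_mono mult_left_mono_neg) linarith+
  have "L2_set (\<lambda>i. real_of_int (p i)) A \<le> L2_set x A + L2_set (\<lambda>i. real_of_int (p i) - x i) A"
    using L2_set_triangle_ineq[of x "\<lambda>i. real_of_int (p i) - x i" A] by simp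
  also have "L2_set x A \<le> sqrt n" using x by (simp add: L2_set_def)
  also have "L2_set (\<lambda>i. real_of_int (p i) - x i) A \<le> sqrt n"
  proof -
    have "(\<Sum>i\<in>A. (real_of_int (p i) - x i)\<^sup>2) \<le> (\<Sum>i\<in>A. 1)"
      using d(1) by (intro sum_mono) (simp add: abs_square_le_1)
    also have "\<dots> \<le> n" using A by simp
    finally show ?thesis by (simp add: L2_set_def)
  qed
  finally have "L2_set (\<lambda>i. real_of_int (p i)) A \<le> 2 * sqrt n" by simp
  then have "(L2_set (\<lambda>i. real_of_int (p i)) A)\<^sup>2 \<le> (2 * sqrt n)\<^sup>2" by (intro power_mono) auto
  then have "real_of_int (\<Sum>i\<in>A. (p i)\<^sup>2) \<le> real_of_int (4 * int n)"
    by (simp add: L2_set_square power_mult_distrib)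
  then have "(\<Sum>i\<in>A. (p i)\<^sup>2) \<le> 4 * int n" by (simp only: of_int_le_iff)
  then have "p \<in> netpts A n" by (auto simp: netpts_def p_def)
  moreover have "(\<Sum>i\<in>A. c i * x i) \<le> (\<Sum>i\<in>A. c i * p i)" using d(2) by (intro sum_mono)
  ultimately show ?thesis by blast
qed

text \<open>Both vectors are scaled to length \<open>sqrt n\<close>, so the threshold corresponds to
  an operator norm of \<open>360 * b * sqrt n\<close>. The Chernoff exponent is at most
  \<open>- 360 * n + 352 * n\<close>, where 352 is 22 times 16; the remaining \<open>- 8 * n\<close>
  outweighs the two nets, which together have at most \<open>exp (6 * n)\<close> elements.\<close>

definition op_bad :: "nat set \<Rightarrow> nat set \<Rightarrow> nat \<Rightarrow> real \<Rightarrow> (nat \<times> nat \<Rightarrow> real) \<Rightarrow> bool" where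
  "op_bad I J n b g \<longleftrightarrow> (\<exists>pq\<in>netpts I n \<times> netpts J n.
     360 * b * n * sqrt n \<le> (\<Sum>i\<in>I. real_of_int (fst pq i) * mv J g (\<lambda>j. real_of_int (snd pq j)) i))"

lemma mv_scale: "mv J g (\<lambda>j. c * x j) i = c * mv J g x i"
  by (simp add: mv_def sum_distrib_left mult_ac)

lemma mv_add: "mv J g (\<lambda>j. x j + y j) i = mv J g x i + mv J g y i"
  by (simp add: mv_def ring_distribs sum.distrib)

lemma op_good_bound:
  assumes fin: "finite I" "card I \<le> n" "finite J" "card J \<le> n" and n: "n \<ge> 1" and b: "b > 0"
    and good: "\<not> op_bad I J n b g"
  shows "L2_set (mv J g x) I \<le> 360 * b * sqrt n * L2_set x J"
proof (cases "L2_set (mv J g x) I = 0 \<or> L2_set x J = 0")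
  case True
  have "L2_set (mv J g x) I = 0" if "L2_set x J = 0"
    using that fin by (auto simp: L2_set_eq_0_iff mv_def)
  then show ?thesis using True b by (auto simp: L2_set_nonneg)
next
  case False
  define a where "a = L2_set x J"
  define c where "c = L2_set (mv J g x) I"
  have ac: "a > 0" "c > 0" using False L2_set_nonneg[of x J] L2_set_nonneg[of "mv J g x" I] by (auto simp: a_def c_def less_le)
  define x' where "x' = (\<lambda>j. (sqrt n / a) * x j)"
  \<comment> \<open>A multiple of the image itself, so that pairing it with the image of
    \<open>x'\<close> gives exactly \<open>n * c / a\<close>.\<close>
  define y' where "y' = (\<lambda>i. (sqrt n / c) * mv J g x i)"
  have nx: "(\<Sum>j\<in>J. (x' j)\<^sup>2) \<le> n"
  proof -
    have "(\<Sum>j\<in>J. (x' j)\<^sup>2) = (n / a\<^sup>2) * (\<Sum>j\<in>J. (x j)\<^sup>2)"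
      unfolding sum_distrib_left x'_def by (intro sum.cong) (auto simp: power_mult_distrib power_divide)
    also have "(\<Sum>j\<in>J. (x j)\<^sup>2) = a\<^sup>2" by (simp add: a_def L2_set_square)
    finally show ?thesis using ac by simp
  qed
  have ny: "(\<Sum>i\<in>I. (y' i)\<^sup>2) \<le> n"
  proof -
    have "(\<Sum>i\<in>I. (y' i)\<^sup>2) = (n / c\<^sup>2) * (\<Sum>i\<in>I. (mv J g x i)\<^sup>2)"
      unfolding sum_distrib_left y'_def by (intro sum.cong) (auto simp: power_mult_distrib power_divide)
    also have "(\<Sum>i\<in>I. (mv J g x i)\<^sup>2) = c\<^sup>2" by (simp add: c_def L2_set_square)
    finally show ?thesis using ac by simp
  qed
  obtain p where p: "p \<in> netpts I n" "(\<Sum>i\<in>I. mv J g x' i * y' i) \<le> (\<Sum>i\<in>I. mv J g x' i * p i)"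
    using round_linear[OF fin(1,2) ny, of "mv J g x'"] by blast
  obtain q where q: "q \<in> netpts J n" "(\<Sum>j\<in>J. (\<Sum>i\<in>I. p i * g (i, j)) * x' j) \<le> (\<Sum>j\<in>J. (\<Sum>i\<in>I. p i * g (i, j)) * q j)"
    using round_linear[OF fin(3,4) nx, of "\<lambda>j. \<Sum>i\<in>I. p i * g (i, j)"] by blast
  have sw: "(\<Sum>j\<in>J. (\<Sum>i\<in>I. p i * g (i, j)) * z j) = (\<Sum>i\<in>I. p i * mv J g z i)" for z :: "nat \<Rightarrow> real"
  proof -
    have "(\<Sum>j\<in>J. (\<Sum>i\<in>I. p i * g (i, j)) * z j) = (\<Sum>i\<in>I. \<Sum>j\<in>J. p i * g (i, j) * z j)"
      unfolding sum_distrib_right by (rule sum.swap)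
    also have "\<dots> = (\<Sum>i\<in>I. p i * mv J g z i)"
      unfolding mv_def sum_distrib_left by (intro sum.cong) auto
    finally show ?thesis .
  qed
  have "n * c / a = (\<Sum>i\<in>I. mv J g x' i * y' i)"
  proof -
    have "(\<Sum>i\<in>I. mv J g x' i * y' i) = (\<Sum>i\<in>I. (n / (a * c)) * (mv J g x i)\<^sup>2)"
      unfolding x'_def y'_def mv_scale using ac by (intro sum.cong) (auto simp: power2_eq_square field_simps)
    also have "\<dots> = (n / (a * c)) * c\<^sup>2" by (simp only: sum_distrib_left[symmetric] L2_set_square c_def)
    also have "\<dots> = n * c / a" using ac by (simp add: power2_eq_square field_simps)
    finally show ?thesis by simp
  qed
  also have "\<dots> \<le> (\<Sum>i\<in>I. p i * mv J g q i)" using p(2) q(2) unfolding sw by (simp add: mult.commute)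
  also have "\<dots> \<le> 360 * b * n * sqrt n"
    using good p(1) q(1) unfolding op_bad_def by (force simp: not_le)
  finally have "n * c \<le> n * (360 * b * sqrt n * a)" using ac by (simp add: field_simps)
  then show ?thesis using n by (simp add: a_def c_def)
qed

lemma op_bad_measurable:
  assumes fin: "finite I" "card I \<le> n" "finite J" "card J \<le> n"
    and [measurable]: "\<And>p. p \<in> I \<times> J \<Longrightarrow> G p \<in> borel_measurable M"
  shows "{\<omega> \<in> space M. op_bad I J n b (\<lambda>p. G p \<omega>)} \<in> sets M"
  unfolding op_bad_def mv_def
  using netpts(1)[OF fin(1,2)] netpts(1)[OF fin(3,4)]
  by (intro sets.sets_Collect_finite_Ex finite_cartesian_product) measurable

lemma (in prob_space) op_bad_prob:
  assumes fin: "finite I" "card I \<le> n" "finite J" "card J \<le> n" and n: "n \<ge> 1"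
    and b: "b > 0" and ind: "indep_matrix M I J G" and sg: "\<And>p. p \<in> I \<times> J \<Longrightarrow> sg_var M b (G p)"
  shows "prob {\<omega> \<in> space M. op_bad I J n b (\<lambda>p. G p \<omega>)} \<le> exp (- real n)"
proof -
  note [measurable] = sg_varD(1)[OF sg]
  have single: "prob {\<omega> \<in> space M. 360 * b * n * sqrt n \<le> (\<Sum>i\<in>I. real_of_int (fst pq i) * mv J (\<lambda>p. G p \<omega>) (\<lambda>j. real_of_int (snd pq j)) i)} \<le> exp (- 8 * real n)"
    if pq: "pq \<in> netpts I n \<times> netpts J n" for pq
  proof -
    obtain p q where pq_eq: "pq = (p, q)" by force
    define s where "s = 1 / (b * sqrt n)"
    have s: "s > 0" using b n by (simp add: s_def)
    define Z where "Z \<omega> = (\<Sum>i\<in>I. p i * mv J (\<lambda>p. G p \<omega>) q i)" for \<omega>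
    have Zm[measurable]: "Z \<in> borel_measurable M" unfolding Z_def mv_def by measurable
    have sZ: "s * Z \<omega> = (\<Sum>r\<in>I \<times> J. (s * p (fst r) * q (snd r)) * G r \<omega>)" for \<omega>
      unfolding Z_def mv_def sum_distrib_left
      by (subst sum.cartesian_product) (auto intro!: sum.cong simp: mult_ac)
    have w: "(\<Sum>r\<in>I \<times> J. (s * p (fst r) * q (snd r))\<^sup>2) \<le> 16 * n / b\<^sup>2"
    proof -
      have p2: "(\<Sum>i\<in>I. (real_of_int (p i))\<^sup>2) \<le> 4 * real n"
        using pq by (auto simp: pq_eq netpts_def simp flip: of_int_le_iff[where 'a=real])
      have q2: "(\<Sum>i\<in>J. (real_of_int (q i))\<^sup>2) \<le> 4 * real n"
        using pq by (auto simp: pq_eq netpts_def simp flip: of_int_le_iff[where 'a=real])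
      have "(\<Sum>r\<in>I \<times> J. (s * p (fst r) * q (snd r))\<^sup>2)
          = (\<Sum>i\<in>I. \<Sum>j\<in>J. s\<^sup>2 * ((real_of_int (p i))\<^sup>2 * (real_of_int (q j))\<^sup>2))"
        by (subst sum.cartesian_product) (auto intro!: sum.cong simp: power_mult_distrib)
      also have "\<dots> = s\<^sup>2 * ((\<Sum>i\<in>I. (real_of_int (p i))\<^sup>2) * (\<Sum>j\<in>J. (real_of_int (q j))\<^sup>2))"
        by (simp only: sum_product) (simp only: sum_distrib_left)
      also have "\<dots> \<le> s\<^sup>2 * ((4 * real n) * (4 * real n))"
        by (intro mult_left_mono mult_mono p2 q2 sum_nonneg) auto
      also have "\<dots> = 16 * n / b\<^sup>2" 
      proof -
        have "s\<^sup>2 = 1 / (b\<^sup>2 * n)" by (simp add: s_def power_divide power_mult_distrib)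
        then show ?thesis using n b by simp
      qed
      finally show ?thesis .
    qed
    have "emeasure M {\<omega> \<in> space M. Z \<omega> \<ge> 360 * b * n * sqrt n} \<le>
      ennreal (exp (- s * (360 * b * n * sqrt n))) * (\<integral>\<^sup>+\<omega>. ennreal (exp (s * Z \<omega>)) * indicator (space M) \<omega> \<partial>M)"
      by (intro Chernoff_ineq_nn_integral_ge s) measurable
    also have "(\<integral>\<^sup>+\<omega>. ennreal (exp (s * Z \<omega>)) * indicator (space M) \<omega> \<partial>M) = (\<integral>\<^sup>+\<omega>. ennreal (exp (s * Z \<omega>)) \<partial>M)"
      by (intro nn_integral_cong) simp
    also have "\<dots> \<le> ennreal (exp (22 * b\<^sup>2 * (\<Sum>r\<in>I \<times> J. (s * p (fst r) * q (snd r))\<^sup>2)))"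
      unfolding sZ using fin sg by (intro sg_sum_mgf ind) auto
    also have "\<dots> \<le> ennreal (exp (22 * b\<^sup>2 * (16 * n / b\<^sup>2)))"
      by (intro ennreal_leI exp_le_cancel_iff[THEN iffD2] mult_left_mono w) auto
    also have "22 * b\<^sup>2 * (16 * n / b\<^sup>2) = 352 * real n" using b by simp
    also have "- s * (360 * b * n * sqrt n) = - 360 * real n" using b n by (simp add: s_def)
    finally have "emeasure M {\<omega> \<in> space M. Z \<omega> \<ge> 360 * b * n * sqrt n} \<le> ennreal (exp (- 360 * real n)) * ennreal (exp (352 * real n))"
      by (simp add: mult_left_mono)
    then show ?thesis by (simp add: emeasure_eq_measure Z_def pq_eq flip: ennreal_mult' exp_add)
  qed
  have e12: "(12::real) ^ n \<le> exp 3 ^ n"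
  proof (intro power_mono)
    have "(5/2::real) \<le> exp 1" using exp_lower_Taylor_quadratic[of "1::real"] by simp
    then have "(5/2::real) ^ 3 \<le> exp 1 ^ 3" by (intro power_mono) auto
    also have "exp (1::real) ^ 3 = exp 3" by (simp flip: exp_of_nat_mult)
    finally show "(12::real) \<le> exp 3" by (simp add: power3_eq_cube)
  qed auto
  have "prob {\<omega> \<in> space M. op_bad I J n b (\<lambda>p. G p \<omega>)} \<le> card (netpts I n \<times> netpts J n) * exp (- 8 * real n)"
    unfolding op_bad_def
    using netpts(1)[OF fin(1,2)] netpts(1)[OF fin(3,4)]
    by (intro union_bound[OF _ _ single]) (auto simp: mv_def)
  also have "real (card (netpts I n \<times> netpts J n)) \<le> 12 ^ n * 12 ^ n"
    using netpts[OF fin(1,2)] netpts[OF fin(3,4)] by (auto simp: card_cartesian_product intro!: mult_mono)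
  also have "(12::real) ^ n * 12 ^ n \<le> exp 3 ^ n * exp 3 ^ n" by (intro mult_mono e12) auto
  also have "exp (3::real) ^ n * exp 3 ^ n * exp (- 8 * real n) = exp (- 2 * real n)"
    by (simp flip: exp_of_nat_mult exp_add)
  also have "\<dots> \<le> exp (- real n)" by simp
  finally show ?thesis by simp
qed

section \<open>Compressible vectors\<close>

text \<open>The best approximation to \<open>x\<close> supported on \<open>S\<close> has as its
  error the part of \<open>x\<close> outside \<open>S\<close>. So this is distance at most
  \<open>r\<close> from a vector with at most \<open>k\<close> nonzero coordinates.\<close>

definition compressible :: "nat set \<Rightarrow> real \<Rightarrow> real \<Rightarrow> (nat \<Rightarrow> real) \<Rightarrow> bool" where
  "compressible J k r x \<longleftrightarrow> (\<exists>S\<subseteq>J. real (card S) \<le> k \<and> (\<Sum>j\<in>J - S. (x j)\<^sup>2) \<le> r\<^sup>2)"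

text \<open>The net points are meant at scale \<open>h = r / sqrt k\<close>. The two bounds on the
  sum of squares say that \<open>h * p\<close> has length between 1/2 and 2; in particular
  \<open>p\<close> is not zero.\<close>

definition comp_net :: "nat set \<Rightarrow> real \<Rightarrow> real \<Rightarrow> (nat \<Rightarrow> int) set" where
  "comp_net J k r = {p \<in> J \<rightarrow>\<^sub>E UNIV. real (card {j \<in> J. p j \<noteq> 0}) \<le> k \<and>
     k / (4 * r\<^sup>2) \<le> (\<Sum>j\<in>J. (real_of_int (p j))\<^sup>2) \<and> (\<Sum>j\<in>J. (real_of_int (p j))\<^sup>2) \<le> 4 * k / r\<^sup>2}"

definition comp_bad :: "nat set \<Rightarrow> nat set \<Rightarrow> real \<Rightarrow> real \<Rightarrow> real \<Rightarrow> (nat \<times> nat \<Rightarrow> real) \<Rightarrow> bool" where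
  "comp_bad I J k r b g \<longleftrightarrow> (\<exists>p\<in>comp_net J k r.
     (\<Sum>i\<in>I. (mv J g p i)\<^sup>2) \<le> (\<Sum>j\<in>J. (real_of_int (p j))\<^sup>2) * (spread b * card I / 16))"

text \<open>The parameter \<open>v\<close> is the weight of a nonzero coordinate. A small
  \<open>v\<close> lowers the cost per coordinate, \<open>2 * v * card J\<close>, and raises the
  cost of the support. Using \<open>1 / v\<close> as a bound for \<open>ln (1 / v)\<close> avoids
  logarithms in the later constants.\<close>

lemma comp_net:
  fixes k r v :: real
  assumes J: "finite J" and k: "k > 0" and r: "r > 0" and v: "0 < v" "v \<le> 1"
  shows "finite (comp_net J k r)" "card (comp_net J k r) \<le> exp (k / v + 2 * k / r + 2 * v * card J)"
proof -
  have L: "(\<Sum>j\<in>J. \<bar>real_of_int (p j)\<bar>) \<le> 2 * k / r" if "p \<in> comp_net J k r" for p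
  proof -
    have "(\<Sum>j\<in>J. (real_of_int (p j))\<^sup>2) \<le> (2 * sqrt k / r)\<^sup>2"
      using that k by (simp add: comp_net_def power_divide power_mult_distrib)
    then have "(\<Sum>j\<in>J. \<bar>real_of_int (p j)\<bar>) \<le> sqrt k * (2 * sqrt k / r)"
      using that k r by (intro sum_abs_le_sqrt J) (auto simp: comp_net_def)
    also have "\<dots> = 2 * k / r" using k by simp
    finally show ?thesis .
  qed
  have T: "comp_net J k r \<subseteq> J \<rightarrow>\<^sub>E UNIV" by (auto simp: comp_net_def)
  have kk: "card {j \<in> J. p j \<noteq> 0} \<le> k" if "p \<in> comp_net J k r" for p
    using that by (simp add: comp_net_def)
  note * = card_lattice_points[OF J T kk L, where x = "1/2" and v = v]
  show "finite (comp_net J k r)" by (rule *) (use v in auto)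
  have "card (comp_net J k r) \<le> v powr (- k) * (1/2) powr (- (2 * k / r)) * (1 + 2 * v) ^ card J"
    using *(2) v by (simp add: mult.commute[of 2 v])
  also have "\<dots> \<le> exp (k / v) * exp (2 * k / r) * exp (2 * v) ^ card J"
  proof (intro mult_mono power_mono)
    have "- k * ln v = k * ln (1 / v)" using v by (simp add: ln_div)
    also have "\<dots> \<le> k * (1 / v)" using v k ln_le_minus_one[of "1/v"] by (intro mult_left_mono) auto
    finally show "v powr (- k) \<le> exp (k / v)" using v by (simp add: powr_def)
    have "- (2 * k / r) * ln (1/2) = (2 * k / r) * ln 2" by (simp add: ln_div)
    also have "\<dots> \<le> (2 * k / r) * 1" using k r ln_le_minus_one[of "2::real"] by (intro mult_left_mono) auto
    finally show "(1/2) powr (- (2 * k / r)) \<le> exp (2 * k / r)" by (simp add: powr_def)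
  qed (use v in auto)
  also have "\<dots> = exp (k / v + 2 * k / r + 2 * v * card J)"
    by (simp add: exp_add mult_ac flip: exp_of_nat_mult)
  finally show "card (comp_net J k r) \<le> exp (k / v + 2 * k / r + 2 * v * card J)" .
qed

lemma comp_bad_measurable:
  assumes fin: "finite I" "finite J" and k: "k > 0" and r: "r > 0"
    and [measurable]: "\<And>p. p \<in> I \<times> J \<Longrightarrow> G p \<in> borel_measurable M"
  shows "{\<omega> \<in> space M. comp_bad I J k r b (\<lambda>p. G p \<omega>)} \<in> sets M"
  unfolding comp_bad_def mv_def
  using comp_net(1)[OF fin(2) k r, of 1]
  by (intro sets.sets_Collect_finite_Ex) (simp_all, measurable)

lemma (in prob_space) comp_bad_prob:
  assumes fin: "finite I" "finite J" and J: "card J \<le> n" and I: "n \<le> 2 * card I" and b: "b \<ge> 1"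
    and k: "k > 0" "k * (64 / spread b + 2 / r) \<le> spread b * n / 32" and r: "r > 0"
    and ind: "indep_matrix M I J G" and sg: "\<And>p. p \<in> I \<times> J \<Longrightarrow> sg_var M b (G p)"
  shows "prob {\<omega> \<in> space M. comp_bad I J k r b (\<lambda>p. G p \<omega>)} \<le> exp (- spread b * n / 16)"
proof -
  note [measurable] = sg_varD(1)[OF sg]
  note p = spread_bounds[OF b]
  \<comment> \<open>With this weight the term linear in \<open>card J\<close> is at most
    \<open>spread b * n / 32\<close>. The hypothesis on \<open>k\<close> bounds the other two terms
    by the same amount, and together they use half of the exponent \<open>spread b * n / 8\<close>
    gained from at least \<open>n / 2\<close> rows.\<close>
  have v: "0 < spread b / 64" "spread b / 64 \<le> 1" using p by auto
  note net = comp_net[OF fin(2) k(1) r v]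
  have "prob {\<omega> \<in> space M. comp_bad I J k r b (\<lambda>p. G p \<omega>)}
      \<le> card (comp_net J k r) * exp (- spread b * card I / 4)"
    unfolding comp_bad_def
  proof (intro union_bound net(1) mv_small_prob fin ind sg refl)
    fix q assume "q \<in> comp_net J k r"
    moreover have "0 < k / (4 * r\<^sup>2)" using k r by simp
    ultimately show "0 < (\<Sum>j\<in>J. (real_of_int (q j))\<^sup>2)" by (auto simp: comp_net_def)
  qed (auto simp: mv_def)
  also have "\<dots> \<le> exp (k / (spread b / 64) + 2 * k / r + 2 * (spread b / 64) * card J) * exp (- spread b * card I / 4)"
    by (intro mult_right_mono net) auto
  also have "\<dots> \<le> exp (spread b * n / 16) * exp (- spread b * n / 8)"
  proof (intro mult_mono)
    have "k / (spread b / 64) + 2 * k / r = k * (64 / spread b + 2 / r)" by (simp add: field_simps)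
    moreover have "2 * (spread b / 64) * card J \<le> 2 * (spread b / 64) * n" using J p by (intro mult_left_mono) auto
    moreover have "2 * (spread b / 64) * n = spread b * n / 32" by simp
    ultimately show "exp (k / (spread b / 64) + 2 * k / r + 2 * (spread b / 64) * card J) \<le> exp (spread b * n / 16)"
      using k(2) by (simp only: exp_le_cancel_iff)
    have "spread b * real n \<le> spread b * real (2 * card I)" using I p by (intro mult_left_mono) linarith+
    then show "exp (- spread b * card I / 4) \<le> exp (- spread b * n / 8)" by (simp add: mult_ac)
  qed auto
  also have "\<dots> = exp (- spread b * n / 16)" by (simp flip: exp_add)
  finally show ?thesis .
qed

text \<open>Rounding \<open>x\<close> on the sparse support with mesh \<open>h\<close> and dropping
  the rest moves it by at most \<open>2 * r\<close>. The resulting net point has an image of length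
  at least \<open>sqrt (spread b * n) / 12\<close>, and by the operator norm bound and the condition
  on \<open>r\<close> the error destroys at most half of that.\<close>

lemma comp_good_bound:
  assumes fin: "finite I" "card I \<le> n" "finite J" "card J \<le> n" and n: "n \<ge> 1" "n \<le> 2 * card I" and b: "b \<ge> 1"
    and k: "k > 0" and r: "r > 0" "360 * b * r \<le> sqrt (spread b) / 48"
    and good: "\<not> op_bad I J n b g" "\<not> comp_bad I J k r b g"
    and x: "(\<Sum>j\<in>J. (x j)\<^sup>2) = 1" and comp: "compressible J k r x"
  shows "sqrt (spread b * n) / 24 \<le> L2_set (mv J g x) I"
proof -
  note p = spread_bounds[OF b]
  obtain S where S: "S \<subseteq> J" "card S \<le> k" "(\<Sum>j\<in>J - S. (x j)\<^sup>2) \<le> r\<^sup>2"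
    using comp by (auto simp: compressible_def)
  define h where "h = r / sqrt k"
  have h: "h > 0" "h\<^sup>2 = r\<^sup>2 / k" using k r by (auto simp: h_def power_divide)
  define q where "q = (\<lambda>j\<in>J. if j \<in> S then \<lfloor>x j / h\<rfloor> else 0)"
  define z where "z j = h * q j" for j
  have zx: "\<bar>x j - z j\<bar> \<le> h" if "j \<in> S" for j
  proof -
    have "\<bar>x j / h - q j\<bar> \<le> 1" using that S(1) by (auto simp: q_def) linarith
    then have "h * \<bar>x j / h - q j\<bar> \<le> h * 1" using h by (intro mult_left_mono) auto
    moreover have "x j - z j = h * (x j / h - q j)" using h by (simp add: z_def field_simps)
    ultimately show ?thesis using h by (simp add: abs_mult)
  qed
  have "(\<Sum>j\<in>J. (x j - z j)\<^sup>2) = (\<Sum>j\<in>J - S. (x j - z j)\<^sup>2) + (\<Sum>j\<in>S. (x j - z j)\<^sup>2)"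
    using S(1) fin by (intro sum.subset_diff) auto
  also have "(\<Sum>j\<in>J - S. (x j - z j)\<^sup>2) = (\<Sum>j\<in>J - S. (x j)\<^sup>2)" by (intro sum.cong) (auto simp: z_def q_def)
  also have "(\<Sum>j\<in>S. (x j - z j)\<^sup>2) \<le> (\<Sum>j\<in>S. h\<^sup>2)"
    using power_mono[OF zx abs_ge_zero, of _ 2] by (intro sum_mono) simp
  also have "\<dots> \<le> k * h\<^sup>2" using S(2) by (simp add: mult_right_mono)
  also have "k * h\<^sup>2 = r\<^sup>2" using k h by simp
  finally have "(\<Sum>j\<in>J. (x j - z j)\<^sup>2) \<le> (\<Sum>j\<in>J - S. (x j)\<^sup>2) + r\<^sup>2" by simp
  moreover have "(2 * r)\<^sup>2 = 4 * r\<^sup>2" by (simp add: power_mult_distrib)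
  ultimately have d: "(\<Sum>j\<in>J. (x j - z j)\<^sup>2) \<le> (2 * r)\<^sup>2" using S(3) zero_le_power2[of r] by linarith
  then have dist: "L2_set (\<lambda>j. x j - z j) J \<le> 2 * r" using r by (simp add: L2_set_def real_le_lsqrt sum_nonneg)
  have x1: "L2_set x J = 1" using x by (simp add: L2_set_def)
  have sp: "sqrt (spread b) \<le> 1" using p by simp
  have "360 * 1 * r \<le> 360 * b * r" using b r by (intro mult_mono) auto
  then have r4: "r \<le> 1/4" using r sp by linarith
  have zn: "1/2 \<le> L2_set z J" "L2_set z J \<le> 2"
    using L2_set_triangle_ineq[of "\<lambda>j. x j - z j" z J] L2_set_triangle_ineq[of x "\<lambda>j. z j - x j" J] dist x1 r4
    by (auto simp: L2_set_def power2_commute)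
  have zq: "L2_set z J ^ 2 = h\<^sup>2 * (\<Sum>j\<in>J. (real_of_int (q j))\<^sup>2)"
    by (simp add: L2_set_square z_def power_mult_distrib sum_distrib_left)
  have qn: "q \<in> comp_net J k r"
  proof -
    have "{j \<in> J. q j \<noteq> 0} \<subseteq> S" by (auto simp: q_def)
    then have "card {j \<in> J. q j \<noteq> 0} \<le> card S" using S fin finite_subset by (intro card_mono) auto
    then have 1: "card {j \<in> J. q j \<noteq> 0} \<le> k" using S(2) by linarith
    have "(1/2)\<^sup>2 \<le> L2_set z J ^ 2" "L2_set z J ^ 2 \<le> 2\<^sup>2" using zn by (intro power_mono; simp)+
    then have 2: "k / (4 * r\<^sup>2) \<le> (\<Sum>j\<in>J. (real_of_int (q j))\<^sup>2)" "(\<Sum>j\<in>J. (real_of_int (q j))\<^sup>2) \<le> 4 * k / r\<^sup>2"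
      unfolding zq h using k r by (auto simp: field_simps power2_eq_square)
    show ?thesis using 1 2 by (auto simp: comp_net_def q_def)
  qed
  have "(1/2)\<^sup>2 * (spread b * card I / 16) \<le> L2_set z J ^ 2 * (spread b * card I / 16)"
    using zn p by (intro mult_right_mono power_mono) auto
  also have "\<dots> = h\<^sup>2 * ((\<Sum>j\<in>J. (real_of_int (q j))\<^sup>2) * (spread b * card I / 16))" by (simp add: zq)
  also have "\<dots> \<le> h\<^sup>2 * (\<Sum>i\<in>I. (mv J g q i)\<^sup>2)"
    using good(2) qn unfolding comp_bad_def by (intro mult_left_mono) (auto simp: not_le less_imp_le)
  also have "\<dots> = (L2_set (mv J g z) I)\<^sup>2"
    unfolding z_def L2_set_square mv_scale by (simp add: power_mult_distrib sum_distrib_left)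
  finally have "spread b * card I / 64 \<le> (L2_set (mv J g z) I)\<^sup>2" by (simp add: power2_eq_square)
  \<comment> \<open>Having at least \<open>n / 2\<close> rows gives
    \<open>spread b * n / 128\<close>, and 144 is a perfect square above 128.\<close>
  moreover have "(sqrt (spread b * n) / 12)\<^sup>2 \<le> spread b * card I / 64"
  proof -
    have "spread b * n \<le> spread b * real (2 * card I)" using n p by (intro mult_left_mono) linarith+
    moreover have "0 \<le> spread b * card I" using p by simp
    ultimately show ?thesis using p by (simp add: power_divide)
  qed
  ultimately have "(sqrt (spread b * n) / 12)\<^sup>2 \<le> (L2_set (mv J g z) I)\<^sup>2" by linarith
  then have lz: "sqrt (spread b * n) / 12 \<le> L2_set (mv J g z) I" by (rule power2_le_imp_le) (rule L2_set_nonneg)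
  have "L2_set (mv J g (\<lambda>j. z j - x j)) I \<le> 360 * b * sqrt n * L2_set (\<lambda>j. z j - x j) J"
    using b by (intro op_good_bound fin n good) auto
  also have "L2_set (\<lambda>j. z j - x j) J = L2_set (\<lambda>j. x j - z j) J" by (simp add: L2_set_def power2_commute)
  also have "360 * b * sqrt n * \<dots> \<le> 360 * b * sqrt n * (2 * r)" using b by (intro mult_left_mono dist) auto
  also have "\<dots> = (360 * b * r) * (2 * sqrt n)" by simp
  also have "\<dots> \<le> (sqrt (spread b) / 48) * (2 * sqrt n)" by (intro mult_right_mono r) auto
  also have "\<dots> = sqrt (spread b * n) / 24" by (simp add: real_sqrt_mult)
  finally have err: "L2_set (mv J g (\<lambda>j. z j - x j)) I \<le> sqrt (spread b * n) / 24" .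
  have "mv J g z = (\<lambda>i. mv J g x i + mv J g (\<lambda>j. z j - x j) i)" by (auto simp: mv_add[symmetric])
  then have "L2_set (mv J g z) I \<le> L2_set (mv J g x) I + L2_set (mv J g (\<lambda>j. z j - x j)) I"
    by (metis L2_set_triangle_ineq)
  with lz err show ?thesis by linarith
qed

section \<open>Small ball probabilities and the least common denominator\<close>

lemma one_minus_cos_ge:
  assumes "\<bar>d\<bar> \<le> 1/2"
  shows "8 * d\<^sup>2 \<le> 1 - cos (2 * pi * d)"
proof -
  define e where "e = \<bar>d\<bar>"
  have e: "0 \<le> e" "e \<le> 1/2" using assms by (auto simp: e_def)
  \<comment> \<open>By concavity the sine lies above its chord on the quarter period; the double
    angle formula then gives the quadratic bound.\<close>
  have "convex_on {0..pi/2} (\<lambda>x. - sin x)"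
    by (rule convex_on_realI[where f' = "\<lambda>x. - cos x"])
      (auto intro!: derivative_eq_intros cos_monotone_0_pi_le)
  from convex_onD[OF this, of "2 * e" 0 "pi/2"] e have "2 * e \<le> sin (pi * e)" by (simp add: mult_ac)
  then have "(2 * e)\<^sup>2 \<le> (sin (pi * e))\<^sup>2" using e by (intro power_mono) auto
  moreover have "cos (2 * pi * d) = cos (2 * (pi * e))" by (auto simp add: e_def abs_if mult.assoc)
  ultimately show ?thesis unfolding cos_double_sin by (simp add: e_def power_mult_distrib)
qed

text \<open>The distance of \<open>w a\<close> to the integer lattice.\<close>

definition dz :: "'i set \<Rightarrow> ('i \<Rightarrow> real) \<Rightarrow> real \<Rightarrow> real" where
  "dz J a w = L2_set (\<lambda>i. w * a i - of_int (round (w * a i))) J"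

lemma dz_le: "dz J a w \<le> L2_set (\<lambda>i. w * a i - of_int (p i)) J"
  unfolding dz_def L2_set_def
  by (intro real_sqrt_le_mono sum_mono) (simp add: abs_le_square_iff[symmetric] round_diff_minimal)

lemma dz_nonneg: "0 \<le> dz J a w"
  by (simp add: dz_def L2_set_nonneg)

lemma dz_add: "dz J a (w + w') \<le> dz J a w + dz J a w'"
proof -
  have "dz J a (w + w') \<le> L2_set (\<lambda>i. (w + w') * a i - of_int (round (w * a i) + round (w' * a i))) J"
    by (rule dz_le)
  also have "\<dots> = L2_set (\<lambda>i. (w * a i - of_int (round (w * a i))) + (w' * a i - of_int (round (w' * a i)))) J"
    by (intro arg_cong2[where f = L2_set] ext) (auto simp: algebra_simps)
  also have "\<dots> \<le> dz J a w + dz J a w'" unfolding dz_def by (rule L2_set_triangle_ineq)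
  finally show ?thesis .
qed

lemma dz_minus [simp]: "dz J a (- w) = dz J a w"
proof -
  have le: "dz J a (- w) \<le> dz J a w" for w
  proof -
    have "dz J a (- w) \<le> L2_set (\<lambda>i. - w * a i - of_int (- round (w * a i))) J" by (rule dz_le)
    also have "\<dots> = dz J a w" by (simp add: dz_def L2_set_def power2_commute)
    finally show ?thesis .
  qed
  from le[of w] le[of "- w"] show ?thesis by simp
qed

lemma dz_le_abs: "dz J a w \<le> \<bar>w\<bar> * L2_set a J"
proof -
  have "dz J a w \<le> L2_set (\<lambda>i. w * a i - of_int 0) J" by (rule dz_le)
  also have "\<dots> = \<bar>w\<bar> * L2_set a J"
    by (simp add: L2_set_def power_mult_distrib sum_distrib_left[symmetric] real_sqrt_mult)
  finally show ?thesis .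
qed

text \<open>Rounding is discontinuous, but the distance to the lattice is Lipschitz by subadditivity
  and symmetry. Continuity yields the minimizer on an interval used below, as well as
  measurability.\<close>

lemma continuous_dz [continuous_intros]:
  assumes "continuous_on S f"
  shows "continuous_on S (\<lambda>x. dz J a (f x))"
proof -
  have "(L2_set a J)-lipschitz_on UNIV (dz J a)"
  proof (rule lipschitz_onI)
    fix w w' :: real
    note d = dz_minus[of J a "w - w'"]
    have "dz J a w \<le> dz J a w' + dz J a (w - w')" "dz J a w' \<le> dz J a w + dz J a (- (w - w'))"
      using dz_add[of J a w' "w - w'"] dz_add[of J a w "- (w - w')"] by auto
    then show "dist (dz J a w) (dz J a w') \<le> L2_set a J * dist w w'"
      using dz_le_abs[of J a "w - w'"] d by (simp add: dist_real_def abs_le_iff mult.commute[of "L2_set a J"])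
  qed (rule L2_set_nonneg)
  then have "continuous_on UNIV (dz J a)" by (rule lipschitz_on_continuous_on)
  then show ?thesis using assms continuous_on_compose2 by blast
qed

lemma borel_measurable_dz [measurable]: "dz J a \<in> borel_measurable borel"
  by (intro borel_measurable_continuous_onI continuous_intros)

text \<open>\<open>lcd J a r \<alpha> D\<close> says that the least common denominator of the unit vector \<open>a\<close>, with parameters \<open>r\<close> and \<open>\<alpha>\<close>,
  is at least \<open>D\<close>.\<close>

definition lcd :: "'i set \<Rightarrow> ('i \<Rightarrow> real) \<Rightarrow> real \<Rightarrow> real \<Rightarrow> real \<Rightarrow> bool" where
  "lcd J a r \<alpha> D \<longleftrightarrow> (\<forall>w. 0 < w \<and> w < D \<longrightarrow> min (r * w) \<alpha> \<le> dz J a w)"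

section \<open>Gaussian averages of the distance to the lattice\<close>

lemma nn_integral_gaussian:
  assumes "c > 0"
  shows "(\<integral>\<^sup>+x. ennreal (exp (- c * (x - m)\<^sup>2)) \<partial>lborel) = ennreal (sqrt (pi / c))"
proof -
  define s where "s = 1 / sqrt (2 * c)"
  have s: "s > 0" "s\<^sup>2 = 1 / (2 * c)" using assms by (auto simp: s_def power_divide)
  have "exp (- c * (x - m)\<^sup>2) = sqrt (pi / c) * normal_density m s x" for x
    unfolding normal_density_def s using assms by (simp add: real_sqrt_divide)
  then have "(\<integral>\<^sup>+x. ennreal (exp (- c * (x - m)\<^sup>2)) \<partial>lborel) = (\<integral>\<^sup>+x. ennreal (sqrt (pi / c)) * ennreal (normal_density m s x) \<partial>lborel)"
    using assms by (simp add: ennreal_mult')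
  also have "\<dots> = ennreal (sqrt (pi / c)) * (\<integral>\<^sup>+x. ennreal (normal_density m s x) \<partial>lborel)"
    by (rule nn_integral_cmult) simp
  also have "(\<integral>\<^sup>+x. ennreal (normal_density m s x) \<partial>lborel) = 1"
    using s by (subst nn_integral_eq_integral) (auto simp: integral_normal_density)
  finally show ?thesis by simp
qed

text \<open>Taking the minimizer \<open>g\<^sub>0\<close> of \<open>dz\<close> on the interval, subadditivity gives
  \<open>dz (\<eta> (g - g\<^sub>0)) \<le> 2 dz (\<eta> g)\<close>, so that only the behaviour of \<open>dz\<close> near 0 matters.\<close>

lemma dz_interval_integral:
  assumes h: "h > 0" and eta: "\<eta> \<noteq> 0" "\<bar>\<eta>\<bar> * h < D" and lcd: "lcd J a r \<alpha> D"
    and pos: "\<beta> > 0" "r > 0" "\<alpha> \<ge> 0"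
  shows "(\<integral>\<^sup>+g. ennreal (exp (- \<beta> * (dz J a (\<eta> * g))\<^sup>2)) * indicator {x..x + h} g \<partial>lborel)
    \<le> ennreal (sqrt (4 * pi / \<beta>) / (r * \<bar>\<eta>\<bar>) + h * exp (- \<beta> * \<alpha>\<^sup>2 / 4))"
proof -
  have "\<exists>g0\<in>{x..x + h}. \<forall>g\<in>{x..x + h}. dz J a (\<eta> * g0) \<le> dz J a (\<eta> * g)"
    using h by (intro continuous_attains_inf continuous_intros) auto
  then obtain g0 where g0: "g0 \<in> {x..x + h}" "\<And>g. g \<in> {x..x + h} \<Longrightarrow> dz J a (\<eta> * g0) \<le> dz J a (\<eta> * g)"
    by blast
  define c where "c = \<beta> / 4 * (r * \<eta>)\<^sup>2"
  have c: "c > 0" using pos eta by (simp add: c_def)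
  have pw: "exp (- \<beta> * (dz J a (\<eta> * g))\<^sup>2) \<le> exp (- c * (g - g0)\<^sup>2) + exp (- \<beta> * \<alpha>\<^sup>2 / 4)" if g: "g \<in> {x..x + h}" for g
  proof -
    define w where "w = \<bar>\<eta>\<bar> * \<bar>g - g0\<bar>"
    have "\<bar>g - g0\<bar> \<le> h" using g g0(1) by auto
    then have "w \<le> \<bar>\<eta>\<bar> * h" unfolding w_def by (intro mult_left_mono) auto
    then have wD: "w < D" using eta by linarith
    have "dz J a w = dz J a (\<eta> * g + \<eta> * (- g0))"
    proof -
      have "w = \<eta> * g + \<eta> * (- g0) \<or> w = - (\<eta> * g + \<eta> * (- g0))"
        unfolding w_def by (auto simp: abs_if algebra_simps)
      then show ?thesis by (metis dz_minus)
    qed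
    also have "\<dots> \<le> dz J a (\<eta> * g) + dz J a (\<eta> * g0)" using dz_add[of J a "\<eta> * g" "- (\<eta> * g0)"] by simp
    also have "\<dots> \<le> 2 * dz J a (\<eta> * g)" using g0(2)[OF g] by simp
    finally have dw: "dz J a w \<le> 2 * dz J a (\<eta> * g)" .
    have w0: "w \<ge> 0" by (simp add: w_def)
    have "min (r * w) \<alpha> \<le> dz J a w"
    proof (cases "w = 0")
      case True
      then show ?thesis using dz_nonneg[of J a w] by (simp add: min_le_iff_disj)
    qed (use lcd wD w0 in \<open>auto simp: lcd_def\<close>)
    with dw have "min (r * w) \<alpha> \<le> 2 * dz J a (\<eta> * g)" by linarith
    then have "(min (r * w) \<alpha>)\<^sup>2 \<le> (2 * dz J a (\<eta> * g))\<^sup>2"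
      using w0 pos by (intro power_mono) auto
    then have "\<beta> * (min (r * w) \<alpha>)\<^sup>2 \<le> \<beta> * (4 * (dz J a (\<eta> * g))\<^sup>2)"
      using pos by (intro mult_left_mono) (auto simp: power_mult_distrib)
    then have "exp (- \<beta> * (dz J a (\<eta> * g))\<^sup>2) \<le> exp (- \<beta> / 4 * (min (r * w) \<alpha>)\<^sup>2)" by simp
    also have "\<dots> \<le> exp (- \<beta> / 4 * (r * w)\<^sup>2) + exp (- \<beta> / 4 * \<alpha>\<^sup>2)"
      by (auto simp: min_def)
    also have "\<beta> / 4 * (r * w)\<^sup>2 = c * (g - g0)\<^sup>2" by (simp add: c_def w_def power_mult_distrib)
    then have "- \<beta> / 4 * (r * w)\<^sup>2 = - c * (g - g0)\<^sup>2" by simp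
    finally show ?thesis by simp
  qed
  have "(\<integral>\<^sup>+g. ennreal (exp (- \<beta> * (dz J a (\<eta> * g))\<^sup>2)) * indicator {x..x + h} g \<partial>lborel)
     \<le> (\<integral>\<^sup>+g. ennreal (exp (- c * (g - g0)\<^sup>2)) + ennreal (exp (- \<beta> * \<alpha>\<^sup>2 / 4)) * indicator {x..x + h} g \<partial>lborel)"
    using pw by (intro nn_integral_mono) (auto split: split_indicator simp: ennreal_leI simp flip: ennreal_plus)
  also have "\<dots> = ennreal (sqrt (pi / c)) + ennreal (exp (- \<beta> * \<alpha>\<^sup>2 / 4)) * ennreal h"
    using h by (subst nn_integral_add) (auto simp: nn_integral_gaussian[OF c, simplified] nn_integral_cmult)
  also have "\<dots> = ennreal (sqrt (pi / c) + exp (- \<beta> * \<alpha>\<^sup>2 / 4) * h)"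
    using h c by (simp add: ennreal_mult' ennreal_plus)
  also have "sqrt (pi / c) = sqrt (4 * pi / \<beta>) / (r * \<bar>\<eta>\<bar>)"
  proof -
    have "pi / c = (4 * pi / \<beta>) / (r * \<eta>)\<^sup>2" by (simp add: c_def field_simps)
    then show ?thesis using pos by (simp add: real_sqrt_divide real_sqrt_mult abs_mult)
  qed
  finally show ?thesis by (simp add: mult.commute)
qed

text \<open>Averaging over windows of length \<open>h\<close>, the Gaussian density being comparable within a window.\<close>

lemma gaussian_window_bound:
  assumes [measurable]: "f \<in> borel_measurable borel" and h: "0 < h" "h \<le> 1"
    and R: "\<And>x. (\<integral>\<^sup>+g. ennreal (f g) * indicator {x..x + h} g \<partial>lborel) \<le> ennreal R" and R0: "R \<ge> 0"
    and f0: "\<And>x. f x \<ge> 0"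
  shows "(\<integral>\<^sup>+g. ennreal (std_normal_density g) * ennreal (f g) \<partial>lborel) \<le> ennreal (4 * R / h)"
proof -
  \<comment> \<open>The standard density at \<open>g\<close> is bounded by a Gaussian of variance 2
    at the left end of the window: \<open>(g - x)\<^sup>2 \<le> 1\<close> and
    \<open>0 \<le> (2 * g - x)\<^sup>2\<close> combine to the exponent inequality, and the factor
    \<open>exp (1/2)\<close> is absorbed by \<open>sqrt (2 * pi)\<close>.\<close>
  have den: "std_normal_density g \<le> exp (- (1/4) * (x - 0)\<^sup>2)" if "g \<in> {x..x + h}" for x g
  proof -
    have "\<bar>g - x\<bar> \<le> 1" using that h by auto
    then have "(g - x)\<^sup>2 \<le> 1" by (simp add: abs_square_le_1)
    moreover have "0 \<le> (2 * g - x)\<^sup>2" by simp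
    ultimately have e: "- g\<^sup>2 / 2 \<le> 1/2 + - (1/4) * (x - 0)\<^sup>2" by (simp add: power2_eq_square algebra_simps)
    have "2 \<le> sqrt (2 * pi)" using pi_gt3 by (intro real_le_rsqrt) simp
    then have "1 / sqrt (2 * pi) \<le> 1 / 2" by (intro divide_left_mono) auto
    moreover have "exp (1/2::real) \<le> 2" using exp_bound[of "1/2::real"] by (simp add: power2_eq_square)
    ultimately have "1 / sqrt (2 * pi) * exp (1/2) \<le> 1/2 * 2" by (intro mult_mono) auto
    have "std_normal_density g \<le> 1 / sqrt (2 * pi) * exp (1/2 + - (1/4) * (x - 0)\<^sup>2)"
      unfolding std_normal_density_def using e by (intro mult_left_mono) auto
    also have "\<dots> = (1 / sqrt (2 * pi) * exp (1/2)) * exp (- (1/4) * (x - 0)\<^sup>2)" by (simp only: exp_add mult.assoc)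
    also have "\<dots> \<le> 1 * exp (- (1/4) * (x - 0)\<^sup>2)"
      using \<open>1 / sqrt (2 * pi) * exp (1/2) \<le> 1/2 * 2\<close> by (intro mult_right_mono) auto
    finally show ?thesis by simp
  qed
  have ind: "indicator {x..x + h} g = (indicator {g - h..g} x :: ennreal)" for x g by (auto split: split_indicator)
  have [measurable]: "(\<lambda>p. indicator {fst p..fst p + h} (snd p) :: ennreal) \<in> borel_measurable (borel \<Otimes>\<^sub>M borel)"
  proof -
    have "(\<lambda>p. indicator {fst p..fst p + h} (snd p) :: ennreal) = (\<lambda>p. if fst p \<le> snd p \<and> snd p \<le> fst p + h then 1 else 0)"
      for h :: real by (auto split: split_indicator)
    then show ?thesis by simp
  qed
  have "ennreal h * (\<integral>\<^sup>+g. ennreal (std_normal_density g) * ennreal (f g) \<partial>lborel)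
    = (\<integral>\<^sup>+g. (ennreal (std_normal_density g) * ennreal (f g)) * ennreal h \<partial>lborel)"
    by (subst nn_integral_multc) (auto simp: mult.commute)
  also have "\<dots> = (\<integral>\<^sup>+g. \<integral>\<^sup>+x. ennreal (std_normal_density g) * ennreal (f g) * indicator {x..x + h} g \<partial>lborel \<partial>lborel)"
    unfolding ind using h by (subst nn_integral_cmult) auto
  also have "\<dots> = (\<integral>\<^sup>+x. \<integral>\<^sup>+g. ennreal (std_normal_density g) * ennreal (f g) * indicator {x..x + h} g \<partial>lborel \<partial>lborel)"
    by (rule lborel_pair.Fubini') (auto simp: split_beta')
  also have "\<dots> \<le> (\<integral>\<^sup>+x. \<integral>\<^sup>+g. ennreal (exp (- (1/4) * (x - 0)\<^sup>2)) * (ennreal (f g) * indicator {x..x + h} g) \<partial>lborel \<partial>lborel)"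
  proof (intro nn_integral_mono)
    fix x g :: real
    show "ennreal (std_normal_density g) * ennreal (f g) * indicator {x..x + h} g
      \<le> ennreal (exp (- (1/4) * (x - 0)\<^sup>2)) * (ennreal (f g) * indicator {x..x + h} g)"
      using den[of g x] by (auto split: split_indicator simp del: minus_mult_left[symmetric] intro!: mult_right_mono ennreal_leI)
  qed
  also have "\<dots> = (\<integral>\<^sup>+x. ennreal (exp (- (1/4) * (x - 0)\<^sup>2)) * (\<integral>\<^sup>+g. ennreal (f g) * indicator {x..x + h} g \<partial>lborel) \<partial>lborel)"
    by (intro nn_integral_cong nn_integral_cmult) auto
  also have "\<dots> \<le> (\<integral>\<^sup>+x. ennreal (exp (- (1/4) * (x - 0)\<^sup>2)) * ennreal R \<partial>lborel)"
    by (intro nn_integral_mono mult_left_mono R) auto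
  also have "\<dots> = (\<integral>\<^sup>+x. ennreal (exp (- (1/4) * (x - 0)\<^sup>2)) \<partial>lborel) * ennreal R"
    by (rule nn_integral_multc) auto
  also have "\<dots> = ennreal (sqrt (pi / (1/4))) * ennreal R" by (subst nn_integral_gaussian) auto
  also have "\<dots> \<le> ennreal 4 * ennreal R"
    using pi_less_4 by (intro mult_right_mono ennreal_leI real_le_lsqrt) auto
  finally have "ennreal h * (\<integral>\<^sup>+g. ennreal (std_normal_density g) * ennreal (f g) \<partial>lborel) \<le> ennreal (4 * R)"
    by (simp add: ennreal_mult' R0)
  then have "ennreal (1 / h) * (ennreal h * (\<integral>\<^sup>+g. ennreal (std_normal_density g) * ennreal (f g) \<partial>lborel)) \<le> ennreal (1 / h) * ennreal (4 * R)"
    by (intro mult_left_mono) auto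
  also have "ennreal (1 / h) * (ennreal h * X) = X" for X
    using h by (simp add: mult.assoc[symmetric] flip: ennreal_mult')
  finally show ?thesis using h R0 by (simp flip: ennreal_mult')
qed

lemma gaussian_dz_bound:
  assumes lcd: "lcd J a r \<alpha> D" and pos: "\<beta> > 0" "r > 0" "\<alpha> \<ge> 0" "D > 0" and eta: "\<eta> \<noteq> 0"
  shows "(\<integral>\<^sup>+g. ennreal (std_normal_density g) * ennreal (exp (- \<beta> * (dz J a (\<eta> * g))\<^sup>2)) \<partial>lborel)
    \<le> ennreal (4 * sqrt (4 * pi / \<beta>) / r * (1 / \<bar>\<eta>\<bar> + 2 / D) + 4 * exp (- \<beta> * \<alpha>\<^sup>2 / 4))"
proof -
  \<comment> \<open>A window of length at most 1 along which \<open>\<eta> * g\<close> varies by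
    less than \<open>D\<close>, the range where \<open>lcd\<close> gives information. Dividing by
    \<open>h\<close> is the origin of the additional summand \<open>2 / D\<close>.\<close>
  define h where "h = min 1 (D / (2 * \<bar>\<eta>\<bar>))"
  have h: "0 < h" "h \<le> 1" using pos eta by (auto simp: h_def)
  have "\<bar>\<eta>\<bar> * h \<le> \<bar>\<eta>\<bar> * (D / (2 * \<bar>\<eta>\<bar>))" by (intro mult_left_mono) (auto simp: h_def)
  also have "\<dots> < D" using eta pos by simp
  finally have hD: "\<bar>\<eta>\<bar> * h < D" .
  define s where "s = sqrt (4 * pi / \<beta>)"
  have s: "s \<ge> 0" using pos by (simp add: s_def)
  define R where "R = s / (r * \<bar>\<eta>\<bar>) + h * exp (- \<beta> * \<alpha>\<^sup>2 / 4)"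
  have "R \<ge> 0" using s pos h by (simp add: R_def)
  then have "(\<integral>\<^sup>+g. ennreal (std_normal_density g) * ennreal (exp (- \<beta> * (dz J a (\<eta> * g))\<^sup>2)) \<partial>lborel) \<le> ennreal (4 * R / h)"
    using dz_interval_integral[OF h(1) eta hD lcd pos(1-3)]
    by (intro gaussian_window_bound h) (auto simp: R_def s_def)
  also have "4 * R / h = 4 * s / r * (1 / (\<bar>\<eta>\<bar> * h)) + 4 * exp (- \<beta> * \<alpha>\<^sup>2 / 4)"
    using h eta pos by (simp add: R_def field_simps)
  also have "\<dots> \<le> 4 * s / r * (1 / \<bar>\<eta>\<bar> + 2 / D) + 4 * exp (- \<beta> * \<alpha>\<^sup>2 / 4)"
  proof (intro add_right_mono mult_left_mono)
    show "1 / (\<bar>\<eta>\<bar> * h) \<le> 1 / \<bar>\<eta>\<bar> + 2 / D"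
      using pos eta by (auto simp: h_def min_def field_simps)
  qed (use s pos in auto)
  finally show ?thesis by (simp add: s_def ennreal_leI)
qed

section \<open>From characteristic functions to small ball probabilities\<close>

lemma (in prob_space) gaussian_transform_le:
  assumes [measurable]: "S \<in> borel_measurable M"
  shows "(\<integral>\<^sup>+\<omega>. ennreal (exp (- (S \<omega> / t)\<^sup>2 / 2)) \<partial>M) \<le>
    (\<integral>\<^sup>+g. ennreal (std_normal_density g) * ennreal (cmod (char (distr M borel S) (g / t))) \<partial>lborel)"
proof -
  define \<mu> where "\<mu> = distr M borel S"
  interpret \<mu>: real_distribution \<mu> unfolding \<mu>_def by (rule real_distribution_distr) fact
  let ?N = "std_normal_distribution"
  interpret N: real_distribution ?N by (rule real_dist_normal_dist)
  interpret P: pair_prob_space \<mu> ?N ..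
  have int: "integrable (\<mu> \<Otimes>\<^sub>M ?N) (\<lambda>(x, g). iexp (x / t * g))"
    by (intro P.P.integrable_const_bound[where B = 1]) (auto simp: split_beta')
  have "(CLINT x|\<mu>. of_real (exp (- (x / t)\<^sup>2 / 2))) = (CLINT x|\<mu>. CLINT g|?N. iexp (x / t * g))"
  proof (intro Bochner_Integration.integral_cong refl)
    fix x show "complex_of_real (exp (- (x / t)\<^sup>2 / 2)) = (CLINT g|?N. iexp (x / t * g))"
      using fun_cong[OF char_std_normal_distribution, of "x / t"] by (simp only: char_def)
  qed
  also have "\<dots> = (CLINT g|?N. CLINT x|\<mu>. iexp (x / t * g))"
    using P.Fubini_integral[OF int] by simp
  also have "\<dots> = (CLINT g|?N. char \<mu> (g / t))"
    unfolding char_def by (intro Bochner_Integration.integral_cong) (auto simp: mult_ac)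
  finally have eq: "(CLINT x|\<mu>. of_real (exp (- (x / t)\<^sup>2 / 2))) = (CLINT g|?N. char \<mu> (g / t))" .
  have i1: "integrable \<mu> (\<lambda>x. exp (- (x / t)\<^sup>2 / 2))"
    by (intro \<mu>.integrable_const_bound[where B = 1]) auto
  have i2: "integrable ?N (\<lambda>g. cmod (char \<mu> (g / t)))"
    by (intro N.integrable_const_bound[where B = 1]) (auto intro!: \<mu>.cmod_char_le_1)
  have "(\<integral>x. exp (- (x / t)\<^sup>2 / 2) \<partial>\<mu>) = cmod (CLINT x|\<mu>. of_real (exp (- (x / t)\<^sup>2 / 2)))"
    by (simp del: of_real_exp)
  also have "\<dots> \<le> (\<integral>g. cmod (char \<mu> (g / t)) \<partial>?N)" unfolding eq by (rule integral_norm_bound)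
  finally have le: "(\<integral>x. exp (- (x / t)\<^sup>2 / 2) \<partial>\<mu>) \<le> (\<integral>g. cmod (char \<mu> (g / t)) \<partial>?N)" .
  have "(\<integral>\<^sup>+\<omega>. ennreal (exp (- (S \<omega> / t)\<^sup>2 / 2)) \<partial>M) = (\<integral>\<^sup>+x. ennreal (exp (- (x / t)\<^sup>2 / 2)) \<partial>\<mu>)"
    by (simp add: \<mu>_def nn_integral_distr)
  also have "\<dots> = ennreal (\<integral>x. exp (- (x / t)\<^sup>2 / 2) \<partial>\<mu>)"
    by (intro nn_integral_eq_integral i1) auto
  also have "\<dots> \<le> ennreal (\<integral>g. cmod (char \<mu> (g / t)) \<partial>?N)" by (intro ennreal_leI le)
  also have "\<dots> = (\<integral>\<^sup>+g. ennreal (cmod (char \<mu> (g / t))) \<partial>?N)"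
    by (intro nn_integral_eq_integral[symmetric] i2) auto
  also have "\<dots> = (\<integral>\<^sup>+g. ennreal (std_normal_density g) * ennreal (cmod (char \<mu> (g / t))) \<partial>lborel)"
    by (subst nn_integral_density) auto
  finally show ?thesis by (simp add: \<mu>_def)
qed

text \<open>Symmetrization: the squared modulus is the characteristic function of the difference of
  two independent copies, and therefore the expectation of a cosine. The inequality
  \<open>1 + y \<le> exp y\<close> then makes products over coordinates into sums in the
  exponent.\<close>

lemma (in real_distribution) cmod_char_square_le:
  "(cmod (char M u))\<^sup>2 \<le> exp (- (\<integral>q. 1 - cos (u * (fst q - snd q)) \<partial>(M \<Otimes>\<^sub>M M)))"
proof -
  interpret P: pair_prob_space M M ..
  have ii: "integrable M (\<lambda>x. iexp (u * x))" by (rule integrable_iexp) auto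
  have ic: "integrable M (\<lambda>x. cos (u * x))" "integrable M (\<lambda>x. sin (u * x))"
    by (intro integrable_const_bound[where B = 1]; simp)+
  have re: "Re (char M u) = (\<integral>x. cos (u * x) \<partial>M)" "Im (char M u) = (\<integral>x. sin (u * x) \<partial>M)"
    unfolding char_def integral_Re[OF ii, symmetric] integral_Im[OF ii, symmetric]
    by (auto simp: Re_exp Im_exp)
  have ip: "integrable (M \<Otimes>\<^sub>M M) (\<lambda>q. cos (u * (fst q - snd q)))"
    by (intro P.P.integrable_const_bound[where B = 1]) auto
  have "(cmod (char M u))\<^sup>2 = (\<integral>x. cos (u * x) \<partial>M) * (\<integral>x. cos (u * x) \<partial>M) + (\<integral>x. sin (u * x) \<partial>M) * (\<integral>x. sin (u * x) \<partial>M)"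
    unfolding cmod_power2 re by (simp add: power2_eq_square)
  also have "\<dots> = (\<integral>x. (\<integral>y. cos (u * x) * cos (u * y) + sin (u * x) * sin (u * y) \<partial>M) \<partial>M)"
    using ic by simp
  also have "\<dots> = (\<integral>x. (\<integral>y. cos (u * (fst (x, y) - snd (x, y))) \<partial>M) \<partial>M)"
    by (simp add: right_diff_distrib cos_diff)
  also have "\<dots> = (\<integral>q. cos (u * (fst q - snd q)) \<partial>(M \<Otimes>\<^sub>M M))"
    using P.integral_fst'[OF ip] by simp
  also have "\<dots> = 1 + (- (\<integral>q. 1 - cos (u * (fst q - snd q)) \<partial>(M \<Otimes>\<^sub>M M)))"
    using ip by (subst Bochner_Integration.integral_diff) (auto simp: P.P.prob_space)
  also have "\<dots> \<le> exp (- (\<integral>q. 1 - cos (u * (fst q - snd q)) \<partial>(M \<Otimes>\<^sub>M M)))" by (rule exp_ge_add_one_self)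
  finally show ?thesis .
qed

text \<open>Jensen's inequality for the measure conditioned on \<open>A\<close>, obtained from the
  tangent to the exponential at the conditional mean \<open>m\<close>. It takes the average out of
  the exponent, after which the difference of two copies can be held fixed. Replacing the
  probability of \<open>A\<close> by its lower bound \<open>p\<close> in the exponent keeps the
  estimate uniform in the law.\<close>

lemma (in prob_space) exp_neg_set_integral_le:
  assumes [measurable]: "h \<in> borel_measurable M" "A \<in> events" and h: "\<And>x. 0 \<le> h x" "\<And>x. h x \<le> B"
    and p: "0 < p" "p \<le> prob A"
    and c: "c \<ge> 0"
  shows "exp (- c * (\<integral>x. h x * indicator A x \<partial>M)) \<le> (\<integral>x. exp (- c * p * h x) * indicator A x \<partial>M) / prob A"
proof -
  have ih: "integrable M (\<lambda>x. h x * indicator A x)"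
    using h order_trans[OF h(1) h(2)] by (intro integrable_const_bound[where B = B]) (auto split: split_indicator)
  have ie: "integrable M (\<lambda>x. exp (- c * p * h x) * indicator A x)"
    using h c p by (intro integrable_const_bound[where B = 1]) (auto split: split_indicator)
  have iA: "integrable M (indicat_real A)"
    by (intro integrable_real_indicator) (auto simp: emeasure_eq_measure)
  define I where "I = (\<integral>x. h x * indicator A x \<partial>M)"
  define m where "m = I / prob A"
  have A0: "prob A > 0" using p by linarith
  have I0: "I \<ge> 0" unfolding I_def using h by (intro integral_nonneg_AE) auto
  have "exp (- c * p * m) * prob A = (\<integral>x. exp (- c * p * m) * (1 + c * p * m) * indicator A x + (- exp (- c * p * m) * c * p) * (h x * indicator A x) \<partial>M)"
  proof -
    have "(\<integral>x. K1 * indicator A x + K2 * (h x * indicator A x) \<partial>M) = K1 * prob A + K2 * I" for K1 K2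
      using iA ih by (simp add: I_def)
    moreover have "I = m * prob A" using A0 by (simp add: m_def)
    ultimately show ?thesis by (simp only:) (simp add: algebra_simps)
  qed
  also have "\<dots> \<le> (\<integral>x. exp (- c * p * h x) * indicator A x \<partial>M)"
  proof (intro integral_mono ie)
    show "integrable M (\<lambda>x. exp (- c * p * m) * (1 + c * p * m) * indicator A x + (- exp (- c * p * m) * c * p) * (h x * indicator A x))"
      using iA ih by (intro Bochner_Integration.integrable_add integrable_mult_right)
    fix x
    have "exp (- c * p * m) * (1 + (c * p * m - c * p * h x)) \<le> exp (- c * p * m) * exp (c * p * m - c * p * h x)"
      by (intro mult_left_mono exp_ge_add_one_self) auto
    also have "\<dots> = exp (- c * p * h x)" by (simp flip: exp_add)
    finally show "exp (- c * p * m) * (1 + c * p * m) * indicator A x + (- exp (- c * p * m) * c * p) * (h x * indicator A x)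
      \<le> exp (- c * p * h x) * indicator A x"
      by (auto split: split_indicator simp: algebra_simps)
  qed
  finally have *: "exp (- c * p * m) \<le> (\<integral>x. exp (- c * p * h x) * indicator A x \<partial>M) / prob A"
    using A0 by (simp add: field_simps)
  have "p * m \<le> prob A * m" using p A0 I0 by (intro mult_right_mono) (auto simp: m_def)
  also have "\<dots> = I" using A0 by (simp add: m_def)
  finally have "c * (p * m) \<le> c * I" using c by (intro mult_left_mono) auto
  then have "exp (- c * I) \<le> exp (- c * p * m)" by (simp add: mult.assoc)
  from order_trans[OF this *] show ?thesis by (simp only: I_def)
qed

lemma sg_var_distr:
  assumes [measurable]: "Y \<in> borel_measurable M"
  shows "sg_var (distr M borel Y) b (\<lambda>x. x) \<longleftrightarrow> sg_var M b Y"
proof -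
  have "measure (distr M borel Y) {\<omega> \<in> space (distr M borel Y). t < \<bar>\<omega>\<bar>} = measure M {\<omega> \<in> space M. t < \<bar>Y \<omega>\<bar>}" for t
    by (subst measure_distr) (auto intro!: arg_cong[where f = "measure M"])
  then show ?thesis
    by (simp add: sg_var_def subgaussian_bound_def integral_distr)
qed

text \<open>The weights \<open>1 / sqrt 2\<close> and \<open>- 1 / sqrt 2\<close> form a unit
  vector, so \<open>sg_sum_spread\<close> applies to two independent copies; removing the division
  by \<open>sqrt 2\<close> only enlarges the difference.\<close>

lemma sg_difference_spread:
  assumes \<nu>: "real_distribution \<nu>" and sg: "sg_var \<nu> b (\<lambda>x. x)"
  shows "spread b \<le> measure (\<nu> \<Otimes>\<^sub>M \<nu>) {q \<in> space (\<nu> \<Otimes>\<^sub>M \<nu>). 1/2 \<le> \<bar>fst q - snd q\<bar>}"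
proof -
  interpret real_distribution \<nu> by fact
  interpret P: pair_prob_space \<nu> \<nu> ..
  let ?P = "\<nu> \<Otimes>\<^sub>M \<nu>"
  have mf[measurable]: "fst \<in> borel_measurable ?P" "snd \<in> borel_measurable ?P" by auto
  have df: "distr ?P borel fst = \<nu>"
  proof -
    have "distr ?P \<nu> fst = \<nu>" by (rule distr_pair_fst)
    moreover have "distr ?P borel fst = distr ?P \<nu> fst" by (intro distr_cong) auto
    ultimately show ?thesis by simp
  qed
  have ds: "distr ?P borel snd = \<nu>"
  proof (rule measure_eqI)
    fix A assume "A \<in> sets (distr ?P borel snd)"
    then have A: "A \<in> sets borel" by simp
    have "emeasure (distr ?P borel snd) A = emeasure ?P (space \<nu> \<times> A)"
      using A by (subst emeasure_distr) (auto intro!: arg_cong[where f = "emeasure ?P"] simp: space_pair_measure)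
    also have "\<dots> = emeasure \<nu> A" using A emeasure_space_1 by (subst emeasure_pair_measure_Times) auto
    finally show "emeasure (distr ?P borel snd) A = emeasure \<nu> A" .
  qed simp
  have "distr ?P (borel \<Otimes>\<^sub>M borel) (\<lambda>x. (fst x, snd x)) = ?P"
    by (subst prod.collapse) (intro distr_id2 sets_pair_measure_cong; simp)
  then have "P.indep_var borel fst borel snd"
    unfolding P.indep_var_distribution_eq df ds by auto
  then have ind: "P.indep_vars (\<lambda>_. borel) (case_bool fst snd) UNIV"
    unfolding P.indep_var_def by (rule P.indep_vars_cong[THEN iffD1, rotated -1]) (auto split: bool.split)
  have sgP: "sg_var ?P b (case_bool fst snd i)" for i
    using sg sg_var_distr[OF mf(1), of b] sg_var_distr[OF mf(2), of b] by (cases i) (auto simp: df ds)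
  define w :: "bool \<Rightarrow> real" where "w i = (if i then 1 / sqrt 2 else - 1 / sqrt 2)" for i
  have "spread b \<le> P.prob {q \<in> space ?P. 1/2 \<le> \<bar>\<Sum>i\<in>UNIV. w i * case_bool fst snd i q\<bar>}"
    by (intro P.sg_sum_spread ind sgP) (auto simp: w_def UNIV_bool power_divide)
  also have "\<dots> \<le> P.prob {q \<in> space ?P. 1/2 \<le> \<bar>fst q - snd q\<bar>}"
  proof (intro P.finite_measure_mono subsetI)
    fix q assume q: "q \<in> {q \<in> space ?P. 1/2 \<le> \<bar>\<Sum>i\<in>UNIV. w i * case_bool fst snd i q\<bar>}"
    have "(\<Sum>i\<in>UNIV. w i * case_bool fst snd i q) = (fst q - snd q) / sqrt 2"
      by (simp add: w_def UNIV_bool diff_divide_distrib)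
    with q have "1/2 \<le> \<bar>fst q - snd q\<bar> / sqrt 2" by simp
    also have "\<dots> \<le> \<bar>fst q - snd q\<bar> / 1" by (intro divide_left_mono) auto
    finally show "q \<in> {q \<in> space ?P. 1/2 \<le> \<bar>fst q - snd q\<bar>}" using q by simp
  qed measurable
  finally show ?thesis .
qed

text \<open>The characteristic function of the sum is a product. Symmetrizing each factor and
  bounding \<open>1 - cos\<close> by the squared distance to the integers produces the exponential
  of an averaged squared \<open>dz\<close>. Because all summands share the law \<open>\<nu>\<close>,
  one and the same difference of two copies serves every coordinate, and the coordinatewise
  distances combine into a single \<open>dz\<close>. Jensen's inequality on the event that this
  difference is at least 1/2 moves the average outside, and for each fixed difference
  \<open>gaussian_dz_bound\<close> applies.\<close>

lemma (in prob_space) sg_small_ball: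
  fixes Y :: "'i \<Rightarrow> 'a \<Rightarrow> real"
  assumes J: "finite J" and ind: "indep_vars (\<lambda>_. borel) Y J" and law: "\<And>i. i \<in> J \<Longrightarrow> distr M borel (Y i) = \<nu>"
    and sg: "\<And>i. i \<in> J \<Longrightarrow> sg_var M b (Y i)" and b: "b \<ge> 1" and a: "(\<Sum>i\<in>J. (a i)\<^sup>2) = 1"
    and lcd: "lcd J a r \<alpha> D" and pos: "r > 0" "\<alpha> \<ge> 0" "D > 0" "t > 0"
  shows "(\<integral>\<^sup>+\<omega>. ennreal (exp (- ((\<Sum>i\<in>J. a i * Y i \<omega>) / t)\<^sup>2 / 2)) \<partial>M) \<le>
    ennreal (128 / (r * sqrt (spread b)) * (t + 1 / D) + 4 * exp (- spread b * \<alpha>\<^sup>2))"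
proof -
  note [measurable] = sg_varD(1)[OF sg]
  define p where "p = spread b"
  have p: "0 < p" "p \<le> 1" using spread_bounds[OF b] by (auto simp: p_def)
  have "J \<noteq> {}" using a by auto
  then obtain i0 where i0: "i0 \<in> J" by blast
  have \<nu>: "real_distribution \<nu>" using law[OF i0] sg_varD(1)[OF sg[OF i0]] by (metis real_distribution_distr)
  interpret \<nu>: real_distribution \<nu> by fact
  interpret P: pair_prob_space \<nu> \<nu> ..
  let ?P = "\<nu> \<Otimes>\<^sub>M \<nu>"
  have sg\<nu>: "sg_var \<nu> b (\<lambda>x. x)" using sg[OF i0] law[OF i0] sg_var_distr by (metis sg_varD(1))
  define A where "A = {q \<in> space ?P. 1/2 \<le> \<bar>fst q - snd q\<bar>}"
  have Am[measurable]: "A \<in> sets ?P" unfolding A_def by measurable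
  have PA: "p \<le> P.prob A" using sg_difference_spread[OF \<nu> sg\<nu>] by (simp add: A_def p_def)
  then have PA0: "P.prob A > 0" using p by linarith
  define S where "S \<omega> = (\<Sum>i\<in>J. a i * Y i \<omega>)" for \<omega>
  have [measurable]: "S \<in> borel_measurable M" unfolding S_def by measurable
  have charS: "char (distr M borel S) u = (\<Prod>i\<in>J. char \<nu> (u * a i))" for u
  proof -
    have "char (distr M borel S) u = (\<Prod>i\<in>J. char (distr M borel (\<lambda>\<omega>. a i * Y i \<omega>)) u)"
      unfolding S_def by (intro char_distr_sum indep_vars_compose2[OF ind]) auto
    also have "\<dots> = (\<Prod>i\<in>J. char \<nu> (u * a i))"
    proof (intro prod.cong refl)
      fix i assume i: "i \<in> J"
      have [measurable]: "Y i \<in> borel_measurable M" using sg_varD(1)[OF sg[OF i]] .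
      show "char (distr M borel (\<lambda>\<omega>. a i * Y i \<omega>)) u = char \<nu> (u * a i)"
        unfolding law[OF i, symmetric] char_def by (simp add: integral_distr mult_ac)
    qed
    finally show ?thesis .
  qed
  define h where "h u q = (dz J a (u * (fst q - snd q) / (2 * pi)))\<^sup>2" for u and q :: "real \<times> real"
  have hm[measurable]: "h u \<in> borel_measurable ?P" for u unfolding h_def by measurable
  have h0: "0 \<le> h u q" for u q by (simp add: h_def)
  have hB: "h u q \<le> card J" for u q
  proof -
    have "h u q = (\<Sum>i\<in>J. (u * (fst q - snd q) / (2 * pi) * a i - of_int (round (u * (fst q - snd q) / (2 * pi) * a i)))\<^sup>2)"
      by (simp add: h_def dz_def L2_set_square)
    also have "\<dots> \<le> (\<Sum>i\<in>J. 1)"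
    proof (intro sum_mono)
      fix i
      have "\<bar>x - of_int (round x)\<bar> \<le> 1" for x :: real using of_int_round_abs_le[of x] by (simp add: abs_minus_commute)
      then show "(u * (fst q - snd q) / (2 * pi) * a i - of_int (round (u * (fst q - snd q) / (2 * pi) * a i)))\<^sup>2 \<le> 1"
        by (simp add: abs_square_le_1)
    qed
    finally show ?thesis by simp
  qed
  have cos_ge: "8 * h u q \<le> (\<Sum>i\<in>J. 1 - cos (u * a i * (fst q - snd q)))" for u q
  proof -
    have "8 * h u q = (\<Sum>i\<in>J. 8 * (u * (fst q - snd q) / (2 * pi) * a i - of_int (round (u * (fst q - snd q) / (2 * pi) * a i)))\<^sup>2)"
      by (simp add: h_def dz_def L2_set_square sum_distrib_left)
    also have "\<dots> \<le> (\<Sum>i\<in>J. 1 - cos (u * a i * (fst q - snd q)))"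
    proof (intro sum_mono)
      fix i
      define y where "y = u * (fst q - snd q) / (2 * pi) * a i"
      have "8 * (y - of_int (round y))\<^sup>2 \<le> 1 - cos (2 * pi * (y - of_int (round y)))"
        using of_int_round_abs_le[of y] by (intro one_minus_cos_ge) (simp add: abs_minus_commute)
      also have "cos (2 * pi * (y - of_int (round y))) = cos (2 * pi * y - 2 * pi * of_int (round y))"
        by (simp add: algebra_simps)
      also have "\<dots> = cos (2 * pi * y)" by (simp add: cos_diff sin_int_2pin cos_int_2pin)
      also have "2 * pi * y = u * a i * (fst q - snd q)" by (simp add: y_def)
      finally show "8 * (u * (fst q - snd q) / (2 * pi) * a i - of_int (round (u * (fst q - snd q) / (2 * pi) * a i)))\<^sup>2
          \<le> 1 - cos (u * a i * (fst q - snd q))" by (simp add: y_def)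
    qed
    finally show ?thesis .
  qed
  have ih: "integrable ?P (h u)" for u
    using h0 hB by (intro P.P.integrable_const_bound[where B = "card J"]) auto
  have ihA: "integrable ?P (\<lambda>q. h u q * indicator A q)" for u
    using h0 hB by (intro P.P.integrable_const_bound[where B = "card J"]) (auto split: split_indicator)
  have ie: "integrable ?P (\<lambda>q. exp (- 4 * p * h u q) * indicator A q)" for u
    using h0 p by (intro P.P.integrable_const_bound[where B = 1]) (auto split: split_indicator)
  have cmod_le: "cmod (char (distr M borel S) u) \<le> (\<integral>q. exp (- 4 * p * h u q) * indicator A q \<partial>?P) / P.prob A" for u
  proof -
    have "(cmod (char (distr M borel S) u))\<^sup>2 = (\<Prod>i\<in>J. (cmod (char \<nu> (u * a i)))\<^sup>2)"
      by (simp add: charS prod_norm[symmetric] prod_power_distrib)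
    also have "\<dots> \<le> (\<Prod>i\<in>J. exp (- (\<integral>q. 1 - cos (u * a i * (fst q - snd q)) \<partial>?P)))"
      by (intro prod_mono conjI \<nu>.cmod_char_square_le) auto
    also have "\<dots> = exp (- (\<Sum>i\<in>J. \<integral>q. 1 - cos (u * a i * (fst q - snd q)) \<partial>?P))"
      by (simp add: exp_sum J sum_negf[symmetric])
    also have "(\<Sum>i\<in>J. \<integral>q. 1 - cos (u * a i * (fst q - snd q)) \<partial>?P) = (\<integral>q. (\<Sum>i\<in>J. 1 - cos (u * a i * (fst q - snd q))) \<partial>?P)"
      by (intro Bochner_Integration.integral_sum[symmetric] Bochner_Integration.integrable_diff P.P.integrable_const_bound[where B = 1]) auto
    also have "exp (- \<dots>) \<le> exp (- (\<integral>q. 8 * h u q \<partial>?P))"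
      unfolding exp_le_cancel_iff neg_le_iff_le
      by (intro integral_mono cos_ge Bochner_Integration.integrable_sum Bochner_Integration.integrable_diff
        P.P.integrable_const_bound[where B = 1] integrable_mult_right ih) auto
    also have "\<dots> \<le> exp (- (\<integral>q. 8 * (h u q * indicator A q) \<partial>?P))"
      unfolding exp_le_cancel_iff neg_le_iff_le
      by (intro integral_mono integrable_mult_right ih ihA) (auto split: split_indicator simp: h0)
    also have "\<dots> = (exp (- 4 * (\<integral>q. h u q * indicator A q \<partial>?P)))\<^sup>2"
      using ihA by (simp flip: exp_double)
    finally have "cmod (char (distr M borel S) u) \<le> exp (- 4 * (\<integral>q. h u q * indicator A q \<partial>?P))"
      by (rule power2_le_imp_le) simp
    also have "\<dots> \<le> (\<integral>q. exp (- 4 * p * h u q) * indicator A q \<partial>?P) / P.prob A"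
      by (rule P.P.exp_neg_set_integral_le[OF hm Am h0 hB p(1) PA]) simp
    finally show ?thesis .
  qed
  define K where "K = 128 / (r * sqrt p) * (t + 1 / D) + 4 * exp (- p * \<alpha>\<^sup>2)"
  have K0: "K \<ge> 0" using pos p by (simp add: K_def)
  have inner: "(\<integral>\<^sup>+g. ennreal (std_normal_density g) * ennreal (exp (- 4 * p * h (g / t) q)) \<partial>lborel) \<le> ennreal K"
    if q: "q \<in> A" for q
  proof -
    \<comment> \<open>The argument of \<open>dz\<close> is linear in the Gaussian variable
      \<open>g\<close>, with this slope. Since the difference is at least 1/2 on \<open>A\<close>,
      the reciprocal of the slope is at most a multiple of \<open>t\<close>.\<close>
    define \<eta> where "\<eta> = (fst q - snd q) / (2 * pi * t)"
    have z: "1/2 \<le> \<bar>fst q - snd q\<bar>" using q by (simp add: A_def)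
    then have eta: "\<eta> \<noteq> 0" using pos by (auto simp: \<eta>_def)
    have "1 / \<bar>\<eta>\<bar> = 2 * pi * t / \<bar>fst q - snd q\<bar>" using pos by (simp add: \<eta>_def abs_mult)
    also have "\<dots> \<le> 2 * 4 * t / (1/2)"
      using pos z pi_less_4 by (intro frac_le mult_mono) auto
    finally have e1: "1 / \<bar>\<eta>\<bar> \<le> 16 * t" by simp
    have sq: "sqrt (4 * pi / (4 * p)) \<le> 2 / sqrt p"
    proof -
      have "sqrt (4 * pi / (4 * p)) \<le> sqrt (4 / p)" using p pi_less_4 by (intro real_sqrt_le_mono) (simp add: divide_right_mono)
      then show ?thesis by (simp add: real_sqrt_divide)
    qed
    have "(\<integral>\<^sup>+g. ennreal (std_normal_density g) * ennreal (exp (- 4 * p * h (g / t) q)) \<partial>lborel)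
      = (\<integral>\<^sup>+g. ennreal (std_normal_density g) * ennreal (exp (- (4 * p) * (dz J a (\<eta> * g))\<^sup>2)) \<partial>lborel)"
      by (simp add: h_def \<eta>_def mult_ac)
    also have "\<dots> \<le> ennreal (4 * sqrt (4 * pi / (4 * p)) / r * (1 / \<bar>\<eta>\<bar> + 2 / D) + 4 * exp (- (4 * p) * \<alpha>\<^sup>2 / 4))"
      using p pos by (intro gaussian_dz_bound lcd eta) auto
    also have "\<dots> \<le> ennreal K"
    proof (intro ennreal_leI)
      have "4 * sqrt (4 * pi / (4 * p)) / r * (1 / \<bar>\<eta>\<bar> + 2 / D) \<le> 4 * (2 / sqrt p) / r * (16 * t + 16 / D)"
        using pos p sq e1 by (intro mult_mono add_mono divide_right_mono mult_left_mono) auto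
      also have "\<dots> = 128 / (r * sqrt p) * (t + 1 / D)" by (simp add: field_simps)
      finally show "4 * sqrt (4 * pi / (4 * p)) / r * (1 / \<bar>\<eta>\<bar> + 2 / D) + 4 * exp (- (4 * p) * \<alpha>\<^sup>2 / 4) \<le> K"
        by (simp add: K_def)
    qed
    finally show ?thesis .
  qed
  have "(\<integral>\<^sup>+\<omega>. ennreal (exp (- (S \<omega> / t)\<^sup>2 / 2)) \<partial>M) \<le>
    (\<integral>\<^sup>+g. ennreal (std_normal_density g) * ennreal (cmod (char (distr M borel S) (g / t))) \<partial>lborel)"
    by (rule gaussian_transform_le) measurable
  also have "\<dots> \<le> (\<integral>\<^sup>+g. \<integral>\<^sup>+q. ennreal (std_normal_density g) * ennreal (exp (- 4 * p * h (g / t) q)) * (indicator A q * ennreal (1 / P.prob A)) \<partial>?P \<partial>lborel)"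
  proof (intro nn_integral_mono)
    fix g
    have "ennreal (cmod (char (distr M borel S) (g / t))) \<le> ennreal ((\<integral>q. exp (- 4 * p * h (g / t) q) * indicator A q \<partial>?P) * (1 / P.prob A))"
      using cmod_le by (intro ennreal_leI) simp
    also have "\<dots> = ennreal (\<integral>q. exp (- 4 * p * h (g / t) q) * indicator A q \<partial>?P) * ennreal (1 / P.prob A)"
      by (rule ennreal_mult'') (use PA0 in simp)
    also have "ennreal (\<integral>q. exp (- 4 * p * h (g / t) q) * indicator A q \<partial>?P) = (\<integral>\<^sup>+q. ennreal (exp (- 4 * p * h (g / t) q) * indicator A q) \<partial>?P)"
      by (intro nn_integral_eq_integral[symmetric] ie) auto
    finally have "ennreal (std_normal_density g) * ennreal (cmod (char (distr M borel S) (g / t))) \<le>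
       ennreal (std_normal_density g) * ((\<integral>\<^sup>+q. ennreal (exp (- 4 * p * h (g / t) q) * indicator A q) \<partial>?P) * ennreal (1 / P.prob A))"
      by (intro mult_left_mono) auto
    also have "\<dots> = (\<integral>\<^sup>+q. ennreal (std_normal_density g) * (ennreal (exp (- 4 * p * h (g / t) q) * indicator A q) * ennreal (1 / P.prob A)) \<partial>?P)"
      by (subst nn_integral_cmult; (subst nn_integral_multc)?) auto
    also have "\<dots> = (\<integral>\<^sup>+q. ennreal (std_normal_density g) * ennreal (exp (- 4 * p * h (g / t) q)) * (indicator A q * ennreal (1 / P.prob A)) \<partial>?P)"
      by (intro nn_integral_cong) (auto split: split_indicator simp: mult_ac)
    finally show "ennreal (std_normal_density g) * ennreal (cmod (char (distr M borel S) (g / t))) \<le>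
      (\<integral>\<^sup>+q. ennreal (std_normal_density g) * ennreal (exp (- 4 * p * h (g / t) q)) * (indicator A q * ennreal (1 / P.prob A)) \<partial>?P)" .
  qed
  also have "\<dots> = (\<integral>\<^sup>+q. \<integral>\<^sup>+g. ennreal (std_normal_density g) * ennreal (exp (- 4 * p * h (g / t) q)) * (indicator A q * ennreal (1 / P.prob A)) \<partial>lborel \<partial>?P)"
  proof -
    interpret Q: pair_sigma_finite ?P lborel ..
    show ?thesis
      by (rule Q.Fubini') (simp add: h_def split_beta', measurable)
  qed
  also have "\<dots> = (\<integral>\<^sup>+q. (\<integral>\<^sup>+g. ennreal (std_normal_density g) * ennreal (exp (- 4 * p * h (g / t) q)) \<partial>lborel) * (indicator A q * ennreal (1 / P.prob A)) \<partial>?P)"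
    by (intro nn_integral_cong nn_integral_multc) (auto simp: h_def)
  also have "\<dots> \<le> (\<integral>\<^sup>+q. ennreal K * ennreal (1 / P.prob A) * indicator A q \<partial>?P)"
    using inner by (intro nn_integral_mono) (auto split: split_indicator intro!: mult_right_mono)
  also have "\<dots> = ennreal K * ennreal (1 / P.prob A) * ennreal (P.prob A)"
    by (simp only: nn_integral_cmult_indicator[OF Am] P.P.emeasure_eq_measure)
  also have "\<dots> = ennreal K" using PA0 K0 by (simp add: mult.assoc flip: ennreal_mult')
  finally show ?thesis by (simp add: K_def p_def S_def)
qed

section \<open>The least common denominator of a random normal vector\<close>

text \<open>If \<open>w * a\<close> were within \<open>r * w\<close> of an integer vector, that
  vector would have length at most \<open>2 * w\<close>, hence fewer than \<open>k\<close> nonzero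
  coordinates, each being at least 1 in absolute value. Outside its support \<open>a\<close> would
  have length at most \<open>r\<close>, so \<open>a\<close> would be compressible.\<close>

lemma lcd_of_not_compressible:
  assumes J: "finite J" and a: "(\<Sum>j\<in>J. (a j)\<^sup>2) = 1" and nc: "\<not> compressible J k r a" and r: "0 < r" "r \<le> 1" and k: "k > 0"
  shows "lcd J a r \<alpha> (sqrt k / 2)"
  unfolding lcd_def
proof (intro allI impI, rule ccontr)
  fix w assume w: "0 < w \<and> w < sqrt k / 2" and "\<not> min (r * w) \<alpha> \<le> dz J a w"
  then have d: "dz J a w < r * w" by simp
  define p where "p i = round (w * a i)" for i
  define S where "S = {i \<in> J. p i \<noteq> 0}"
  have fS: "finite S" "S \<subseteq> J" using J by (auto simp: S_def)
  have a1: "L2_set a J = 1" using a by (simp add: L2_set_def)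
  have "L2_set (\<lambda>i. real_of_int (p i)) J \<le> L2_set (\<lambda>i. w * a i) J + L2_set (\<lambda>i. real_of_int (p i) - w * a i) J"
    using L2_set_triangle_ineq[of "\<lambda>i. w * a i" "\<lambda>i. real_of_int (p i) - w * a i" J] by simp
  also have "L2_set (\<lambda>i. w * a i) J = w" using w a1 by (simp add: L2_set_right_distrib[symmetric])
  also have "L2_set (\<lambda>i. real_of_int (p i) - w * a i) J = dz J a w"
    by (simp add: dz_def p_def L2_set_def power2_commute)
  also have "w + dz J a w \<le> 2 * w" using d r w mult_right_mono[of r 1 w] by linarith
  also have "\<dots> \<le> sqrt k" using w by simp
  finally have "(L2_set (\<lambda>i. real_of_int (p i)) J)\<^sup>2 \<le> (sqrt k)\<^sup>2" by (intro power_mono L2_set_nonneg)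
  then have pk: "(\<Sum>i\<in>J. (real_of_int (p i))\<^sup>2) \<le> k" using k by (simp add: L2_set_square)
  have "real (card S) = (\<Sum>i\<in>S. 1)" by simp
  also have "\<dots> \<le> (\<Sum>i\<in>S. (real_of_int (p i))\<^sup>2)"
  proof (intro sum_mono)
    fix i assume "i \<in> S"
    then have "1 \<le> \<bar>p i\<bar>" by (auto simp: S_def)
    then have "1 \<le> (p i)\<^sup>2" by (metis abs_le_square_iff abs_1 one_power2)
    then show "1 \<le> (real_of_int (p i))\<^sup>2" by (metis of_int_1_le_iff of_int_power)
  qed
  also have "\<dots> \<le> (\<Sum>i\<in>J. (real_of_int (p i))\<^sup>2)" using J fS by (intro sum_mono2) auto
  finally have cS: "card S \<le> k" using pk by linarith
  have "w\<^sup>2 * (\<Sum>i\<in>J - S. (a i)\<^sup>2) = (\<Sum>i\<in>J - S. (w * a i - of_int (p i))\<^sup>2)"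
    unfolding sum_distrib_left by (intro sum.cong) (auto simp: S_def power_mult_distrib)
  also have "\<dots> \<le> (\<Sum>i\<in>J. (w * a i - of_int (p i))\<^sup>2)" using J by (intro sum_mono2) auto
  also have "\<dots> = (dz J a w)\<^sup>2" by (simp add: dz_def L2_set_square p_def)
  also have "\<dots> \<le> (r * w)\<^sup>2" using d dz_nonneg[of J a w] by (intro power_mono) auto
  finally have "w\<^sup>2 * (\<Sum>i\<in>J - S. (a i)\<^sup>2) \<le> w\<^sup>2 * r\<^sup>2" by (simp add: power_mult_distrib mult.commute)
  then have "(\<Sum>i\<in>J - S. (a i)\<^sup>2) \<le> r\<^sup>2" using w by simp
  with cS fS nc show False by (auto simp: compressible_def)
qed

section \<open>Dyadic levels of the least common denominator\<close>

definition lev_net :: "nat set \<Rightarrow> real \<Rightarrow> (nat \<Rightarrow> int) set" where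
  "lev_net J D = {p \<in> J \<rightarrow>\<^sub>E UNIV. (\<Sum>j\<in>J. (real_of_int (p j))\<^sup>2) \<le> (3 * D)\<^sup>2}"

text \<open>Unit vectors whose denominator is at least \<open>D\<close>, with \<open>p\<close> as
  the lattice point close to a multiple \<open>w * a\<close> of size between \<open>D\<close> and
  \<open>2 * D\<close>.\<close>

definition lev_rep :: "nat set \<Rightarrow> real \<Rightarrow> real \<Rightarrow> real \<Rightarrow> (nat \<Rightarrow> int) \<Rightarrow> (nat \<Rightarrow> real) \<Rightarrow> bool" where
  "lev_rep J r \<alpha> D p a \<longleftrightarrow> (\<Sum>j\<in>J. (a j)\<^sup>2) = 1 \<and> lcd J a r \<alpha> D \<and>
     (\<exists>w. D \<le> w \<and> w < 2 * D \<and> L2_set (\<lambda>j. w * a j - of_int (p j)) J < \<alpha>)"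

text \<open>One representative is chosen for each lattice point, so that the net consists of vectors which themselves satisfy
  the small ball estimate; it has accuracy \<open>4 \<alpha> / D\<close>.\<close>

definition lev_bad :: "nat set \<Rightarrow> nat set \<Rightarrow> real \<Rightarrow> real \<Rightarrow> real \<Rightarrow> real \<Rightarrow> (nat \<times> nat \<Rightarrow> real) \<Rightarrow> bool" where
  "lev_bad I J K r \<alpha> D g \<longleftrightarrow> (\<exists>p\<in>{p \<in> lev_net J D. \<exists>a. lev_rep J r \<alpha> D p a}.
     (\<Sum>i\<in>I. (mv J g (SOME a. lev_rep J r \<alpha> D p a) i)\<^sup>2) \<le> (4 * K * \<alpha> / D)\<^sup>2)"

lemma lev_net:
  assumes J: "finite J" "card J \<le> n" and n: "n \<ge> 1" and D: "D > 0"
  shows "finite (lev_net J D)" "card (lev_net J D) \<le> exp n * (1 + 6 * D / sqrt n) ^ n"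
proof -
  \<comment> \<open>Chosen so that \<open>s * (sqrt n * 3 * D) = n\<close>: with weight
    \<open>exp (- s)\<close> the bound on the sum of absolute values costs exactly
    \<open>exp n\<close>.\<close>
  define s where "s = sqrt n / (3 * D)"
  have s: "s > 0" using n D by (simp add: s_def)
  have L: "(\<Sum>j\<in>J. \<bar>real_of_int (p j)\<bar>) \<le> sqrt n * (3 * D)" if "p \<in> lev_net J D" for p
    using that D J(2) card_mono[OF J(1), of "{j \<in> J. p j \<noteq> 0}"]
    by (intro sum_abs_le_sqrt J) (auto simp: lev_net_def)
  have k: "real (card {j \<in> J. p j \<noteq> 0}) \<le> real n" for p :: "nat \<Rightarrow> int"
    using J(2) card_mono[OF J(1), of "{j \<in> J. p j \<noteq> 0}"] by auto
  have T: "lev_net J D \<subseteq> J \<rightarrow>\<^sub>E UNIV" by (auto simp: lev_net_def)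
  note * = card_lattice_points[OF J(1) T k L, where x = "exp (- s)" and v = 1]
  show "finite (lev_net J D)" by (rule *) (use s in auto)
  have sn: "s * (sqrt n * (3 * D)) = n" using D by (simp add: s_def)
  have x1: "1 + 2 * exp (- s) / (1 - exp (- s)) \<le> 1 + 6 * D / sqrt n"
  proof -
    have "exp (- s) * (1 + s) \<le> exp (- s) * exp s" by (intro mult_left_mono exp_ge_add_one_self) auto
    then have "exp (- s) * s \<le> 1 - exp (- s)" by (simp add: algebra_simps flip: exp_add)
    then have "exp (- s) / (1 - exp (- s)) \<le> 1 / s" using s by (simp add: field_simps)
    then have "2 * (exp (- s) / (1 - exp (- s))) \<le> 2 * (1 / s)" by simp
    then show ?thesis by (simp add: s_def)
  qed
  have "card (lev_net J D) \<le> exp (- s) powr (- (sqrt n * (3 * D))) * (1 + 2 * exp (- s) / (1 - exp (- s))) ^ card J"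
    using *(2) s by simp
  also have "exp (- s) powr (- (sqrt n * (3 * D))) = exp n" using sn by (simp add: powr_def mult.commute)
  also have "exp (real n) * (1 + 2 * exp (- s) / (1 - exp (- s))) ^ card J \<le> exp n * (1 + 6 * D / sqrt n) ^ card J"
    using x1 s by (intro mult_left_mono power_mono) auto
  also have "\<dots> \<le> exp n * (1 + 6 * D / sqrt n) ^ n"
    using J D by (intro mult_left_mono power_increasing) auto
  finally show "card (lev_net J D) \<le> exp n * (1 + 6 * D / sqrt n) ^ n" by simp
qed

lemma lev_bad_measurable:
  assumes fin: "finite I" "finite J" and D: "D > 0"
    and [measurable]: "\<And>p. p \<in> I \<times> J \<Longrightarrow> G p \<in> borel_measurable M"
  shows "{\<omega> \<in> space M. lev_bad I J K r \<alpha> D (\<lambda>p. G p \<omega>)} \<in> sets M"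
  unfolding lev_bad_def mv_def
  using lev_net(1)[OF fin(2), of "Suc (card J)" D] D
  by (intro sets.sets_Collect_finite_Ex) (simp_all, measurable)

text \<open>Suppose the denominator lies between \<open>D\<close> and \<open>2 * D\<close>, and
  round the witnessing multiple of \<open>a\<close> to \<open>p\<close>. The representative
  \<open>a'\<close> of \<open>p\<close> also has a multiple within \<alpha> of \<open>p\<close>, so
  the two multiples differ by at most \<open>2 * \<alpha>\<close>, and so do their lengths
  \<open>w\<close> and \<open>w'\<close>. Hence \<open>a'\<close> is within
  \<open>4 * \<alpha> / D\<close> of \<open>a\<close>. As \<open>a\<close> is in the kernel, the
  operator norm bound makes the image of \<open>a'\<close> small, which \<open>lev_bad\<close>
  excludes.\<close>

lemma lev_good:
  assumes fin: "finite I" "card I \<le> n" "finite J" "card J \<le> n" and n: "n \<ge> 1" and b: "b > 0"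
    and \<alpha>: "\<alpha> \<le> D" and D: "D > 0"
    and good: "\<not> op_bad I J n b g" "\<not> lev_bad I J (360 * b * sqrt n) r \<alpha> D g"
    and a: "(\<Sum>j\<in>J. (a j)\<^sup>2) = 1" "lcd J a r \<alpha> D" and ker: "\<And>i. i \<in> I \<Longrightarrow> mv J g a i = 0"
  shows "lcd J a r \<alpha> (2 * D)"
proof (rule ccontr)
  assume "\<not> lcd J a r \<alpha> (2 * D)"
  then obtain w where w: "0 < w" "w < 2 * D" "dz J a w < min (r * w) \<alpha>" by (auto simp: lcd_def not_le)
  have wD: "D \<le> w" using a(2) w by (auto simp: lcd_def not_le[symmetric])
  have L1: "L2_set x J = 1" if "(\<Sum>j\<in>J. (x j)\<^sup>2) = 1" for x :: "nat \<Rightarrow> real" using that by (simp add: L2_set_def)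
  have Lw: "L2_set (\<lambda>j. v * x j) J = v" if "(\<Sum>j\<in>J. (x j)\<^sup>2) = 1" "v > 0" for x :: "nat \<Rightarrow> real" and v
    using that L1 by (simp add: L2_set_right_distrib[symmetric])
  define p where "p = (\<lambda>j\<in>J. round (w * a j))"
  have pd: "L2_set (\<lambda>j. w * a j - of_int (p j)) J < \<alpha>"
    using w(3) by (simp add: dz_def p_def L2_set_def cong: sum.cong)
  have "L2_set (\<lambda>j. real_of_int (p j)) J \<le> L2_set (\<lambda>j. w * a j) J + L2_set (\<lambda>j. real_of_int (p j) - w * a j) J"
    using L2_set_triangle_ineq[of "\<lambda>j. w * a j" "\<lambda>j. real_of_int (p j) - w * a j" J] by simp
  also have "L2_set (\<lambda>j. real_of_int (p j) - w * a j) J < \<alpha>" using pd by (simp add: L2_set_def power2_commute)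
  \<comment> \<open>The length is below \<open>w + \<alpha>\<close>, with \<open>w < 2 * D\<close>
    and \<open>\<alpha> \<le> D\<close>; this is the radius of \<open>lev_net\<close>.\<close>
  finally have "L2_set (\<lambda>j. real_of_int (p j)) J \<le> 3 * D" using Lw[OF a(1) w(1)] w \<alpha> by simp
  then have "(L2_set (\<lambda>j. real_of_int (p j)) J)\<^sup>2 \<le> (3 * D)\<^sup>2" by (intro power_mono L2_set_nonneg)
  then have pn: "p \<in> lev_net J D" by (simp add: lev_net_def L2_set_square p_def)
  have "lev_rep J r \<alpha> D p a" using a pd w wD by (auto simp: lev_rep_def)
  then have ex: "\<exists>a. lev_rep J r \<alpha> D p a" by blast
  define a' where "a' = (SOME a. lev_rep J r \<alpha> D p a)"
  have "lev_rep J r \<alpha> D p a'" unfolding a'_def using ex by (rule someI_ex)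
  then obtain w' where a': "(\<Sum>j\<in>J. (a' j)\<^sup>2) = 1" and w': "D \<le> w'" "w' < 2 * D" "L2_set (\<lambda>j. w' * a' j - of_int (p j)) J < \<alpha>"
    by (auto simp: lev_rep_def)
  have sym: "L2_set (\<lambda>j. x j - y j) J = L2_set (\<lambda>j. y j - x j) J" for x y :: "nat \<Rightarrow> real"
    by (simp add: L2_set_def power2_commute)
  have d2: "L2_set (\<lambda>j. w' * a' j - w * a j) J \<le> 2 * \<alpha>"
    using L2_set_triangle_ineq[of "\<lambda>j. w' * a' j - of_int (p j)" "\<lambda>j. of_int (p j) - w * a j" J] pd w'(3)
      sym[of "\<lambda>j. of_int (p j)" "\<lambda>j. w * a j"] by simp
  have ww: "\<bar>w - w'\<bar> \<le> 2 * \<alpha>"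
    using L2_set_triangle_ineq[of "\<lambda>j. w' * a' j - w * a j" "\<lambda>j. w * a j" J]
      L2_set_triangle_ineq[of "\<lambda>j. w * a j - w' * a' j" "\<lambda>j. w' * a' j" J] d2
      Lw[OF a(1) w(1)] Lw[OF a', of w'] w'(1) D sym[of "\<lambda>j. w' * a' j" "\<lambda>j. w * a j"] by simp
  have "w * L2_set (\<lambda>j. a' j - a j) J = L2_set (\<lambda>j. (w' * a' j - w * a j) + (w - w') * a' j) J"
    using w by (subst L2_set_right_distrib) (auto intro!: arg_cong2[where f = L2_set] simp: algebra_simps)
  also have "\<dots> \<le> L2_set (\<lambda>j. w' * a' j - w * a j) J + L2_set (\<lambda>j. (w - w') * a' j) J"
    by (rule L2_set_triangle_ineq)
  also have "L2_set (\<lambda>j. (w - w') * a' j) J = \<bar>w - w'\<bar>"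
    using a' by (simp add: L2_set_def power_mult_distrib sum_distrib_left[symmetric])
  finally have "w * L2_set (\<lambda>j. a' j - a j) J \<le> 4 * \<alpha>" using d2 ww by linarith
  then have "L2_set (\<lambda>j. a' j - a j) J \<le> 4 * \<alpha> / w" using w by (simp add: field_simps)
  also have "\<dots> \<le> 4 * \<alpha> / D"
    using wD D order_trans[OF L2_set_nonneg less_imp_le[OF pd]] by (intro divide_left_mono) auto
  finally have da: "L2_set (\<lambda>j. a' j - a j) J \<le> 4 * \<alpha> / D" .
  have "L2_set (mv J g a') I = L2_set (mv J g (\<lambda>j. a' j - a j)) I"
  proof -
    have "mv J g a' i = mv J g (\<lambda>j. a' j - a j) i" if "i \<in> I" for i
      using mv_add[of J g "\<lambda>j. a' j - a j" a i] ker[OF that] by simp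
    then show ?thesis by (simp add: L2_set_def cong: sum.cong)
  qed
  also have "\<dots> \<le> 360 * b * sqrt n * L2_set (\<lambda>j. a' j - a j) J"
    by (intro op_good_bound fin n b good)
  also have "\<dots> \<le> 360 * b * sqrt n * (4 * \<alpha> / D)" using b by (intro mult_left_mono da) auto
  finally have "L2_set (mv J g a') I \<le> 4 * (360 * b * sqrt n) * \<alpha> / D" by (simp add: mult_ac)
  then have "(L2_set (mv J g a') I)\<^sup>2 \<le> (4 * (360 * b * sqrt n) * \<alpha> / D)\<^sup>2" by (intro power_mono L2_set_nonneg)
  then have "lev_bad I J (360 * b * sqrt n) r \<alpha> D g"
    unfolding lev_bad_def using pn ex by (auto simp: L2_set_square a'_def intro!: bexI[of _ p])
  with good show False by blast
qed

abbreviation row_law :: "'a measure \<Rightarrow> nat set \<Rightarrow> nat set \<Rightarrow> (nat \<times> nat \<Rightarrow> 'a \<Rightarrow> real) \<Rightarrow> bool" where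
  "row_law M I J G \<equiv> \<forall>i\<in>I. \<exists>\<nu>. \<forall>j\<in>J. distr M borel (G (i, j)) = \<nu>"

text \<open>The scale \<open>t\<close> is the forbidden length of the image divided by
  \<open>sqrt n\<close>, that is, the typical size of one coordinate. The last two conditions make
  \<open>t\<close> the dominant term of the small ball estimate, so that each row contributes a
  factor \<open>3 * q * t\<close>.\<close>

lemma (in prob_space) lev_bad_prob:
  fixes K :: real
  assumes fin: "finite I" "finite J" "card J \<le> n" and n: "n \<ge> 1" and b: "b \<ge> 1"
    and ind: "indep_matrix M I J G" and sg: "\<And>p. p \<in> I \<times> J \<Longrightarrow> sg_var M b (G p)" and law: "row_law M I J G"
    and pos: "r > 0" "D > 0" "\<alpha> > 0" "K > 0"
    and q: "q = 128 / (r * sqrt (spread b))" "t = 4 * K * \<alpha> / D"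
      "1 / D \<le> t" "4 * exp (- spread b * \<alpha>\<^sup>2) \<le> q * t"
  shows "prob {\<omega> \<in> space M. lev_bad I J (K * sqrt n) r \<alpha> D (\<lambda>p. G p \<omega>)}
    \<le> exp n * (1 + 6 * D / sqrt n) ^ n * (exp (n / 2) * (3 * q * t) ^ card I)"
proof -
  note [measurable] = sg_varD(1)[OF sg]
  note net = lev_net[OF fin(2,3) n pos(2)]
  let ?N = "{p \<in> lev_net J D. \<exists>a. lev_rep J r \<alpha> D p a}"
  have t0: "t > 0" using pos by (simp add: q)
  have q0: "q > 0" using spread_bounds[OF b] pos by (simp add: q)
  have "prob {\<omega> \<in> space M. lev_bad I J (K * sqrt n) r \<alpha> D (\<lambda>p. G p \<omega>)} \<le> card ?N * (exp (n / 2) * (3 * q * t) ^ card I)"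
    unfolding lev_bad_def
  proof (rule union_bound)
    show "finite ?N" using net(1) by simp
    fix p assume p: "p \<in> ?N"
    define a where "a = (SOME a. lev_rep J r \<alpha> D p a)"
    have "lev_rep J r \<alpha> D p a" unfolding a_def using p by (intro someI_ex[of "lev_rep J r \<alpha> D p"]) auto
    then have a: "(\<Sum>j\<in>J. (a j)\<^sup>2) = 1" "lcd J a r \<alpha> D" by (auto simp: lev_rep_def)
    show "{\<omega> \<in> space M. (\<Sum>i\<in>I. (mv J (\<lambda>p. G p \<omega>) (SOME a. lev_rep J r \<alpha> D p a) i)\<^sup>2) \<le> (4 * (K * sqrt n) * \<alpha> / D)\<^sup>2} \<in> events"
      unfolding mv_def by measurable
    \<comment> \<open>Matches the Gaussian transform of \<open>sg_small_ball\<close> at scale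
      \<open>t\<close>; the Chernoff factor is then \<open>exp (n / 2)\<close>.\<close>
    define l where "l = 1 / (2 * t\<^sup>2)"
    have l: "l > 0" using t0 by (simp add: l_def)
    have "prob {\<omega> \<in> space M. (\<Sum>i\<in>I. (mv J (\<lambda>p. G p \<omega>) a i)\<^sup>2) \<le> (4 * (K * sqrt n) * \<alpha> / D)\<^sup>2}
       \<le> exp (l * (4 * (K * sqrt n) * \<alpha> / D)\<^sup>2) * (3 * q * t) ^ card I"
    proof (intro indep_square_sum_small fin l)
      show "indep_vars (\<lambda>_. borel) (\<lambda>i \<omega>. mv J (\<lambda>p. G p \<omega>) a i) I" by (intro indep_matrix_mv ind fin)
      show "0 \<le> 3 * q * t" using q0 t0 by simp
      fix i assume i: "i \<in> I"
      then obtain \<nu> where \<nu>: "\<And>j. j \<in> J \<Longrightarrow> distr M borel (G (i, j)) = \<nu>" using law by blast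
      have "(\<integral>\<^sup>+\<omega>. ennreal (exp (- l * (mv J (\<lambda>p. G p \<omega>) a i)\<^sup>2)) \<partial>M)
        = (\<integral>\<^sup>+\<omega>. ennreal (exp (- ((\<Sum>j\<in>J. a j * G (i, j) \<omega>) / t)\<^sup>2 / 2)) \<partial>M)"
        by (simp add: mv_def l_def power_divide mult.commute)
      also have "\<dots> \<le> ennreal (128 / (r * sqrt (spread b)) * (t + 1 / D) + 4 * exp (- spread b * \<alpha>\<^sup>2))"
        using i pos t0 by (intro sg_small_ball[where \<nu> = \<nu>] fin indep_matrix_row[OF ind] \<nu> sg b a) auto
      also have "\<dots> \<le> ennreal (3 * q * t)"
      proof (intro ennreal_leI)
        have "q * (t + 1 / D) \<le> q * (2 * t)" using q0 q(3) by (intro mult_left_mono) auto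
        then show "128 / (r * sqrt (spread b)) * (t + 1 / D) + 4 * exp (- spread b * \<alpha>\<^sup>2) \<le> 3 * q * t"
          using q(4) unfolding q(1)[symmetric] by linarith
      qed
      finally show "(\<integral>\<^sup>+\<omega>. ennreal (exp (- l * (mv J (\<lambda>p. G p \<omega>) a i)\<^sup>2)) \<partial>M) \<le> ennreal (3 * q * t)" .
    qed
    also have "l * (4 * (K * sqrt n) * \<alpha> / D)\<^sup>2 = n / 2"
    proof -
      have "4 * (K * sqrt n) * \<alpha> / D = t * sqrt n" by (simp add: q)
      then show ?thesis using t0 by (simp add: l_def power_mult_distrib)
    qed
    finally show "prob {\<omega> \<in> space M. (\<Sum>i\<in>I. (mv J (\<lambda>p. G p \<omega>) (SOME a. lev_rep J r \<alpha> D p a) i)\<^sup>2) \<le> (4 * (K * sqrt n) * \<alpha> / D)\<^sup>2}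
       \<le> exp (n / 2) * (3 * q * t) ^ card I" by (simp add: a_def)
  qed
  also have "\<dots> \<le> exp n * (1 + 6 * D / sqrt n) ^ n * (exp (n / 2) * (3 * q * t) ^ card I)"
  proof (rule mult_right_mono)
    have "card ?N \<le> card (lev_net J D)" using net(1) by (intro card_mono) auto
    then show "real (card ?N) \<le> exp n * (1 + 6 * D / sqrt n) ^ n" using net(2) by linarith
  qed (use q0 t0 in simp)
  finally show ?thesis .
qed

text \<open>\<open>mu\<close> is chosen so that, at each level, the growth of the net and the small ball estimate of one row multiply to
  \<open>exp (- 6)\<close>.\<close>

definition K_const :: "real \<Rightarrow> real" where "K_const b = 360 * b"
text \<open>Gives equality in the condition of \<open>comp_good_bound\<close> that the approximation
  error stays below half of the lower bound.\<close>

definition rho :: "real \<Rightarrow> real" where "rho b = sqrt (spread b) / (48 * K_const b)"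
text \<open>Comes from the counting condition of \<open>comp_bad_prob\<close>: there
  \<open>64 / spread b + 2 / rho b\<close> is at most \<open>66 / (spread b * rho b)\<close>, and
  2112 is 66 times 32.\<close>

definition del :: "real \<Rightarrow> real" where "del b = (spread b)\<^sup>2 * rho b / 2112"
definition L_const :: "real \<Rightarrow> real" where "L_const b = 128 / (rho b * sqrt (spread b))"
text \<open>On every level \<open>D\<close> is at least \<open>sqrt (del b * n) / 2\<close>, so the
  summand 1 in the size of \<open>lev_net\<close> can be absorbed and
  \<open>1 + 6 * D / sqrt n\<close> becomes a multiple of \<open>D / sqrt n\<close>.\<close>

definition N_const :: "real \<Rightarrow> real" where "N_const b = 6 + 2 / sqrt (del b)"
definition mu :: "real \<Rightarrow> real" where "mu b = exp (- 6) / (12 * N_const b * L_const b * K_const b)"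
text \<open>With \<open>\<alpha> = mu b * sqrt n\<close>, the residual term
  \<open>exp (- spread b * \<alpha>\<^sup>2)\<close> of the small ball estimate is exactly
  \<open>exp (- rate b * n)\<close>. This is why denominators are followed only up to
  \<open>exp (rate b * n)\<close>.\<close>

definition rate :: "real \<Rightarrow> real" where "rate b = spread b * (mu b)\<^sup>2"
text \<open>From this dimension on there are at least two columns, the first level
  \<open>sqrt (del b * n) / 2\<close> is at least 1, and
  \<open>4 * K_const b * mu b * sqrt n \<ge> 1\<close>, which makes \<open>1 / D\<close> at most the
  scale \<open>t\<close> on each level.\<close>

definition dim0 :: "real \<Rightarrow> real" where "dim0 b = 2 + 4 / del b + 1 / (4 * K_const b * mu b)\<^sup>2"

lemma const_bounds:
  assumes b: "b \<ge> 1"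
  shows "K_const b \<ge> 360" "0 < rho b" "rho b \<le> 1" "0 < del b" "del b \<le> 1" "L_const b \<ge> 128" "N_const b \<ge> 6"
    "2 / sqrt (del b) \<le> N_const b" "0 < mu b" "12 * N_const b * L_const b * K_const b * mu b = exp (- 6)"
    "mu b \<le> sqrt (del b) / 2" "0 < rate b" "rate b \<le> 1/4" "2 \<le> dim0 b" "mu b \<le> 1/6"
proof -
  note p = spread_bounds[OF b]
  have sp: "0 < sqrt (spread b)" "sqrt (spread b) \<le> 1" using p by auto
  show K: "K_const b \<ge> 360" using b by (simp add: K_const_def)
  show r: "0 < rho b" using K sp by (simp add: rho_def)
  have "sqrt (spread b) \<le> 48 * K_const b" using K sp by linarith
  then show r1: "rho b \<le> 1" using K by (simp add: rho_def)
  show d: "0 < del b" using r p by (simp add: del_def)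
  have "(spread b)\<^sup>2 * rho b \<le> 1 * 1" using p r r1 by (intro mult_mono) (auto simp: power_le_one)
  then show d1: "del b \<le> 1" by (simp add: del_def)
  have "rho b * sqrt (spread b) \<le> 1 * 1" using r r1 sp by (intro mult_mono) auto
  then show L: "L_const b \<ge> 128" using r sp by (simp add: L_const_def field_simps)
  show N: "N_const b \<ge> 6" "2 / sqrt (del b) \<le> N_const b" using d by (auto simp: N_const_def)
  show m: "0 < mu b" using N L K by (simp add: mu_def)
  show e: "12 * N_const b * L_const b * K_const b * mu b = exp (- 6)" using N L K by (simp add: mu_def)
  have "1 * 1 * 1 \<le> 12 * L_const b * K_const b" using L K by (intro mult_mono) auto
  then have "(1 * N_const b) * mu b \<le> ((12 * L_const b * K_const b) * N_const b) * mu b" using N m by (intro mult_right_mono) auto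
  also have "\<dots> = exp (- 6)" using e by (simp add: mult_ac)
  also have "\<dots> \<le> 1" by simp
  finally have Nm: "N_const b * mu b \<le> 1" by simp
  then have mN: "mu b \<le> 1 / N_const b" using N by (simp add: field_simps)
  also have "\<dots> \<le> 1/6" using N by (intro divide_left_mono) auto
  finally show "mu b \<le> 1/6" .
  have "mu b \<le> 1 / N_const b" by (rule mN)
  also have "\<dots> \<le> 1 / (2 / sqrt (del b))" using N d by (intro divide_left_mono) auto
  finally show m2: "mu b \<le> sqrt (del b) / 2" by simp
  also have "\<dots> \<le> 1/2" using d1 by simp
  finally have mh: "mu b \<le> 1/2" .
  show "0 < rate b" using m p by (simp add: rate_def)
  have "spread b * (mu b)\<^sup>2 \<le> 1 * (1/2)\<^sup>2" using p m mh by (intro mult_mono power_mono) auto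
  then show "rate b \<le> 1/4" by (simp add: rate_def power2_eq_square)
  show "2 \<le> dim0 b" using d by (simp add: dim0_def)
qed

text \<open>Dyadic levels, starting from the bound that incompressibility provides. The restriction
  \<open>j < 2 * n\<close> gives finiteness at once; \<open>2 ^ (2 * n)\<close> already exceeds
  \<open>exp (rate b * n)\<close>.\<close>

definition lcd_levels :: "nat \<Rightarrow> real \<Rightarrow> nat set" where
  "lcd_levels n b = {j. j < 2 * n \<and> 2 ^ j * (sqrt (del b * n) / 2) < exp (rate b * n)}"

definition lcd_bad :: "nat set \<Rightarrow> nat set \<Rightarrow> nat \<Rightarrow> real \<Rightarrow> (nat \<times> nat \<Rightarrow> real) \<Rightarrow> bool" where
  "lcd_bad I J n b g \<longleftrightarrow> (\<exists>j\<in>lcd_levels n b.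
     lev_bad I J (K_const b * sqrt n) (rho b) (mu b * sqrt n) (2 ^ j * (sqrt (del b * n) / 2)) g)"

lemma finite_lcd_levels: "finite (lcd_levels n b)"
  by (simp add: lcd_levels_def)

lemma lcd_bad_measurable:
  assumes fin: "finite I" "finite J" and n: "n \<ge> 1" and b: "b \<ge> 1"
    and [measurable]: "\<And>p. p \<in> I \<times> J \<Longrightarrow> G p \<in> borel_measurable M"
  shows "{\<omega> \<in> space M. lcd_bad I J n b (\<lambda>p. G p \<omega>)} \<in> sets M"
  unfolding lcd_bad_def using n const_bounds(4)[OF b] assms
  by (intro sets.sets_Collect_finite_Ex lev_bad_measurable finite_lcd_levels) auto

lemma lcd_mono: "lcd J a r \<alpha> D' \<Longrightarrow> D \<le> D' \<Longrightarrow> lcd J a r \<alpha> D"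
  by (auto simp: lcd_def)

text \<open>If the conclusion failed, the denominator would stay below
  \<open>exp (rate b * n)\<close> while \<open>lev_good\<close> doubles its lower bound at each
  level, starting from \<open>lcd_of_not_compressible\<close>. After \<open>2 * n\<close> doublings
  this is impossible.\<close>

lemma lcd_good:
  assumes fin: "finite I" "card I \<le> n" "finite J" "card J \<le> n" and b: "b \<ge> 1" and n: "dim0 b \<le> n"
    and good: "\<not> op_bad I J n b g" "\<not> lcd_bad I J n b g"
    and a: "(\<Sum>j\<in>J. (a j)\<^sup>2) = 1" "\<not> compressible J (del b * n) (rho b) a" and ker: "\<And>i. i \<in> I \<Longrightarrow> mv J g a i = 0"
  shows "lcd J a (rho b) (mu b * sqrt n) (exp (rate b * n))"
proof (rule ccontr)
  assume not: "\<not> lcd J a (rho b) (mu b * sqrt n) (exp (rate b * n))"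
  note c = const_bounds[OF b]
  have n1: "n \<ge> 1" using n c(14) by linarith
  define D0 where "D0 = sqrt (del b * n) / 2"
  have dn: "4 \<le> del b * n"
  proof -
    have "1 / (4 * K_const b * mu b)\<^sup>2 \<ge> 0" by simp
    then have "4 / del b \<le> n" using n unfolding dim0_def by linarith
    then show ?thesis using c(4) by (simp add: field_simps)
  qed
  then have D0: "D0 \<ge> 1" using real_sqrt_le_mono[OF dn] by (simp add: D0_def)
  have mD: "mu b * sqrt n \<le> D0" using mult_right_mono[OF c(11), of "sqrt n"] by (simp add: D0_def real_sqrt_mult)
  have step: "lcd J a (rho b) (mu b * sqrt n) (2 ^ j * D0) \<and> 2 ^ j * D0 < exp (rate b * n)" if "j \<le> 2 * n" for j
    using that
  proof (induction j)
    case 0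
    have "lcd J a (rho b) (mu b * sqrt n) D0"
      unfolding D0_def using dn by (intro lcd_of_not_compressible fin a c) auto
    then show ?case using not lcd_mono[of J a "rho b" "mu b * sqrt n" D0 "exp (rate b * n)"]
      by (metis mult_1 not_less power_0)
  next
    case (Suc j)
    have j: "j \<in> lcd_levels n b" using Suc by (auto simp: lcd_levels_def D0_def)
    have "1 * D0 \<le> 2 ^ j * D0" using D0 by (intro mult_right_mono) auto
    then have mDj: "mu b * sqrt n \<le> 2 ^ j * D0" using mD by linarith
    have "lcd J a (rho b) (mu b * sqrt n) (2 * (2 ^ j * D0))"
    proof (rule lev_good[OF fin n1])
      show "\<not> lev_bad I J (360 * b * sqrt n) (rho b) (mu b * sqrt n) (2 ^ j * D0) g"
        using good(2) j unfolding lcd_bad_def D0_def K_const_def by blast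
    qed (use good(1) a ker b D0 Suc mDj in auto)
    then have "lcd J a (rho b) (mu b * sqrt n) (2 ^ Suc j * D0)" by (simp add: mult.assoc)
    then show ?case using not lcd_mono[of J a "rho b" "mu b * sqrt n" "2 ^ Suc j * D0" "exp (rate b * n)"]
      by (metis not_less)
  qed
  have "exp (rate b * n) \<le> exp (1 * real n)" using c(13) by (intro exp_le_cancel_iff[THEN iffD2] mult_right_mono) auto
  also have "\<dots> = exp 1 ^ n" by (simp flip: exp_of_nat_mult)
  also have "\<dots> \<le> 4 ^ n" using e_less_272 by (intro power_mono) auto
  also have "(4::real) ^ n = 2 ^ (2 * n)" by (simp add: power_mult)
  also have "\<dots> \<le> 2 ^ (2 * n) * D0" using D0 by simp
  finally show False using step[of "2 * n"] by simp
qed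

lemma (in prob_space) lcd_bad_prob:
  assumes fin: "finite I" "card I + 1 = n" "finite J" "card J \<le> n" and b: "b \<ge> 1" and n: "dim0 b \<le> n"
    and ind: "indep_matrix M I J G" and sg: "\<And>p. p \<in> I \<times> J \<Longrightarrow> sg_var M b (G p)" and law: "row_law M I J G"
  shows "prob {\<omega> \<in> space M. lcd_bad I J n b (\<lambda>p. G p \<omega>)} \<le> 2 * n * (N_const b * exp (- real n))"
proof -
  note [measurable] = sg_varD(1)[OF sg]
  note c = const_bounds[OF b]
  have n2: "n \<ge> 2" using n c(14) by linarith
  define s where "s = sqrt n"
  have s: "s \<ge> 1" using n2 by (simp add: s_def)
  have terms: "4 / del b \<ge> 0" "1 / (4 * K_const b * mu b)\<^sup>2 \<ge> 0" using c(4) by auto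
  have dn: "4 \<le> del b * n"
  proof -
    have "4 / del b \<le> n" using n terms unfolding dim0_def by linarith
    then show ?thesis using c(4) by (simp add: field_simps)
  qed
  have Kms: "1 \<le> 4 * K_const b * mu b * s"
  proof -
    have "1 / (4 * K_const b * mu b)\<^sup>2 \<le> n" using n terms unfolding dim0_def by linarith
    then have "1 \<le> (4 * K_const b * mu b)\<^sup>2 * n" using c(1,9) by (simp add: field_simps)
    also have "\<dots> = (4 * K_const b * mu b * s)\<^sup>2" by (simp add: s_def power_mult_distrib)
    finally have "1\<^sup>2 \<le> (4 * K_const b * mu b * s)\<^sup>2" by simp
    then show ?thesis using c(1,9) s by (intro power2_le_imp_le[of 1]) auto
  qed
  have single: "prob {\<omega> \<in> space M. lev_bad I J (K_const b * sqrt n) (rho b) (mu b * sqrt n) (2 ^ j * (sqrt (del b * n) / 2)) (\<lambda>p. G p \<omega>)}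
      \<le> N_const b * exp (- real n)" if j: "j \<in> lcd_levels n b" for j
  proof -
    define D where "D = 2 ^ j * (sqrt (del b * n) / 2)"
    have Dmax: "D < exp (rate b * n)" using j by (simp add: D_def lcd_levels_def)
    have "1 * (sqrt (del b * n) / 2) \<le> D" unfolding D_def using c(4) by (intro mult_right_mono) auto
    then have Ds: "sqrt (del b) * s \<le> 2 * D" by (simp add: s_def real_sqrt_mult)
    have D0: "D > 0" using dn by (simp add: D_def)
    define t where "t = 4 * K_const b * (mu b * s) / D"
    have t: "1 / D \<le> t" using Kms D0 unfolding t_def by (intro divide_right_mono) (auto simp: mult.assoc)
    have t0: "t > 0" by (rule less_le_trans[OF _ t]) (use D0 in simp)
    have q: "4 * exp (- spread b * (mu b * s)\<^sup>2) \<le> L_const b * t"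
    proof -
      have "(mu b * s)\<^sup>2 = (mu b)\<^sup>2 * n" by (simp add: s_def power_mult_distrib)
      then have "exp (- spread b * (mu b * s)\<^sup>2) = 1 / exp (rate b * n)" by (simp add: rate_def exp_minus field_simps)
      also have "\<dots> \<le> 1 / D" using Dmax D0 by (intro divide_left_mono) auto
      also have "\<dots> \<le> t" by (rule t)
      finally have "4 * exp (- spread b * (mu b * s)\<^sup>2) \<le> 4 * t" by simp
      also have "\<dots> \<le> L_const b * t" using c(6) t0 by (intro mult_right_mono) auto
      finally show ?thesis .
    qed
    have "prob {\<omega> \<in> space M. lev_bad I J (K_const b * sqrt n) (rho b) (mu b * s) D (\<lambda>p. G p \<omega>)}
      \<le> exp n * (1 + 6 * D / sqrt n) ^ n * (exp (n / 2) * (3 * L_const b * t) ^ card I)"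
      using fin n2 c D0 s
      by (intro lev_bad_prob[where b = b] b ind sg law t q L_const_def t_def) auto
    also have "\<dots> \<le> exp n * (N_const b * D / s) ^ n * (exp (n / 2) * (3 * L_const b * t) ^ card I)"
    proof (intro mult_right_mono mult_left_mono power_mono)
      have "1 \<le> 2 * D / (sqrt (del b) * s)" using Ds c(4) s by (simp add: field_simps)
      also have "\<dots> = 2 / sqrt (del b) * (D / s)" by simp
      finally show "1 + 6 * D / sqrt n \<le> N_const b * D / s"
        by (simp add: N_const_def s_def[symmetric] algebra_simps add_divide_distrib)
    qed (use D0 t0 c in auto)
    \<comment> \<open>The net factor of one coordinate is paired with the probability factor of one
      row: \<open>D\<close> cancels, and by the choice of \<open>mu\<close> each pair is
      \<open>exp (- 6)\<close>. There is one row fewer than coordinates, so one net factor is left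
      over; it is at most \<open>N_const b * exp (n / 4)\<close>. For \<open>n \<ge> 2\<close> the
      remaining exponent is at most \<open>- n\<close>.\<close>
    also have "\<dots> = exp n * exp (n / 2) * ((N_const b * D / s) * (N_const b * D / s * (3 * L_const b * t)) ^ card I)"
    proof -
      have gen: "X ^ n * (c * Y ^ card I) = c * (X * (X * Y) ^ card I)" for X Y c :: real
        using fin(2)[symmetric] by (simp add: power_mult_distrib)
      show ?thesis by (simp only: mult.assoc gen)
    qed
    also have "N_const b * D / s * (3 * L_const b * t) = exp (- 6)"
      using c(10) D0 s by (simp add: t_def field_simps)
    also have "N_const b * D / s * exp (- 6) ^ card I \<le> N_const b * exp (n / 4) * exp (- 6 * real (card I))"
    proof (intro mult_mono)
      have "D / s \<le> D" using D0 s by (simp add: field_simps)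
      also have "D \<le> exp (rate b * n)" using Dmax by simp
      also have "\<dots> \<le> exp (n / 4)" using mult_right_mono[OF c(13), of "real n"] by simp
      finally show "N_const b * D / s \<le> N_const b * exp (n / 4)"
        using c(7) unfolding times_divide_eq_right[symmetric] by (intro mult_left_mono) auto
    qed (use c(7) in \<open>auto simp flip: exp_of_nat_mult\<close>)
    also have "exp (real n) * exp (n / 2) * (N_const b * exp (n / 4) * exp (- 6 * real (card I)))
       = N_const b * exp (n + n / 2 + n / 4 + - 6 * real (card I))"
      by (simp only: exp_add mult_ac)
    also have "\<dots> \<le> N_const b * exp (- real n)"
      using fin(2) n2 c(7) by (intro mult_left_mono) auto
    finally show ?thesis by (simp add: D_def s_def)
  qed
  have D0: "2 ^ j * (sqrt (del b * n) / 2) > 0" for j using dn by simp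
  have "prob {\<omega> \<in> space M. lcd_bad I J n b (\<lambda>p. G p \<omega>)} \<le> card (lcd_levels n b) * (N_const b * exp (- real n))"
    unfolding lcd_bad_def
    by (intro union_bound single finite_lcd_levels lev_bad_measurable fin D0) measurable
  also have "\<dots> \<le> (2 * n) * (N_const b * exp (- real n))"
  proof (intro mult_right_mono)
    have "card (lcd_levels n b) \<le> card {..<2 * n}" by (intro card_mono) (auto simp: lcd_levels_def)
    then show "real (card (lcd_levels n b)) \<le> 2 * n" by simp
  qed (use c(7) in auto)
  finally show ?thesis by simp
qed

section \<open>The distance of a column to the span of the others\<close>

text \<open>Replacing row \<open>k\<close> by zero makes the determinant vanish, and a kernel vector
  of the altered matrix is orthogonal to all other rows.\<close>

lemma unit_kernel_exists:
  fixes g :: "nat \<times> nat \<Rightarrow> real"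
  assumes k: "k < n"
  shows "\<exists>a. (\<Sum>i<n. (a i)\<^sup>2) = 1 \<and> (\<forall>l\<in>{..<n} - {k}. mv {..<n} g a l = 0)"
proof -
  define c where "c l = vec n (\<lambda>i. g (l, i))" for l
  define A where "A = mat\<^sub>r n n (\<lambda>l. if l = k then 0\<^sub>v n else c l)"
  have A: "A \<in> carrier_mat n n" by (simp add: A_def)
  have "det A = 0" unfolding A_def by (rule det_row_0[OF k]) (auto simp: c_def)
  then obtain v where v: "v \<in> carrier_vec n" "v \<noteq> 0\<^sub>v n" "A *\<^sub>v v = 0\<^sub>v n"
    using det_0_iff_vec_prod_zero_field[OF A] by blast
  define s where "s = sqrt (\<Sum>i<n. (v $ i)\<^sup>2)"
  obtain i where "i < n" "v $ i \<noteq> 0" using v by (metis carrier_vecD eq_vecI index_zero_vec)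
  then have "0 < (\<Sum>i<n. (v $ i)\<^sup>2)" by (intro sum_pos2[of _ i]) auto
  then have s: "s > 0" "s\<^sup>2 = (\<Sum>i<n. (v $ i)\<^sup>2)" by (auto simp: s_def)
  define a where "a i = v $ i / s" for i
  have "(\<Sum>i<n. (a i)\<^sup>2) = 1" using s(1) by (simp add: a_def power_divide sum_divide_distrib[symmetric] s(2)[symmetric])
  moreover have "mv {..<n} g a l = 0" if l: "l \<in> {..<n} - {k}" for l
  proof -
    have "(A *\<^sub>v v) $ l = 0" using l v by simp
    then have "row A l \<bullet> v = 0" using l A by simp
    moreover have "row A l = c l" using l by (simp add: A_def c_def)
    ultimately have "(\<Sum>i<n. g (l, i) * v $ i) = 0"
      using v by (simp add: scalar_prod_def c_def lessThan_atLeast0)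
    moreover have "mv {..<n} g a l = (\<Sum>i<n. g (l, i) * v $ i) / s"
      by (simp add: mv_def a_def sum_divide_distrib mult_ac)
    ultimately show ?thesis by simp
  qed
  ultimately show ?thesis by blast
qed

text \<open>Conditioning in the form of Fubini's theorem: the joint law is a product, so a bound
  that holds for each fixed value of the second variable survives integration. It is used with
  column \<open>k\<close> as the first variable and the other columns as the second.\<close>

lemma (in prob_space) indep_section_bound:
  fixes q :: real
  assumes ind: "indep_var S X T Y" and E: "E \<in> sets (S \<Otimes>\<^sub>M T)" and q: "q \<ge> 0"
    and sec: "\<And>y. y \<in> space T \<Longrightarrow> prob {\<omega> \<in> space M. (X \<omega>, y) \<in> E} \<le> q"
  shows "prob {\<omega> \<in> space M. (X \<omega>, Y \<omega>) \<in> E} \<le> q"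
proof -
  have [measurable]: "X \<in> measurable M S" "Y \<in> measurable M T"
    using ind indep_var_rv1 indep_var_rv2 by blast+
  interpret X: prob_space "distr M S X" by (rule prob_space_distr) simp
  interpret Y: prob_space "distr M T Y" by (rule prob_space_distr) simp
  interpret P: pair_prob_space "distr M S X" "distr M T Y" ..
  have "emeasure M {\<omega> \<in> space M. (X \<omega>, Y \<omega>) \<in> E} = emeasure (distr M (S \<Otimes>\<^sub>M T) (\<lambda>x. (X x, Y x))) E"
    using E by (subst emeasure_distr) (auto intro!: arg_cong[where f = "emeasure M"])
  also have "\<dots> = emeasure (distr M S X \<Otimes>\<^sub>M distr M T Y) E"
    using ind indep_var_distribution_eq[of S X T Y] by simp
  also have "\<dots> = (\<integral>\<^sup>+y. emeasure (distr M S X) ((\<lambda>x. (x, y)) -` E) \<partial>distr M T Y)"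
    using E by (intro P.emeasure_pair_measure_alt2) simp
  also have "\<dots> \<le> (\<integral>\<^sup>+y. ennreal q \<partial>distr M T Y)"
  proof (intro nn_integral_mono)
    fix y assume "y \<in> space (distr M T Y)"
    then have y: "y \<in> space T" by simp
    have "(\<lambda>x. (x, y)) -` E \<in> sets S" using E by (rule sets_Pair2)
    then have "emeasure (distr M S X) ((\<lambda>x. (x, y)) -` E) = emeasure M {\<omega> \<in> space M. (X \<omega>, y) \<in> E}"
      by (subst emeasure_distr) (auto intro!: arg_cong[where f = "emeasure M"])
    also have "\<dots> \<le> ennreal q" using sec[OF y] by (simp add: emeasure_eq_measure ennreal_leI)
    finally show "emeasure (distr M S X) ((\<lambda>x. (x, y)) -` E) \<le> ennreal q" .
  qed
  also have "\<dots> = ennreal q" by (simp add: Y.emeasure_space_1[simplified])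
  finally show ?thesis using q by (simp add: emeasure_eq_measure)
qed

text \<open>Column \<open>k\<close> is within distance \<open>s\<close> of the span of the others: integral coefficients suffice by density and
  homogeneity, and make the event a countable union.\<close>

definition near_span :: "nat \<Rightarrow> nat \<Rightarrow> real \<Rightarrow> (nat \<times> nat \<Rightarrow> real) \<Rightarrow> bool" where
  "near_span n k s g \<longleftrightarrow> (\<exists>p\<in>{..<n} \<rightarrow>\<^sub>E (UNIV :: int set).
     L2_set (mv {..<n} g (\<lambda>j. real_of_int (p j))) {..<n} < s * \<bar>real_of_int (p k)\<bar>)"

lemma near_span_measurable:
  assumes [measurable]: "\<And>p. p \<in> {..<n} \<times> {..<n} \<Longrightarrow> G p \<in> borel_measurable M"
  shows "{\<omega> \<in> space M. near_span n k s (\<lambda>p. G p \<omega>)} \<in> sets M"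
  unfolding near_span_def mv_def L2_set_def
  by (intro sets.sets_Collect_countable_Ex' countable_PiE) auto

lemma near_spanI:
  assumes x: "L2_set (mv {..<n} g x) {..<n} < s * \<bar>x k\<bar>" and k: "k < n"
  shows "near_span n k s g"
proof -
  define y where "y N j = real_of_int \<lfloor>real (Suc N) * x j\<rfloor> / real (Suc N)" for N :: nat and j
  have y: "(\<lambda>N. y N j) \<longlonglongrightarrow> x j" for j
  proof (rule real_tendsto_sandwich)
    have "(\<lambda>N. x j - inverse (real (Suc N))) \<longlonglongrightarrow> x j - 0"
      by (intro tendsto_diff tendsto_const LIMSEQ_inverse_real_of_nat)
    then show "(\<lambda>N. x j - inverse (real (Suc N))) \<longlonglongrightarrow> x j" by simp
    show "\<forall>\<^sub>F N in sequentially. x j - inverse (real (Suc N)) \<le> y N j"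
    proof (intro always_eventually allI)
      fix N
      have "real (Suc N) * x j - 1 \<le> real_of_int \<lfloor>real (Suc N) * x j\<rfloor>" by linarith
      then have "(real (Suc N) * x j - 1) / real (Suc N) \<le> y N j" unfolding y_def by (intro divide_right_mono) auto
      then show "x j - inverse (real (Suc N)) \<le> y N j" by (simp add: diff_divide_distrib inverse_eq_divide)
    qed
    show "\<forall>\<^sub>F N in sequentially. y N j \<le> x j"
    proof (intro always_eventually allI)
      fix N
      have "y N j \<le> (real (Suc N) * x j) / real (Suc N)" unfolding y_def by (intro divide_right_mono) auto
      then show "y N j \<le> x j" by simp
    qed
  qed auto
  have "(\<lambda>N. L2_set (mv {..<n} g (y N)) {..<n} - s * \<bar>y N k\<bar>) \<longlonglongrightarrow> L2_set (mv {..<n} g x) {..<n} - s * \<bar>x k\<bar>"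
    unfolding L2_set_def mv_def by (intro tendsto_intros y)
  then have "\<forall>\<^sub>F N in sequentially. L2_set (mv {..<n} g (y N)) {..<n} - s * \<bar>y N k\<bar> < 0"
    using x by (intro order_tendstoD(2)) auto
  then obtain N where N: "L2_set (mv {..<n} g (y N)) {..<n} < s * \<bar>y N k\<bar>"
    by (auto simp: eventually_sequentially)
  define p where "p = (\<lambda>j\<in>{..<n}. \<lfloor>real (Suc N) * x j\<rfloor>)"
  have yp: "real (Suc N) * y N j = real_of_int (p j)" if "j < n" for j using that by (simp add: y_def p_def del: of_nat_Suc)
  have "L2_set (mv {..<n} g (\<lambda>j. real_of_int (p j))) {..<n} = L2_set (mv {..<n} g (\<lambda>j. real (Suc N) * y N j)) {..<n}"
    unfolding mv_def by (intro arg_cong2[where f = L2_set] ext sum.cong refl) (auto simp: yp simp del: of_nat_Suc)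
  also have "\<dots> = real (Suc N) * L2_set (mv {..<n} g (y N)) {..<n}"
  proof -
    have "mv {..<n} g (\<lambda>j. real (Suc N) * y N j) = (\<lambda>i. real (Suc N) * mv {..<n} g (y N) i)"
      by (intro ext mv_scale)
    then show ?thesis by (simp add: L2_set_right_distrib del: of_nat_Suc)
  qed
  also have "\<dots> < real (Suc N) * (s * \<bar>y N k\<bar>)" using N by (intro mult_strict_left_mono) auto
  also have "\<dots> = s * \<bar>real_of_int (p k)\<bar>" using yp[OF k, symmetric] by (simp add: abs_mult del: of_nat_Suc)
  finally show ?thesis unfolding near_span_def by (intro bexI[of _ p]) (auto simp: p_def)
qed

text \<open>Pairing the combination with the normal \<open>a\<close> annihilates every column except
  \<open>k\<close>, and Cauchy-Schwarz bounds the pairing by the length of the combination. The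
  strict inequality in \<open>near_span\<close> forces the coefficient of column \<open>k\<close> to
  be nonzero, so it can be cancelled.\<close>

lemma near_span_normal:
  assumes near: "near_span n k s g" and k: "k < n" and a: "(\<Sum>i<n. (a i)\<^sup>2) = 1"
    and orth: "\<And>l. l \<in> {..<n} - {k} \<Longrightarrow> (\<Sum>i<n. a i * g (i, l)) = 0"
  shows "\<bar>\<Sum>i<n. a i * g (i, k)\<bar> < s"
proof -
  obtain p where p: "L2_set (mv {..<n} g (\<lambda>j. real_of_int (p j))) {..<n} < s * \<bar>real_of_int (p k)\<bar>"
    using near by (auto simp: near_span_def)
  let ?v = "mv {..<n} g (\<lambda>j. real_of_int (p j))"
  have "(\<Sum>i<n. a i * ?v i) = (\<Sum>j<n. \<Sum>i<n. a i * (real_of_int (p j) * g (i, j)))"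
    unfolding mv_def sum_distrib_left by (rule sum.swap)
  also have "\<dots> = (\<Sum>j<n. real_of_int (p j) * (\<Sum>i<n. a i * g (i, j)))"
    by (simp add: sum_distrib_left mult_ac)
  also have "\<dots> = (\<Sum>j\<in>{k}. real_of_int (p j) * (\<Sum>i<n. a i * g (i, j)))"
    using k orth by (intro sum.mono_neutral_right) auto
  finally have e: "(\<Sum>i<n. a i * ?v i) = real_of_int (p k) * (\<Sum>i<n. a i * g (i, k))" by simp
  have "\<bar>\<Sum>i<n. a i * ?v i\<bar> \<le> (\<Sum>i<n. \<bar>a i\<bar> * \<bar>?v i\<bar>)" by (simp add: sum_abs abs_mult[symmetric])
  also have "\<dots> \<le> L2_set a {..<n} * L2_set ?v {..<n}" by (rule L2_set_mult_ineq)
  also have "\<dots> = L2_set ?v {..<n}" using a by (simp add: L2_set_def)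
  finally have "\<bar>real_of_int (p k)\<bar> * \<bar>\<Sum>i<n. a i * g (i, k)\<bar> < s * \<bar>real_of_int (p k)\<bar>" using p e by (simp add: abs_mult)
  then have *: "\<bar>real_of_int (p k)\<bar> * \<bar>\<Sum>i<n. a i * g (i, k)\<bar> < \<bar>real_of_int (p k)\<bar> * s" by (simp add: mult.commute)
  show ?thesis using mult_less_cancel_left_pos[THEN iffD1, OF _ *] * by (cases "p k = 0") auto
qed

section \<open>Exceptional matrices and the normal to the remaining columns\<close>

definition bad_matrix :: "nat set \<Rightarrow> nat \<Rightarrow> real \<Rightarrow> (nat \<times> nat \<Rightarrow> real) \<Rightarrow> bool" where
  "bad_matrix I n b g \<longleftrightarrow> op_bad I {..<n} n b g \<or> comp_bad I {..<n} (del b * n) (rho b) b g"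

lemma bad_matrix_measurable:
  assumes "finite I" "card I \<le> n" "n \<ge> 1" "b \<ge> 1" "\<And>p. p \<in> I \<times> {..<n} \<Longrightarrow> G p \<in> borel_measurable M"
  shows "{\<omega> \<in> space M. bad_matrix I n b (\<lambda>p. G p \<omega>)} \<in> sets M"
  unfolding bad_matrix_def using assms const_bounds[of b]
  by (intro sets.sets_Collect_disj op_bad_measurable comp_bad_measurable) auto

lemma (in prob_space) bad_matrix_prob:
  assumes I: "finite I" "card I \<le> n" "n \<le> 2 * card I" and n: "n \<ge> 1" and b: "b \<ge> 1"
    and ind: "indep_matrix M I {..<n} G" and sg: "\<And>p. p \<in> I \<times> {..<n} \<Longrightarrow> sg_var M b (G p)"
  shows "prob {\<omega> \<in> space M. bad_matrix I n b (\<lambda>p. G p \<omega>)} \<le> 2 * exp (- rate b * n)"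
proof -
  note [measurable] = sg_varD(1)[OF sg]
  note c = const_bounds[OF b]
  note p = spread_bounds[OF b]
  let ?O = "{\<omega> \<in> space M. op_bad I {..<n} n b (\<lambda>p. G p \<omega>)}"
  let ?C = "{\<omega> \<in> space M. comp_bad I {..<n} (del b * n) (rho b) b (\<lambda>p. G p \<omega>)}"
  have rate: "rate b \<le> spread b / 16"
  proof -
    have "(mu b)\<^sup>2 \<le> (1/6)\<^sup>2" using c by (intro power_mono) auto
    then have "spread b * (mu b)\<^sup>2 \<le> spread b * (1/16)" using p by (intro mult_left_mono) (auto simp: power2_eq_square)
    then show ?thesis by (simp add: rate_def)
  qed
  have k: "del b * n * (64 / spread b + 2 / rho b) \<le> spread b * n / 32"
  proof -
    have "64 / spread b + 2 / rho b \<le> 66 / (spread b * rho b)"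
    proof -
      have "64 / spread b \<le> 64 / (spread b * rho b)" using p c by (intro divide_left_mono) auto
      moreover have "2 / rho b \<le> 2 / (spread b * rho b)" using p c by (intro divide_left_mono) auto
      ultimately show ?thesis by (simp add: add_divide_distrib[symmetric])
    qed
    then have "del b * n * (64 / spread b + 2 / rho b) \<le> del b * n * (66 / (spread b * rho b))"
      using c by (intro mult_left_mono) auto
    also have "\<dots> = spread b * n / 32" using p c by (simp add: del_def power2_eq_square)
    finally show ?thesis .
  qed
  have "prob {\<omega> \<in> space M. bad_matrix I n b (\<lambda>p. G p \<omega>)} = prob (?O \<union> ?C)"
    by (intro arg_cong[where f = prob]) (auto simp: bad_matrix_def)
  also have "\<dots> \<le> prob ?O + prob ?C"
    using I n c by (intro measure_Un_le op_bad_measurable comp_bad_measurable) auto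
  also have "prob ?O \<le> exp (- real n)"
    using I n b by (intro op_bad_prob ind sg) auto
  also have "prob ?C \<le> exp (- spread b * n / 16)"
    using I n b c by (intro comp_bad_prob k ind sg) auto
  also have "exp (- real n) \<le> exp (- rate b * n)" using mult_right_mono[of "rate b" 1 "real n"] c by simp
  also have "exp (- spread b * n / 16) \<le> exp (- rate b * n)" using mult_right_mono[OF rate, of "real n"] by simp
  finally show ?thesis by simp
qed

text \<open>After transposition the columns other than \<open>k\<close> become rows, and a normal to
  them is a kernel vector. Column \<open>k\<close> does not enter, so this event is independent of
  it.\<close>

definition col_bad :: "nat \<Rightarrow> nat \<Rightarrow> real \<Rightarrow> (nat \<times> nat \<Rightarrow> real) \<Rightarrow> bool" where
  "col_bad n k b g \<longleftrightarrow> bad_matrix ({..<n} - {k}) n b (g \<circ> prod.swap) \<or> lcd_bad ({..<n} - {k}) {..<n} n b (g \<circ> prod.swap)"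

text \<open>The exceptional events see the matrix only through the products of the rows in
  \<open>I\<close> with vectors. This makes precise that \<open>col_bad\<close> depends only on the
  columns other than \<open>k\<close>.\<close>

lemma bad_mv_cong:
  assumes "\<And>i x. i \<in> I \<Longrightarrow> mv {..<n} g x i = mv {..<n} h x i"
  shows "bad_matrix I n b g = bad_matrix I n b h" "lcd_bad I {..<n} n b g = lcd_bad I {..<n} n b h"
  using assms by (simp_all add: bad_matrix_def op_bad_def comp_bad_def lcd_bad_def lev_bad_def cong: sum.cong)

lemma col_bad_measurable:
  assumes "k < n" "n \<ge> 1" "b \<ge> 1" "\<And>p. p \<in> {..<n} \<times> ({..<n} - {k}) \<Longrightarrow> G p \<in> borel_measurable M"
  shows "{\<omega> \<in> space M. col_bad n k b (\<lambda>p. G p \<omega>)} \<in> sets M"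
proof -
  have m: "G (prod.swap p) \<in> borel_measurable M" if "p \<in> ({..<n} - {k}) \<times> {..<n}" for p
    using that by (intro assms(4)) auto
  have "{\<omega> \<in> space M. bad_matrix ({..<n} - {k}) n b (\<lambda>p. G (prod.swap p) \<omega>) \<or> lcd_bad ({..<n} - {k}) {..<n} n b (\<lambda>p. G (prod.swap p) \<omega>)} \<in> sets M"
    using assms(1-3) by (intro sets.sets_Collect_disj bad_matrix_measurable lcd_bad_measurable m) auto
  then show ?thesis by (simp add: col_bad_def comp_def)
qed

text \<open>A unit normal is mapped to zero by the transposed remaining columns, so
  \<open>comp_good_bound\<close> rules out that it is compressible, and \<open>lcd_good\<close> then
  gives it a large denominator.\<close>

lemma col_good_normal:
  assumes k: "k < n" and b: "b \<ge> 1" and n: "dim0 b \<le> n" and good: "\<not> col_bad n k b g"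
  shows "\<exists>a. (\<Sum>i<n. (a i)\<^sup>2) = 1 \<and> (\<forall>l\<in>{..<n} - {k}. (\<Sum>i<n. a i * g (i, l)) = 0) \<and>
    lcd {..<n} a (rho b) (mu b * sqrt n) (exp (rate b * n))"
proof -
  note c = const_bounds[OF b]
  note p = spread_bounds[OF b]
  let ?I = "{..<n} - {k}"
  let ?h = "g \<circ> prod.swap"
  have n2: "n \<ge> 2" using n c(14) by linarith
  have cI: "card ?I = n - 1" using k by simp
  obtain a where a: "(\<Sum>i<n. (a i)\<^sup>2) = 1" and ker: "\<And>l. l \<in> ?I \<Longrightarrow> mv {..<n} ?h a l = 0"
    using unit_kernel_exists[OF k, of ?h] by blast
  have gd: "\<not> op_bad ?I {..<n} n b ?h" "\<not> comp_bad ?I {..<n} (del b * n) (rho b) b ?h" "\<not> lcd_bad ?I {..<n} n b ?h"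
    using good by (auto simp: col_bad_def bad_matrix_def)
  have "\<not> compressible {..<n} (del b * n) (rho b) a"
  proof
    assume comp: "compressible {..<n} (del b * n) (rho b) a"
    have "sqrt (spread b * n) / 24 \<le> L2_set (mv {..<n} ?h a) ?I"
    proof (rule comp_good_bound[OF _ _ _ _ _ _ b _ _ _ gd(1,2) a comp])
      show "360 * b * rho b \<le> sqrt (spread b) / 48" using b by (simp add: rho_def K_const_def)
    qed (use cI n2 c in auto)
    also have "\<dots> = 0" using ker by (simp add: L2_set_def)
    finally show False using p n2 by (simp add: mult_le_0_iff)
  qed
  then have "lcd {..<n} a (rho b) (mu b * sqrt n) (exp (rate b * n))"
    using cI by (intro lcd_good[OF _ _ _ _ b n gd(1,3) a _ ker]) auto
  moreover have "(\<Sum>i<n. a i * g (i, l)) = 0" if "l \<in> ?I" for l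
    using ker[OF that] by (simp add: mv_def)
  ultimately show ?thesis using a by blast
qed

definition F_const :: "real \<Rightarrow> real" where "F_const b = 2 + 4 * N_const b + 4 * L_const b"

lemma (in prob_space) indep_matrix_swap:
  assumes "indep_matrix M I J A" "I' \<subseteq> J"
  shows "indep_matrix M I' I (\<lambda>p. A (prod.swap p))"
  using assms by (intro indep_vars_reindex[where f = prod.swap]) auto

lemma (in prob_space) col_bad_prob:
  assumes k: "k < n" and b: "b \<ge> 1" and n: "dim0 b \<le> n"
    and ind: "indep_matrix M {..<n} {..<n} A" and sg: "\<And>p. p \<in> {..<n} \<times> {..<n} \<Longrightarrow> sg_var M b (A p)"
    and law: "\<And>j. j < n \<Longrightarrow> \<exists>\<nu>. \<forall>i<n. distr M borel (A (i, j)) = \<nu>"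
  shows "prob {\<omega> \<in> space M. col_bad n k b (\<lambda>p. A p \<omega>)} \<le> (2 + 4 * N_const b) * exp (- rate b * n)"
proof -
  note [measurable] = sg_varD(1)[OF sg]
  note c = const_bounds[OF b]
  let ?I = "{..<n} - {k}"
  have n2: "n \<ge> 2" using n c(14) by linarith
  have cI: "card ?I = n - 1" using k by simp
  let ?G = "\<lambda>p. A (prod.swap p)"
  have indG: "indep_matrix M ?I {..<n} ?G" by (rule indep_matrix_swap[OF ind]) auto
  let ?B = "{\<omega> \<in> space M. bad_matrix ?I n b (\<lambda>p. ?G p \<omega>)}"
  let ?L = "{\<omega> \<in> space M. lcd_bad ?I {..<n} n b (\<lambda>p. ?G p \<omega>)}"
  have "prob {\<omega> \<in> space M. col_bad n k b (\<lambda>p. A p \<omega>)} = prob (?B \<union> ?L)"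
    by (intro arg_cong[where f = prob]) (auto simp: col_bad_def comp_def)
  also have "\<dots> \<le> prob ?B + prob ?L"
    using cI n2 b by (intro measure_Un_le bad_matrix_measurable lcd_bad_measurable) auto
  also have "prob ?B \<le> 2 * exp (- rate b * n)"
    using cI n2 b by (intro bad_matrix_prob indG sg) auto
  also have "prob ?L \<le> 2 * real n * (N_const b * exp (- real n))"
  proof (rule lcd_bad_prob[OF _ _ _ _ b n indG])
    show "row_law M ?I {..<n} ?G"
    proof
      fix l assume "l \<in> ?I"
      then obtain \<nu> where "\<forall>i<n. distr M borel (A (i, l)) = \<nu>" using law[of l] by auto
      then show "\<exists>\<nu>. \<forall>j\<in>{..<n}. distr M borel (?G (l, j)) = \<nu>" by (intro exI[of _ \<nu>]) auto
    qed
  qed (use cI n2 sg in auto)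
  also have "2 * real n * (N_const b * exp (- real n)) \<le> 2 * (2 * exp (n / 2)) * (N_const b * exp (- real n))"
  proof (intro mult_right_mono mult_left_mono)
    show "real n \<le> 2 * exp (n / 2)" using exp_ge_add_one_self[of "n / 2"] by linarith
  qed (use c in auto)
  also have "\<dots> = 4 * N_const b * exp (- real n / 2)" by (simp add: mult_ac flip: exp_add)
  also have "\<dots> \<le> 4 * N_const b * exp (- rate b * n)"
    using c mult_right_mono[of "rate b" "1/2" "real n"] by (intro mult_left_mono) auto
  finally show ?thesis by (simp add: algebra_simps)
qed

text \<open>The columns other than \<open>k\<close> are frozen. If they form a
  \<open>col_bad\<close> configuration, the section of \<open>E\<close> is empty. Otherwise they
  have a normal \<open>a\<close> with large denominator, and the event forces the pairing of
  \<open>a\<close> with column \<open>k\<close> below \<open>s\<close>, to which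
  \<open>sg_small_ball\<close> applies. Since \<open>a\<close> is chosen after the columns are
  fixed, it need not depend on them measurably.\<close>

lemma (in prob_space) near_span_prob:
  assumes k: "k < n" and b: "b \<ge> 1" and n: "dim0 b \<le> n" and s: "s > 0"
    and ind: "indep_matrix M {..<n} {..<n} A" and sg: "\<And>p. p \<in> {..<n} \<times> {..<n} \<Longrightarrow> sg_var M b (A p)"
    and law: "\<And>j. j < n \<Longrightarrow> \<exists>\<nu>. \<forall>i<n. distr M borel (A (i, j)) = \<nu>"
  shows "prob {\<omega> \<in> space M. near_span n k s (\<lambda>p. A p \<omega>)} \<le> 2 * L_const b * s + F_const b * exp (- rate b * n)"
proof -
  note [measurable] = sg_varD(1)[OF sg]
  note c = const_bounds[OF b]
  have n2: "n \<ge> 2" using n c(14) by linarith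
  define P Q where "P = {..<n} \<times> {k}" and "Q = {..<n} \<times> ({..<n} - {k})"
  define S T where "S = PiM P (\<lambda>_. borel :: real measure)" and "T = PiM Q (\<lambda>_. borel :: real measure)"
  define X Y where "X \<omega> = restrict (\<lambda>p. A p \<omega>) P" and "Y \<omega> = restrict (\<lambda>p. A p \<omega>) Q" for \<omega>
  have iv: "indep_var S X T Y"
    unfolding S_def T_def X_def Y_def using k by (intro indep_var_restrict[OF ind]) (auto simp: P_def Q_def)
  define H where "H xy p = (if p \<in> P then fst xy p else snd xy p)" for xy :: "(nat \<times> nat \<Rightarrow> real) \<times> (nat \<times> nat \<Rightarrow> real)" and p
  have Hm: "(\<lambda>xy. H xy p) \<in> borel_measurable (S \<Otimes>\<^sub>M T)" if "p \<in> {..<n} \<times> {..<n}" for p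
  proof (cases "p \<in> P")
    case True
    then show ?thesis unfolding H_def S_def by simp
  next
    case False
    then have "p \<in> Q" using that by (auto simp: P_def Q_def)
    then show ?thesis using False unfolding H_def T_def by simp
  qed
  define E where "E = {xy \<in> space (S \<Otimes>\<^sub>M T). \<not> col_bad n k b (\<lambda>p. H xy p) \<and> near_span n k s (\<lambda>p. H xy p)}"
  have E: "E \<in> sets (S \<Otimes>\<^sub>M T)"
    unfolding E_def using k n2 b
    by (intro sets.sets_Collect_conj sets.sets_Collect_neg col_bad_measurable near_span_measurable Hm) auto
  have HA: "H (X \<omega>, Y \<omega>) p = A p \<omega>" if "p \<in> {..<n} \<times> {..<n}" for p \<omega>
    using that by (auto simp: H_def X_def Y_def P_def Q_def)
  have col_cong: "col_bad n k b g = col_bad n k b h" if "\<And>p. p \<in> Q \<Longrightarrow> g p = h p" for g h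
  proof -
    have "mv {..<n} (g \<circ> prod.swap) x i = mv {..<n} (h \<circ> prod.swap) x i" if "i \<in> {..<n} - {k}" for x i
      using that \<open>\<And>p. p \<in> Q \<Longrightarrow> g p = h p\<close> by (auto simp: mv_def Q_def intro!: sum.cong)
    then show ?thesis
      unfolding col_bad_def using bad_mv_cong[of "{..<n} - {k}" n "g \<circ> prod.swap" "h \<circ> prod.swap" b] by blast
  qed
  have near_cong: "near_span n k s g = near_span n k s h" if "\<And>p. p \<in> {..<n} \<times> {..<n} \<Longrightarrow> g p = h p" for g h
  proof -
    have "mv {..<n} g x i = mv {..<n} h x i" if "i \<in> {..<n}" for x i
      using that \<open>\<And>p. p \<in> {..<n} \<times> {..<n} \<Longrightarrow> g p = h p\<close> by (auto simp: mv_def intro!: sum.cong)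
    then show ?thesis by (simp add: near_span_def cong: L2_set_cong del: lessThan_iff)
  qed
  define q where "q = 2 * L_const b * (s + 2 * exp (- rate b * n))"
  have q0: "q \<ge> 0" using c s by (simp add: q_def)
  have sec: "prob {\<omega> \<in> space M. (X \<omega>, y) \<in> E} \<le> q" if y: "y \<in> space T" for y
  \<comment> \<open>The value \<open>undefined\<close> stands in for column \<open>k\<close>, whose
    entries are read neither by \<open>col_bad\<close> nor by the orthogonality relations.\<close>
  proof (cases "col_bad n k b (\<lambda>p. H (undefined, y) p)")
    case True
    have "col_bad n k b (\<lambda>p. H (X \<omega>, y) p)" for \<omega>
    proof -
      have "col_bad n k b (\<lambda>p. H (X \<omega>, y) p) = col_bad n k b (\<lambda>p. H (undefined, y) p)"
        by (rule col_cong) (auto simp: H_def P_def Q_def)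
      then show ?thesis using True by simp
    qed
    then have "{\<omega> \<in> space M. (X \<omega>, y) \<in> E} = {}" by (auto simp: E_def)
    then show ?thesis using q0 by (simp only: measure_empty)
  next
    case False
    obtain a where a: "(\<Sum>i<n. (a i)\<^sup>2) = 1" "\<And>l. l \<in> {..<n} - {k} \<Longrightarrow> (\<Sum>i<n. a i * H (undefined, y) (i, l)) = 0"
       "lcd {..<n} a (rho b) (mu b * sqrt n) (exp (rate b * n))"
      using col_good_normal[OF k b n False] by blast
    define Z where "Z \<omega> = (\<Sum>i<n. a i * A (i, k) \<omega>)" for \<omega>
    have [measurable]: "A (i, k) \<in> borel_measurable M" if "i \<in> {..<n}" for i
      using sg_varD(1)[OF sg, of "(i, k)"] that k by auto
    have Zm[measurable]: "Z \<in> borel_measurable M" unfolding Z_def by measurable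
    have "{\<omega> \<in> space M. (X \<omega>, y) \<in> E} \<subseteq> {\<omega> \<in> space M. (Z \<omega> / s)\<^sup>2 / 2 \<le> 1 / 2}"
    proof
      fix \<omega> assume \<omega>: "\<omega> \<in> {\<omega> \<in> space M. (X \<omega>, y) \<in> E}"
      then have near: "near_span n k s (\<lambda>p. H (X \<omega>, y) p)" by (auto simp: E_def)
      have "\<bar>\<Sum>i<n. a i * H (X \<omega>, y) (i, k)\<bar> < s"
      proof (rule near_span_normal[OF near k a(1)])
        fix l assume l: "l \<in> {..<n} - {k}"
        then have "H (X \<omega>, y) (i, l) = H (undefined, y) (i, l)" for i by (auto simp: H_def P_def)
        then show "(\<Sum>i<n. a i * H (X \<omega>, y) (i, l)) = 0" using a(2)[OF l] by simp
      qed
      also have "(\<Sum>i<n. a i * H (X \<omega>, y) (i, k)) = Z \<omega>"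
        unfolding Z_def by (intro sum.cong) (auto simp: H_def X_def P_def)
      finally have "\<bar>Z \<omega> / s\<bar> \<le> 1" using s by (simp add: abs_divide)
      then have "(Z \<omega> / s)\<^sup>2 \<le> 1" by (simp add: abs_square_le_1)
      then show "\<omega> \<in> {\<omega> \<in> space M. (Z \<omega> / s)\<^sup>2 / 2 \<le> 1 / 2}" using \<omega> by simp
    qed
    then have "prob {\<omega> \<in> space M. (X \<omega>, y) \<in> E} \<le> prob {\<omega> \<in> space M. (Z \<omega> / s)\<^sup>2 / 2 \<le> 1 / 2}"
      by (intro finite_measure_mono) measurable
    also have "\<dots> \<le> q"
    proof -
      obtain \<nu> where \<nu>: "\<And>i. i < n \<Longrightarrow> distr M borel (A (i, k)) = \<nu>" using law[OF k] by blast
      have "(\<integral>\<^sup>+\<omega>. ennreal (exp (- 1 * ((Z \<omega> / s)\<^sup>2 / 2))) * indicator (space M) \<omega> \<partial>M)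
         = (\<integral>\<^sup>+\<omega>. ennreal (exp (- ((\<Sum>i<n. a i * A (i, k) \<omega>) / s)\<^sup>2 / 2)) \<partial>M)"
        by (intro nn_integral_cong) (simp add: Z_def)
      also have "\<dots> \<le> ennreal (128 / (rho b * sqrt (spread b)) * (s + 1 / exp (rate b * n)) + 4 * exp (- spread b * (mu b * sqrt n)\<^sup>2))"
      proof (rule sg_small_ball[OF _ _ \<nu> _ b a(1,3)])
        show "indep_vars (\<lambda>_. borel) (\<lambda>i. A (i, k)) {..<n}"
          using k by (intro indep_vars_reindex[OF ind, where f = "\<lambda>i. (i, k)"]) (auto simp: inj_on_def)
      qed (use c s k sg in auto)
      also have "128 / (rho b * sqrt (spread b)) * (s + 1 / exp (rate b * n)) + 4 * exp (- spread b * (mu b * sqrt n)\<^sup>2)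
         \<le> L_const b * (s + 2 * exp (- rate b * n))"
      proof -
        have e1: "exp (- spread b * (mu b * sqrt n)\<^sup>2) = exp (- rate b * n)"
          by (simp add: rate_def power_mult_distrib mult_ac)
        have e2: "1 / exp (rate b * n) = exp (- rate b * n)" by (simp add: exp_minus field_simps)
        have "4 * exp (- rate b * n) \<le> L_const b * exp (- rate b * n)" using c by (intro mult_right_mono) auto
        then have "L_const b * (s + exp (- rate b * n)) + 4 * exp (- rate b * n) \<le> L_const b * (s + exp (- rate b * n)) + L_const b * exp (- rate b * n)"
          by (rule add_left_mono)
        also have "\<dots> = L_const b * (s + 2 * exp (- rate b * n))" by (simp add: algebra_simps)
        finally show ?thesis unfolding L_const_def[symmetric] e1 e2 .
      qed
      finally have I: "(\<integral>\<^sup>+\<omega>. ennreal (exp (- 1 * ((Z \<omega> / s)\<^sup>2 / 2))) * indicator (space M) \<omega> \<partial>M)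
        \<le> ennreal (L_const b * (s + 2 * exp (- rate b * n)))" by (simp add: ennreal_leI)
      have "emeasure M {\<omega> \<in> space M. (Z \<omega> / s)\<^sup>2 / 2 \<le> 1 / 2} \<le>
        ennreal (exp (1 * (1/2))) * (\<integral>\<^sup>+\<omega>. ennreal (exp (- 1 * ((Z \<omega> / s)\<^sup>2 / 2))) * indicator (space M) \<omega> \<partial>M)"
        by (intro Chernoff_ineq_nn_integral_le) auto
      also have "\<dots> \<le> ennreal 2 * ennreal (L_const b * (s + 2 * exp (- rate b * n)))"
      proof (intro mult_mono I)
        show "ennreal (exp (1 * (1/2))) \<le> ennreal 2"
          using exp_bound[of "1/2::real"] by (intro ennreal_leI) (simp add: power2_eq_square)
      qed auto
      also have "\<dots> = ennreal q" unfolding q_def mult.assoc[of 2] by (rule ennreal_mult'[symmetric]) simp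
      finally show ?thesis using q0 by (simp add: emeasure_eq_measure)
    qed
    finally show ?thesis .
  qed
  have XYsp: "(X \<omega>, Y \<omega>) \<in> space (S \<Otimes>\<^sub>M T)" for \<omega>
    by (auto simp: space_pair_measure S_def T_def space_PiM X_def Y_def)
  let ?N = "{\<omega> \<in> space M. near_span n k s (\<lambda>p. A p \<omega>)}"
  let ?C = "{\<omega> \<in> space M. col_bad n k b (\<lambda>p. A p \<omega>)}"
  have eqs: "near_span n k s (\<lambda>p. H (X \<omega>, Y \<omega>) p) = near_span n k s (\<lambda>p. A p \<omega>)"
    "col_bad n k b (\<lambda>p. H (X \<omega>, Y \<omega>) p) = col_bad n k b (\<lambda>p. A p \<omega>)" for \<omega>
    by (rule near_cong, rule HA, assumption) (rule col_cong, rule HA, auto simp: Q_def)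
  have "?N \<subseteq> ?C \<union> {\<omega> \<in> space M. (X \<omega>, Y \<omega>) \<in> E}"
    using XYsp by (auto simp: E_def eqs)
  moreover have Em: "{\<omega> \<in> space M. (X \<omega>, Y \<omega>) \<in> E} \<in> sets M"
  proof -
    have [measurable]: "X \<in> measurable M S" "Y \<in> measurable M T" using iv indep_var_rv1 indep_var_rv2 by blast+
    note [measurable] = E
    show ?thesis by measurable
  qed
  moreover have Cm: "?C \<in> sets M" using k n2 b by (intro col_bad_measurable) auto
  ultimately have "prob ?N \<le> prob (?C \<union> {\<omega> \<in> space M. (X \<omega>, Y \<omega>) \<in> E})"
    by (intro finite_measure_mono) auto
  also have "\<dots> \<le> prob ?C + prob {\<omega> \<in> space M. (X \<omega>, Y \<omega>) \<in> E}"
    using Em Cm by (intro measure_Un_le)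
  also have "prob {\<omega> \<in> space M. (X \<omega>, Y \<omega>) \<in> E} \<le> q"
    by (rule indep_section_bound[OF iv E q0 sec])
  also have "prob ?C \<le> (2 + 4 * N_const b) * exp (- rate b * n)"
    by (rule col_bad_prob[OF k b n ind sg law])
  finally show ?thesis by (simp add: q_def F_const_def algebra_simps)
qed

section \<open>Invertibility in large dimension\<close>

text \<open>The first summand comes from the distances of the columns: \<open>near_span_prob\<close>
  at \<open>s = t / rho b\<close>, divided by \<open>del b\<close> through Markov's inequality. The
  second makes the claim trivial once \<open>t\<close> is at least
  \<open>sqrt (spread b) / 24\<close>.\<close>

definition big_C :: "real \<Rightarrow> real" where
  "big_C b = 2 * L_const b / (del b * rho b) + 24 / sqrt (spread b)"
definition H_const :: "real \<Rightarrow> real" where "H_const b = 2 + F_const b / del b"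
text \<open>Beyond this dimension the prefactor \<open>H_const b\<close> of
  \<open>exp (- rate b * n)\<close> is absorbed by giving up half of the rate.\<close>

definition dim1 :: "real \<Rightarrow> real" where "dim1 b = dim0 b + 2 * H_const b / rate b"

lemma const_bounds':
  assumes b: "b \<ge> 1"
  shows "F_const b > 0" "H_const b > 0" "big_C b > 0" "dim1 b \<ge> dim0 b"
proof -
  note c = const_bounds[OF b]
  note p = spread_bounds[OF b]
  show F: "F_const b > 0" using c by (simp add: F_const_def)
  show H: "H_const b > 0" using F c by (simp add: H_const_def add_pos_pos)
  show "big_C b > 0" unfolding big_C_def using c p by (intro add_pos_pos) auto
  show "dim1 b \<ge> dim0 b" using H c by (simp add: dim1_def)
qed

text \<open>Otherwise the large coordinates form a support witnessing compressibility, since all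
  others together contribute at most \<open>n\<close> times \<open>r\<^sup>2 / n\<close>.\<close>

lemma many_large_coordinates:
  assumes nc: "\<not> compressible {..<n} k r x" and n: "n \<ge> 1" and r: "r \<ge> 0"
  shows "k < card {j \<in> {..<n}. r / sqrt n \<le> \<bar>x j\<bar>}"
proof (rule ccontr)
  define S where "S = {j \<in> {..<n}. r / sqrt n \<le> \<bar>x j\<bar>}"
  assume "\<not> k < card {j \<in> {..<n}. r / sqrt n \<le> \<bar>x j\<bar>}"
  then have cS: "card S \<le> k" by (simp add: S_def)
  have "(\<Sum>j\<in>{..<n} - S. (x j)\<^sup>2) \<le> (\<Sum>j\<in>{..<n} - S. r\<^sup>2 / n)"
  proof (intro sum_mono)
    fix j assume "j \<in> {..<n} - S"
    then have "\<bar>x j\<bar> \<le> r / sqrt n" by (auto simp: S_def)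
    then have "\<bar>x j\<bar>\<^sup>2 \<le> (r / sqrt n)\<^sup>2" by (intro power_mono) auto
    then show "(x j)\<^sup>2 \<le> r\<^sup>2 / n" by (simp add: power_divide)
  qed
  also have "\<dots> \<le> n * (r\<^sup>2 / n)"
  proof -
    have "card ({..<n} - S) \<le> n" using card_mono[of "{..<n}" "{..<n} - S"] by auto
    then have "real (card ({..<n} - S)) * (r\<^sup>2 / n) \<le> real n * (r\<^sup>2 / n)" by (intro mult_right_mono) auto
    then show ?thesis by simp
  qed
  finally have "(\<Sum>j\<in>{..<n} - S. (x j)\<^sup>2) \<le> r\<^sup>2" using n by simp
  with cS nc show False unfolding compressible_def by (auto simp: S_def)
qed

text \<open>With \<open>k = del b * n\<close> and \<open>n\<close> columns this loses only the
  factor \<open>1 / del b\<close>, where a union bound over the columns would lose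
  \<open>n\<close>.\<close>

lemma (in prob_space) markov_card:
  fixes q k :: real
  assumes fin: "finite J" and m: "\<And>j. j \<in> J \<Longrightarrow> {\<omega> \<in> space M. P j \<omega>} \<in> events"
    and q: "\<And>j. j \<in> J \<Longrightarrow> prob {\<omega> \<in> space M. P j \<omega>} \<le> q" and k: "k > 0"
  shows "{\<omega> \<in> space M. k < card {j \<in> J. P j \<omega>}} \<in> events"
    and "prob {\<omega> \<in> space M. k < card {j \<in> J. P j \<omega>}} \<le> card J * q / k"
proof -
  define Z where "Z \<omega> = (\<Sum>j\<in>J. indicat_real {\<omega> \<in> space M. P j \<omega>} \<omega>)" for \<omega>
  have Zm[measurable]: "Z \<in> borel_measurable M" unfolding Z_def using m by measurable
  have Z: "Z \<omega> = card {j \<in> J. P j \<omega>}" if "\<omega> \<in> space M" for \<omega>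
    using that fin by (simp add: Z_def indicator_def sum.If_cases Int_def)
  then have eq: "{\<omega> \<in> space M. k < card {j \<in> J. P j \<omega>}} = {\<omega> \<in> space M. k < Z \<omega>}" by auto
  show ev: "{\<omega> \<in> space M. k < card {j \<in> J. P j \<omega>}} \<in> events" unfolding eq by measurable
  have ii: "integrable M (indicat_real A)" if "A \<in> events" for A
    using that by (intro integrable_real_indicator) (auto simp: emeasure_eq_measure)
  have "k * prob {\<omega> \<in> space M. k < Z \<omega>} = (\<integral>\<omega>. k * indicat_real {\<omega> \<in> space M. k < Z \<omega>} \<omega> \<partial>M)"
    using ii[OF ev[unfolded eq]] ev[unfolded eq] by simp
  also have "\<dots> \<le> (\<integral>\<omega>. Z \<omega> \<partial>M)"
  proof (intro integral_mono)
    show "integrable M (\<lambda>\<omega>. k * indicat_real {\<omega> \<in> space M. k < Z \<omega>} \<omega>)"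
      using ii[OF ev[unfolded eq]] by (intro integrable_mult_right)
    show "integrable M Z" unfolding Z_def using m ii by (intro Bochner_Integration.integrable_sum) auto
    fix \<omega> show "k * indicat_real {\<omega> \<in> space M. k < Z \<omega>} \<omega> \<le> Z \<omega>"
      using k by (auto split: split_indicator simp: Z_def sum_nonneg)
  qed
  also have "\<dots> = (\<Sum>j\<in>J. prob {\<omega> \<in> space M. P j \<omega>})"
    unfolding Z_def using m ii by (subst Bochner_Integration.integral_sum) (auto intro!: sum.cong)
  also have "\<dots> \<le> (\<Sum>j\<in>J. q)" by (intro sum_mono q)
  finally show "prob {\<omega> \<in> space M. k < card {j \<in> J. P j \<omega>}} \<le> card J * q / k"
    unfolding eq using k by (simp add: field_simps)
qed

text \<open>The quantifier ranges over all real unit vectors, so measurability of the event is not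
  evident; the bounds below are therefore stated for a measurable \<open>W\<close> that contains
  it.\<close>

definition small_sv :: "nat \<Rightarrow> real \<Rightarrow> (nat \<times> nat \<Rightarrow> real) \<Rightarrow> bool" where
  "small_sv n t g \<longleftrightarrow> (\<exists>x. (\<Sum>i<n. (x i)\<^sup>2) = 1 \<and> L2_set (mv {..<n} g x) {..<n} < t / sqrt n)"

lemma (in prob_space) small_sv_large_dim:
  assumes b: "b \<ge> 1" and n: "dim1 b \<le> n" and t: "t > 0"
    and ind: "indep_matrix M {..<n} {..<n} A" and sg: "\<And>p. p \<in> {..<n} \<times> {..<n} \<Longrightarrow> sg_var M b (A p)"
    and law: "\<And>j. j < n \<Longrightarrow> \<exists>\<nu>. \<forall>i<n. distr M borel (A (i, j)) = \<nu>"
  shows "\<exists>W\<in>events. prob W \<le> big_C b * t + exp (- rate b / 2) ^ n \<and>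
    (\<forall>\<omega>\<in>space M. small_sv n t (\<lambda>p. A p \<omega>) \<longrightarrow> \<omega> \<in> W)"
proof -
  note [measurable] = sg_varD(1)[OF sg]
  note c = const_bounds[OF b]
  note c' = const_bounds'[OF b]
  note p = spread_bounds[OF b]
  have n0: "dim0 b \<le> n" using n c' by linarith
  have n2: "n \<ge> 2" using n0 c(14) by linarith
  have Lt: "0 \<le> 2 * L_const b / (del b * rho b) * t" using c t by auto
  show ?thesis
  proof (cases "t / sqrt n \<le> sqrt (spread b * n) / 24")
    \<comment> \<open>The level \<open>t / sqrt n\<close> exceeds the lower bound for compressible
      vectors. Then \<open>t\<close> is bounded below in terms of \<open>spread b\<close>, the
      right-hand side is at least 1, and \<open>W\<close> may be the whole space.\<close>
    case False
    have "sqrt (spread b) * n = sqrt (spread b * n) * sqrt n" using p by (simp add: real_sqrt_mult)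
    moreover have "sqrt (spread b * n) < 24 * (t / sqrt n)" using False by linarith
    then have "sqrt (spread b * n) * sqrt n < 24 * (t / sqrt n) * sqrt n"
      using n2 by (intro mult_strict_right_mono) auto
    ultimately have "sqrt (spread b) * n < 24 * t" using n2 by simp
    moreover have "sqrt (spread b) * 1 \<le> sqrt (spread b) * n" using p n2 by (intro mult_left_mono) auto
    ultimately have "sqrt (spread b) \<le> 24 * t" by linarith
    then have "1 \<le> 24 / sqrt (spread b) * t" using p by (simp add: field_simps)
    then have "1 \<le> big_C b * t" using Lt by (simp add: big_C_def algebra_simps)
    then have "1 \<le> big_C b * t + exp (- rate b / 2) ^ n" by (rule add_increasing2[rotated]) simp
    then show ?thesis by (intro bexI[of _ "space M"]) (auto simp: prob_space)
  next
    case True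
    \<comment> \<open>At a coordinate of size at least \<open>rho b / sqrt n\<close>, dividing the
      length \<open>t / sqrt n\<close> of the image by that coordinate gives a distance to the span
      below \<open>t / rho b\<close>.\<close>
    define s where "s = t / rho b"
    have s: "s > 0" using t c by (simp add: s_def)
    define q where "q = 2 * L_const b * s + F_const b * exp (- rate b * n)"
    let ?N = "\<lambda>j \<omega>. near_span n j s (\<lambda>p. A p \<omega>)"
    define W1 where "W1 = {\<omega> \<in> space M. bad_matrix {..<n} n b (\<lambda>p. A p \<omega>)}"
    define W2 where "W2 = {\<omega> \<in> space M. del b * n < card {j \<in> {..<n}. ?N j \<omega>}}"
    have W1: "W1 \<in> events" unfolding W1_def using n2 b by (intro bad_matrix_measurable) auto
    have Nm: "{\<omega> \<in> space M. ?N j \<omega>} \<in> events" for j by (intro near_span_measurable) auto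
    have Np: "prob {\<omega> \<in> space M. ?N j \<omega>} \<le> q" if "j \<in> {..<n}" for j
      unfolding q_def using that by (intro near_span_prob b n0 s ind sg law) auto
    have dn: "del b * n > 0" using c n2 by simp
    note W2 = markov_card[where P = ?N and J = "{..<n}" and q = q and k = "del b * n", OF finite_lessThan Nm Np dn, folded W2_def]
    have "prob (W1 \<union> W2) \<le> prob W1 + prob W2" using W1 W2(1) by (intro measure_Un_le)
    also have "prob W1 \<le> 2 * exp (- rate b * n)"
      unfolding W1_def using n2 by (intro bad_matrix_prob b ind sg) auto
    also have "prob W2 \<le> q / del b" using W2(2) n2 c by simp
    also have "2 * exp (- rate b * n) + q / del b = 2 * L_const b / (del b * rho b) * t + H_const b * exp (- rate b * n)"
      using c by (simp add: q_def s_def H_const_def field_simps)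
    also have "2 * L_const b / (del b * rho b) * t \<le> big_C b * t"
      using p t by (intro mult_right_mono) (auto simp: big_C_def)
    also have "H_const b * exp (- rate b * n) \<le> exp (- rate b / 2) ^ n"
    proof -
      have "2 * H_const b / rate b \<le> n" using n c(14) by (simp add: dim1_def)
      then have "H_const b \<le> rate b * n / 2" using c by (simp add: field_simps)
      also have "\<dots> \<le> exp (rate b * n / 2)" using exp_ge_add_one_self[of "rate b * n / 2"] by linarith
      finally have "H_const b * exp (- rate b * n) \<le> exp (rate b * n / 2) * exp (- rate b * n)" by (intro mult_right_mono) auto
      also have "\<dots> = exp (- rate b / 2) ^ n" by (simp add: mult_ac flip: exp_add exp_of_nat_mult)
      finally show ?thesis .
    qed
    finally have prob: "prob (W1 \<union> W2) \<le> big_C b * t + exp (- rate b / 2) ^ n" by simp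
    have "\<omega> \<in> W1 \<union> W2" if \<omega>: "\<omega> \<in> space M" and sv: "small_sv n t (\<lambda>p. A p \<omega>)" for \<omega>
    proof (rule ccontr)
      assume notin: "\<omega> \<notin> W1 \<union> W2"
      obtain x where x: "(\<Sum>i<n. (x i)\<^sup>2) = 1" "L2_set (mv {..<n} (\<lambda>p. A p \<omega>) x) {..<n} < t / sqrt n"
        using sv by (auto simp: small_sv_def)
      have gd: "\<not> op_bad {..<n} {..<n} n b (\<lambda>p. A p \<omega>)" "\<not> comp_bad {..<n} {..<n} (del b * n) (rho b) b (\<lambda>p. A p \<omega>)"
        using notin \<omega> by (auto simp: W1_def bad_matrix_def)
      have nc: "\<not> compressible {..<n} (del b * n) (rho b) x"
      proof
        assume comp: "compressible {..<n} (del b * n) (rho b) x"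
        have "sqrt (spread b * n) / 24 \<le> L2_set (mv {..<n} (\<lambda>p. A p \<omega>) x) {..<n}"
        proof (rule comp_good_bound[OF _ _ _ _ _ _ b _ _ _ gd x(1) comp])
          show "360 * b * rho b \<le> sqrt (spread b) / 48" using b by (simp add: rho_def K_const_def)
        qed (use n2 c in auto)
        then show False using x(2) True by linarith
      qed
      have "{j \<in> {..<n}. rho b / sqrt n \<le> \<bar>x j\<bar>} \<subseteq> {j \<in> {..<n}. ?N j \<omega>}"
      proof safe
        fix j assume j: "j < n" "rho b / sqrt n \<le> \<bar>x j\<bar>"
        have "t / sqrt n = s * (rho b / sqrt n)" using c by (simp add: s_def)
        also have "\<dots> \<le> s * \<bar>x j\<bar>" using s j by (intro mult_left_mono) auto
        finally show "near_span n j s (\<lambda>p. A p \<omega>)" using x(2) j by (intro near_spanI[where x = x]) auto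
      qed
      then have "card {j \<in> {..<n}. rho b / sqrt n \<le> \<bar>x j\<bar>} \<le> card {j \<in> {..<n}. ?N j \<omega>}"
        by (intro card_mono) auto
      moreover have "del b * n < card {j \<in> {..<n}. rho b / sqrt n \<le> \<bar>x j\<bar>}"
        using nc n2 c by (intro many_large_coordinates) auto
      ultimately show False using notin \<omega> by (simp add: W2_def)
    qed
    then show ?thesis using prob W1 W2(1) by (intro bexI[of _ "W1 \<union> W2"]) auto
  qed
qed

section \<open>Invertibility in small dimension\<close>

text \<open>At \<open>8 / spread b\<close> multiples of \<open>b\<close> the tail is at most a
  quarter of \<open>spread b\<close>. Truncating two independent copies therefore costs at most half
  of the probability that they differ by 1/2.\<close>

definition trunc_R :: "real \<Rightarrow> real" where "trunc_R b = 8 * b / spread b"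
text \<open>The remaining probability \<open>spread b / 2\<close>, divided by the number of pairs of
  cells of width \<tau> that cover the truncated square.\<close>

definition atom_prob :: "real \<Rightarrow> real \<Rightarrow> real" where
  "atom_prob b \<tau> = spread b / 2 / (2 * (\<lceil>trunc_R b / \<tau>\<rceil> + 1) + 1)\<^sup>2"

text \<open>Pigeonhole for two independent copies that differ by at least 1/2: some product of two
  cells carries an average share of the probability, and each factor carries at least that much.
  Points \<open>x\<close>, \<open>y\<close> in such a pair of cells differ by 1/2, so one of them
  has absolute value at least 1/4, and it is named \<open>x\<close>.\<close>

lemma sg_two_atoms:
  assumes \<nu>: "real_distribution \<nu>" and sg: "sg_var \<nu> b (\<lambda>x. x)" and b: "b \<ge> 1" and \<tau>: "\<tau> > 0"
  shows "\<exists>x y. 1/2 \<le> \<bar>x - y\<bar> \<and> 1/4 \<le> \<bar>x\<bar> \<and> \<bar>x\<bar> \<le> trunc_R b \<and> \<bar>y\<bar> \<le> trunc_R b \<and>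
    atom_prob b \<tau> \<le> measure \<nu> {z. \<bar>z - x\<bar> \<le> \<tau>} \<and> atom_prob b \<tau> \<le> measure \<nu> {z. \<bar>z - y\<bar> \<le> \<tau>}"
proof -
  interpret real_distribution \<nu> by fact
  interpret P: pair_prob_space \<nu> \<nu> ..
  let ?P = "\<nu> \<Otimes>\<^sub>M \<nu>"
  define p where "p = spread b"
  have p: "0 < p" "p \<le> 1" using spread_bounds[OF b] by (auto simp: p_def)
  define R where "R = trunc_R b"
  have R: "R > 0" "R / b = 8 / p" using b p by (auto simp: R_def trunc_R_def p_def)
  define D where "D = {q \<in> space ?P. 1/2 \<le> \<bar>fst q - snd q\<bar>}"
  have Dm[measurable]: "D \<in> sets ?P" unfolding D_def by measurable
  have PD: "p \<le> P.P.prob D" using sg_difference_spread[OF \<nu> sg] by (simp add: D_def p_def)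
  define T where "T = {z::real. R < \<bar>z\<bar>}"
  have Tm[measurable]: "T \<in> sets borel" unfolding T_def by measurable
  have PT: "prob T \<le> p / 4"
  proof -
    have "prob T \<le> 2 * exp (- R\<^sup>2 / b\<^sup>2)"
      using sg R unfolding sg_var_def subgaussian_bound_def T_def by simp
    also have "- R\<^sup>2 / b\<^sup>2 = - (8 / p)\<^sup>2" using R(2) by (metis minus_divide_left power_divide)
    also have "2 * exp (- (8 / p)\<^sup>2) \<le> 2 * (1 / (8 / p)\<^sup>2)"
    proof -
      have "(8 / p)\<^sup>2 \<le> exp ((8 / p)\<^sup>2)" using exp_ge_add_one_self[of "(8 / p)\<^sup>2"] by linarith
      then show ?thesis using p by (simp add: exp_minus field_simps)
    qed
    also have "\<dots> = p * p / 32" by (simp add: power_divide power2_eq_square)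
    also have "\<dots> \<le> p / 4" using mult_left_mono[OF p(2), of p] p by simp
    finally show ?thesis .
  qed
  define G where "G = {q \<in> space ?P. 1/2 \<le> \<bar>fst q - snd q\<bar> \<and> \<bar>fst q\<bar> \<le> R \<and> \<bar>snd q\<bar> \<le> R}"
  have Gm[measurable]: "G \<in> sets ?P" unfolding G_def by measurable
  have PG: "p / 2 \<le> P.P.prob G"
  proof -
    have T1: "P.P.prob (T \<times> space \<nu>) = prob T"
      using emeasure_pair_measure_Times[of T \<nu> "space \<nu>"] emeasure_space_1
      by (simp add: P.P.emeasure_eq_measure emeasure_eq_measure)
    have T2: "P.P.prob (space \<nu> \<times> T) = prob T"
      using emeasure_pair_measure_Times[of "space \<nu>" \<nu> T] emeasure_space_1
      by (simp add: P.P.emeasure_eq_measure emeasure_eq_measure)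
    have Ts: "T \<times> space \<nu> \<in> sets ?P" "space \<nu> \<times> T \<in> sets ?P" by auto
    have "P.P.prob D \<le> P.P.prob (G \<union> (T \<times> space \<nu> \<union> space \<nu> \<times> T))"
    proof (rule P.P.finite_measure_mono)
      show "D \<subseteq> G \<union> (T \<times> space \<nu> \<union> space \<nu> \<times> T)" by (auto simp: D_def G_def T_def space_pair_measure)
      show "G \<union> (T \<times> space \<nu> \<union> space \<nu> \<times> T) \<in> sets ?P" by (rule sets.Un[OF Gm sets.Un[OF Ts]])
    qed
    also have "\<dots> \<le> P.P.prob G + P.P.prob (T \<times> space \<nu> \<union> space \<nu> \<times> T)" by (intro measure_Un_le Gm sets.Un Ts)
    also have "P.P.prob (T \<times> space \<nu> \<union> space \<nu> \<times> T) \<le> prob T + prob T"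
      using measure_Un_le[OF Ts] T1 T2 by simp
    finally show ?thesis using PD PT by simp
  qed
  define m where "m = \<lceil>R / \<tau>\<rceil> + 1"
  have "0 < R / \<tau>" using R \<tau> by simp
  then have m: "m \<ge> 1" unfolding m_def by linarith
  define cell where "cell k = {z::real. \<lfloor>z / \<tau>\<rfloor> = k}" for k
  have cellm[measurable]: "cell k \<in> sets borel" for k unfolding cell_def by measurable
  have cm: "cell k \<times> cell l \<in> sets ?P" for k l by auto
  have gc: "G \<inter> (cell k \<times> cell l) \<in> sets ?P" for k l by (rule sets.Int[OF Gm cm])
  have cover: "G \<subseteq> (\<Union>kl\<in>{-m..m} \<times> {-m..m}. G \<inter> (cell (fst kl) \<times> cell (snd kl)))"
  proof
    fix q assume q: "q \<in> G"
    have "\<lfloor>z / \<tau>\<rfloor> \<in> {-m..m}" if "\<bar>z\<bar> \<le> R" for z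
    proof -
      have "z / \<tau> \<le> R / \<tau>" "- (R / \<tau>) \<le> z / \<tau>" using that \<tau> by (auto simp: field_simps abs_le_iff)
      then show ?thesis unfolding m_def by (auto; linarith)
    qed
    then have "(\<lfloor>fst q / \<tau>\<rfloor>, \<lfloor>snd q / \<tau>\<rfloor>) \<in> {-m..m} \<times> {-m..m}" using q by (auto simp: G_def)
    then show "q \<in> (\<Union>kl\<in>{-m..m} \<times> {-m..m}. G \<inter> (cell (fst kl) \<times> cell (snd kl)))"
      using q by (intro UN_I[of "(\<lfloor>fst q / \<tau>\<rfloor>, \<lfloor>snd q / \<tau>\<rfloor>)"]) (auto simp: cell_def mem_Times_iff)
  qed
  define N where "N = (2 * m + 1)\<^sup>2"
  have cardN: "real (card ({-m..m} \<times> {-m..m})) = real_of_int N"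
    using m by (simp add: card_cartesian_product N_def power2_eq_square)
  have N0: "real_of_int N > 0" using m by (simp add: N_def)
  have "\<exists>kl\<in>{-m..m} \<times> {-m..m}. p / 2 / N \<le> P.P.prob (G \<inter> (cell (fst kl) \<times> cell (snd kl)))"
  proof (rule ccontr)
    assume "\<not> ?thesis"
    then have less: "P.P.prob (G \<inter> (cell (fst kl) \<times> cell (snd kl))) < p / 2 / N" if "kl \<in> {-m..m} \<times> {-m..m}" for kl
      using that by (auto simp: not_le)
    have "P.P.prob G \<le> P.P.prob (\<Union>kl\<in>{-m..m} \<times> {-m..m}. G \<inter> (cell (fst kl) \<times> cell (snd kl)))"
      by (intro P.P.finite_measure_mono cover sets.finite_UN gc) auto
    also have "\<dots> \<le> (\<Sum>kl\<in>{-m..m} \<times> {-m..m}. P.P.prob (G \<inter> (cell (fst kl) \<times> cell (snd kl))))"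
      using gc by (intro P.P.finite_measure_subadditive_finite image_subsetI) auto
    also have "\<dots> < (\<Sum>kl\<in>{-m..m} \<times> {-m..m}. p / 2 / N)"
      using m by (intro sum_strict_mono less) auto
    also have "\<dots> = p / 2" unfolding sum_constant cardN using N0 by simp
    finally show False using PG by simp
  qed
  then obtain k l where kl: "p / 2 / N \<le> P.P.prob (G \<inter> (cell k \<times> cell l))" by auto
  have q0: "p / 2 / N > 0" using p N0 by simp
  then have "G \<inter> (cell k \<times> cell l) \<noteq> {}" using kl by (metis measure_empty not_le)
  then obtain x y where xy: "(x, y) \<in> G" "x \<in> cell k" "y \<in> cell l" by auto
  have "P.P.prob (G \<inter> (cell k \<times> cell l)) \<le> P.P.prob (cell k \<times> cell l)"
    by (intro P.P.finite_measure_mono cm) auto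
  also have "\<dots> = prob (cell k) * prob (cell l)"
    using emeasure_pair_measure_Times[of "cell k" \<nu> "cell l"]
    by (simp add: P.P.emeasure_eq_measure emeasure_eq_measure flip: ennreal_mult)
  finally have kl2: "p / 2 / N \<le> prob (cell k) * prob (cell l)" using kl by linarith
  have "prob (cell k) * prob (cell l) \<le> prob (cell k) * 1" "prob (cell k) * prob (cell l) \<le> 1 * prob (cell l)"
    by (intro mult_left_mono mult_right_mono; simp)+
  then have cells: "p / 2 / N \<le> prob (cell k)" "p / 2 / N \<le> prob (cell l)" using kl2 by linarith+
  have near: "prob (cell k) \<le> prob {z. \<bar>z - x\<bar> \<le> \<tau>}" if "x \<in> cell k" for x k
  proof (intro finite_measure_mono)
    show "cell k \<subseteq> {z. \<bar>z - x\<bar> \<le> \<tau>}"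
    proof
      fix z assume "z \<in> cell k"
      then have "\<lfloor>z / \<tau>\<rfloor> = \<lfloor>x / \<tau>\<rfloor>" using that by (simp add: cell_def)
      then have "\<bar>z / \<tau> - x / \<tau>\<bar> \<le> 1" by linarith
      then have "\<bar>(z - x) / \<tau>\<bar> \<le> 1" by (simp add: diff_divide_distrib)
      then show "z \<in> {z. \<bar>z - x\<bar> \<le> \<tau>}" using \<tau> by (simp add: abs_divide)
    qed
  qed (simp, measurable)
  have ap: "atom_prob b \<tau> = p / 2 / N"
    by (simp add: atom_prob_def p_def N_def m_def R_def)
  have props: "1/2 \<le> \<bar>x - y\<bar>" "\<bar>x\<bar> \<le> R" "\<bar>y\<bar> \<le> R" using xy by (auto simp: G_def)
  have ax: "atom_prob b \<tau> \<le> prob {z. \<bar>z - x\<bar> \<le> \<tau>}" "atom_prob b \<tau> \<le> prob {z. \<bar>z - y\<bar> \<le> \<tau>}"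
    using cells near[OF xy(2)] near[OF xy(3)] ap by linarith+
  show ?thesis
  proof (cases "1/4 \<le> \<bar>x\<bar>")
    case True
    then show ?thesis using props ax unfolding R_def by blast
  next
    case False
    then have "1/4 \<le> \<bar>y\<bar>" using props(1) by linarith
    then show ?thesis using props ax unfolding R_def by (intro exI[of _ y] exI[of _ x]) (auto simp: abs_minus_commute)
  qed
qed

definition stair :: "(nat \<Rightarrow> real) \<Rightarrow> (nat \<Rightarrow> real) \<Rightarrow> nat \<times> nat \<Rightarrow> real" where
  "stair x y p = (if fst p \<le> snd p then x (snd p) else y (snd p))"

text \<open>Consecutive rows of \<open>stair\<close> differ in a single entry, which makes the matrix explicitly invertible.\<close>

lemma stair_lower_bound:
  assumes n: "n \<ge> 1" and R: "R \<ge> 0"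
    and xy: "\<And>j. j < n \<Longrightarrow> 1/2 \<le> \<bar>x j - y j\<bar>" "\<And>j. j < n \<Longrightarrow> 1/4 \<le> \<bar>x j\<bar>" "\<And>j. j < n \<Longrightarrow> \<bar>y j\<bar> \<le> R"
  shows "L2_set v {..<n} \<le> 4 * n * (1 + 4 * n * R) * L2_set (mv {..<n} (stair x y) v) {..<n}"
proof -
  define r where "r = mv {..<n} (stair x y) v"
  define \<rho> where "\<rho> = L2_set r {..<n}"
  have \<rho>0: "\<rho> \<ge> 0" by (simp add: \<rho>_def L2_set_nonneg)
  have r: "\<bar>r i\<bar> \<le> \<rho>" if "i < n" for i
    using member_le_L2_set[of "{..<n}" i "\<lambda>i. \<bar>r i\<bar>"] that by (simp add: \<rho>_def L2_set_def)
  have low: "\<bar>v i\<bar> \<le> 4 * \<rho>" if i: "Suc i < n" for i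
  proof -
    have "r i - r (Suc i) = (\<Sum>j<n. v j * (stair x y (i, j) - stair x y (Suc i, j)))"
      by (simp add: r_def mv_def sum_subtractf right_diff_distrib)
    also have "\<dots> = (\<Sum>j\<in>{i}. v j * (stair x y (i, j) - stair x y (Suc i, j)))"
      using i by (intro sum.mono_neutral_right) (auto simp: stair_def)
    finally have e: "r i - r (Suc i) = v i * (x i - y i)" by (simp add: stair_def)
    have "\<bar>v i\<bar> * (1/2) \<le> \<bar>v i\<bar> * \<bar>x i - y i\<bar>" using xy(1)[of i] i by (intro mult_left_mono) auto
    also have "\<dots> = \<bar>r i - r (Suc i)\<bar>" by (simp add: e abs_mult)
    also have "\<dots> \<le> 2 * \<rho>" using r[of i] r[of "Suc i"] i by linarith
    finally show ?thesis by simp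
  qed
  define l where "l = n - 1"
  have l: "l < n" "Suc l = n" using n by (auto simp: l_def)
  \<comment> \<open>The last row has no successor to be compared with. Its equation is solved for
    the last coordinate, which is where the lower bound on the diagonal entry enters.\<close>
  have last: "\<bar>v l\<bar> \<le> 4 * (1 + 4 * n * R) * \<rho>"
  proof -
    have "r l = (\<Sum>j<n. v j * stair x y (l, j))" by (simp add: r_def mv_def)
    also have "\<dots> = (\<Sum>j<l. v j * stair x y (l, j)) + v l * stair x y (l, l)"
      unfolding l(2)[symmetric] by simp
    also have "(\<Sum>j<l. v j * stair x y (l, j)) = (\<Sum>j<l. v j * y j)" by (intro sum.cong) (auto simp: stair_def)
    finally have e: "v l * x l = r l - (\<Sum>j<l. v j * y j)" by (simp add: stair_def)
    have "\<bar>\<Sum>j<l. v j * y j\<bar> \<le> (\<Sum>j<l. \<bar>v j * y j\<bar>)" by (rule sum_abs)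
    also have "\<dots> \<le> (\<Sum>j<l. 4 * \<rho> * R)"
    proof (intro sum_mono)
      fix j assume "j \<in> {..<l}"
      then show "\<bar>v j * y j\<bar> \<le> 4 * \<rho> * R"
        unfolding abs_mult using low[of j] xy(3)[of j] l \<rho>0 by (intro mult_mono) auto
    qed
    also have "\<dots> \<le> n * (4 * \<rho> * R)" using l \<rho>0 R by (simp add: mult_right_mono)
    finally have s: "\<bar>\<Sum>j<l. v j * y j\<bar> \<le> n * (4 * \<rho> * R)" .
    have "\<bar>v l\<bar> * (1/4) \<le> \<bar>v l\<bar> * \<bar>x l\<bar>" using xy(2)[OF l(1)] by (intro mult_left_mono) auto
    also have "\<dots> = \<bar>r l - (\<Sum>j<l. v j * y j)\<bar>" by (simp flip: e add: abs_mult)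
    also have "\<dots> \<le> \<rho> + n * (4 * \<rho> * R)" using s r[OF l(1)] by linarith
    finally show ?thesis by (simp add: algebra_simps)
  qed
  have "4 * 1 * \<rho> \<le> 4 * (1 + 4 * n * R) * \<rho>" using \<rho>0 R by (intro mult_right_mono mult_left_mono) auto
  then have all: "\<bar>v i\<bar> \<le> 4 * (1 + 4 * n * R) * \<rho>" if "i < n" for i
    using low[of i] last that l by (cases "i = l") auto
  have "L2_set v {..<n} \<le> (\<Sum>i<n. \<bar>v i\<bar>)" by (rule L2_set_le_sum_abs)
  also have "\<dots> \<le> (\<Sum>i<n. 4 * (1 + 4 * n * R) * \<rho>)" by (intro sum_mono all) auto
  also have "\<dots> = 4 * n * (1 + 4 * n * R) * \<rho>" by simp
  finally show ?thesis by (simp add: \<rho>_def r_def)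
qed

lemma mv_entry_bound:
  assumes d: "\<And>p. p \<in> {..<n} \<times> {..<n} \<Longrightarrow> \<bar>g p\<bar> \<le> \<tau>" and \<tau>: "\<tau> \<ge> 0"
  shows "L2_set (mv {..<n} g v) {..<n} \<le> n * \<tau> * L2_set v {..<n}"
proof -
  have row: "\<bar>mv {..<n} g v i\<bar> \<le> \<tau> * sqrt n * L2_set v {..<n}" if "i < n" for i
  proof -
    have "\<bar>mv {..<n} g v i\<bar> \<le> (\<Sum>j<n. \<bar>v j\<bar> * \<bar>g (i, j)\<bar>)" unfolding mv_def by (rule order_trans[OF sum_abs]) (simp add: abs_mult)
    also have "\<dots> \<le> (\<Sum>j<n. \<bar>v j\<bar> * \<bar>\<tau>\<bar>)" using d that \<tau> by (intro sum_mono mult_left_mono) auto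
    also have "\<dots> \<le> L2_set v {..<n} * L2_set (\<lambda>_. \<tau>) {..<n}" by (rule L2_set_mult_ineq)
    also have "L2_set (\<lambda>_. \<tau>) {..<n} = sqrt n * \<tau>" using \<tau> by (simp add: L2_set_def real_sqrt_mult)
    finally show ?thesis by (simp add: mult_ac)
  qed
  have "L2_set (mv {..<n} g v) {..<n} = L2_set (\<lambda>i. \<bar>mv {..<n} g v i\<bar>) {..<n}" by (simp add: L2_set_def)
  also have "\<dots> \<le> L2_set (\<lambda>i. \<tau> * sqrt n * L2_set v {..<n}) {..<n}" by (intro L2_set_mono row) auto
  also have "\<dots> = sqrt n * (\<tau> * sqrt n * L2_set v {..<n})"
    using \<tau> L2_set_nonneg[of v "{..<n}"] by (simp add: L2_set_def[of "\<lambda>_. _ * _"] real_sqrt_mult abs_mult)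
  also have "\<dots> = n * \<tau> * L2_set v {..<n}" by simp
  finally show ?thesis .
qed

definition kappa :: "nat \<Rightarrow> real \<Rightarrow> real" where "kappa N b = 1 / (4 * N * (1 + 4 * N * trunc_R b))"
text \<open>Perturbing each entry by at most this much changes the image of a unit vector by at most
  \<open>kappa N b / 2\<close> in every dimension up to \<open>N\<close>.\<close>

definition tol :: "nat \<Rightarrow> real \<Rightarrow> real" where "tol N b = kappa N b / (2 * N)"

text \<open>Each column has its own law and hence its own pair of values from
  \<open>sg_two_atoms\<close>, valid for all its entries. By independence every entry is close to
  the corresponding entry of \<open>stair\<close> with probability at least
  \<open>Q ^ (n * n)\<close>. The exponent \<open>N * N\<close> makes the bound uniform over the
  dimensions up to \<open>N\<close>.\<close>

lemma (in prob_space) small_sv_small_dim: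
  assumes b: "b \<ge> 1" and n: "1 \<le> n" "n \<le> N" and t: "t \<le> kappa N b / 2"
    and ind: "indep_matrix M {..<n} {..<n} A" and sg: "\<And>p. p \<in> {..<n} \<times> {..<n} \<Longrightarrow> sg_var M b (A p)"
    and law: "\<And>j. j < n \<Longrightarrow> \<exists>\<nu>. \<forall>i<n. distr M borel (A (i, j)) = \<nu>"
  shows "\<exists>W\<in>events. prob W \<le> 1 - atom_prob b (tol N b) ^ (N * N) \<and>
    (\<forall>\<omega>\<in>space M. small_sv n t (\<lambda>p. A p \<omega>) \<longrightarrow> \<omega> \<in> W)"
proof -
  have Am: "A p \<in> borel_measurable M" if "p \<in> {..<n} \<times> {..<n}" for p using sg_varD(1)[OF sg[OF that]] .
  define R where "R = trunc_R b"
  have R: "R \<ge> 0" using b spread_bounds[OF b] by (simp add: R_def trunc_R_def)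
  define K where "K = kappa N b"
  have K: "K > 0" using n R by (simp add: K_def kappa_def R_def[symmetric] add_pos_nonneg)
  define \<tau> where "\<tau> = tol N b"
  have \<tau>: "\<tau> > 0" using K n by (simp add: \<tau>_def tol_def K_def)
  define Q where "Q = atom_prob b \<tau>"
  have "\<forall>j\<in>{..<n}. \<exists>xy. 1/2 \<le> \<bar>fst xy - snd xy\<bar> \<and> 1/4 \<le> \<bar>fst xy\<bar> \<and> \<bar>snd xy\<bar> \<le> R \<and>
    (\<forall>i<n. Q \<le> prob {\<omega> \<in> space M. \<bar>A (i, j) \<omega> - fst xy\<bar> \<le> \<tau>} \<and> Q \<le> prob {\<omega> \<in> space M. \<bar>A (i, j) \<omega> - snd xy\<bar> \<le> \<tau>})"
  proof
    fix j assume j: "j \<in> {..<n}"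
    then obtain \<nu> where \<nu>: "\<And>i. i < n \<Longrightarrow> distr M borel (A (i, j)) = \<nu>" using law by auto
    have m0: "A (0, j) \<in> borel_measurable M" using j by (intro Am) auto
    have rd: "real_distribution \<nu>" using \<nu>[of 0] n real_distribution_distr[OF m0] by simp
    have sg\<nu>: "sg_var \<nu> b (\<lambda>x. x)" using \<nu>[of 0] n sg[of "(0, j)"] j sg_var_distr[OF m0, of b] by auto
    obtain x y where xy: "1/2 \<le> \<bar>x - y\<bar>" "1/4 \<le> \<bar>x\<bar>" "\<bar>y\<bar> \<le> R"
      "Q \<le> measure \<nu> {z. \<bar>z - x\<bar> \<le> \<tau>}" "Q \<le> measure \<nu> {z. \<bar>z - y\<bar> \<le> \<tau>}"
      using sg_two_atoms[OF rd sg\<nu> b \<tau>] unfolding Q_def R_def by blast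
    have "measure \<nu> {z. \<bar>z - w\<bar> \<le> \<tau>} = prob {\<omega> \<in> space M. \<bar>A (i, j) \<omega> - w\<bar> \<le> \<tau>}" if "i < n" for i w
      unfolding \<nu>[OF that, symmetric] using that j
      by (subst measure_distr) (auto intro!: Am arg_cong[where f = prob])
    then show "\<exists>xy. 1/2 \<le> \<bar>fst xy - snd xy\<bar> \<and> 1/4 \<le> \<bar>fst xy\<bar> \<and> \<bar>snd xy\<bar> \<le> R \<and>
      (\<forall>i<n. Q \<le> prob {\<omega> \<in> space M. \<bar>A (i, j) \<omega> - fst xy\<bar> \<le> \<tau>} \<and> Q \<le> prob {\<omega> \<in> space M. \<bar>A (i, j) \<omega> - snd xy\<bar> \<le> \<tau>})"
      using xy by (intro exI[of _ "(x, y)"]) auto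
  qed
  then obtain xy where xy: "\<And>j. j < n \<Longrightarrow> 1/2 \<le> \<bar>fst (xy j) - snd (xy j)\<bar> \<and> 1/4 \<le> \<bar>fst (xy j)\<bar> \<and> \<bar>snd (xy j)\<bar> \<le> R \<and>
    (\<forall>i<n. Q \<le> prob {\<omega> \<in> space M. \<bar>A (i, j) \<omega> - fst (xy j)\<bar> \<le> \<tau>} \<and> Q \<le> prob {\<omega> \<in> space M. \<bar>A (i, j) \<omega> - snd (xy j)\<bar> \<le> \<tau>})"
    unfolding bchoice_iff by auto
  define T where "T = stair (\<lambda>j. fst (xy j)) (\<lambda>j. snd (xy j))"
  define V where "V p = {\<omega> \<in> space M. \<bar>A p \<omega> - T p\<bar> \<le> \<tau>}" for p
  have VQ: "Q \<le> prob (V p)" if "p \<in> {..<n} \<times> {..<n}" for p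
    using xy[of "snd p"] that by (cases p) (auto simp: V_def T_def stair_def)
  have Q0: "0 \<le> Q" "Q \<le> 1"
  proof -
    show "0 \<le> Q" using spread_bounds[OF b] by (simp add: Q_def atom_prob_def)
    have "Q \<le> prob (V (0, 0))" using n by (intro VQ) auto
    then show "Q \<le> 1" using prob_le_1 order_trans by blast
  qed
  let ?IJ = "{..<n} \<times> {..<n}"
  have Vm: "V p \<in> events" if "p \<in> ?IJ" for p unfolding V_def using Am[OF that] by measurable
  define E where "E = (\<Inter>p\<in>?IJ. V p)"
  have "(0, 0) \<in> ?IJ" using n by auto
  then have ne: "?IJ \<noteq> {}" by blast
  have E: "E \<in> events" unfolding E_def using ne Vm by (intro sets.finite_INT) auto
  have "Q ^ (N * N) \<le> Q ^ (n * n)" using Q0 n by (intro power_decreasing mult_le_mono) auto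
  also have "\<dots> = (\<Prod>p\<in>?IJ. Q)" by (simp add: card_cartesian_product)
  also have "\<dots> \<le> (\<Prod>p\<in>?IJ. prob (V p))" using Q0 VQ by (intro prod_mono) auto
  also have "\<dots> = prob E"
  proof -
    have Veq: "V p = A p -` {z. \<bar>z - T p\<bar> \<le> \<tau>} \<inter> space M" for p by (auto simp: V_def)
    show ?thesis unfolding E_def Veq using ne
      by (intro indep_varsD_finite[OF ind, symmetric]) auto
  qed
  finally have PE: "Q ^ (N * N) \<le> prob E" .
  have "\<omega> \<in> space M - E" if \<omega>: "\<omega> \<in> space M" and sv: "small_sv n t (\<lambda>p. A p \<omega>)" for \<omega>
  proof (rule ccontr)
    assume "\<omega> \<notin> space M - E"
    then have "\<omega> \<in> E" using \<omega> by simp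
    then have close: "\<bar>A p \<omega> - T p\<bar> \<le> \<tau>" if "p \<in> ?IJ" for p using that by (auto simp: E_def V_def)
    obtain x where x: "(\<Sum>i<n. (x i)\<^sup>2) = 1" "L2_set (mv {..<n} (\<lambda>p. A p \<omega>) x) {..<n} < t / sqrt n"
      using sv by (auto simp: small_sv_def)
    have x1: "L2_set x {..<n} = 1" using x(1) by (simp add: L2_set_def)
    have "1 \<le> 4 * n * (1 + 4 * n * R) * L2_set (mv {..<n} T x) {..<n}"
      using stair_lower_bound[OF n(1) R, of "\<lambda>j. fst (xy j)" "\<lambda>j. snd (xy j)" x] xy x1 by (simp add: T_def)
    also have "\<dots> \<le> 4 * N * (1 + 4 * N * R) * L2_set (mv {..<n} T x) {..<n}"
      using n R by (intro mult_right_mono mult_mono add_mono L2_set_nonneg) auto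
    finally have KT: "K \<le> L2_set (mv {..<n} T x) {..<n}"
      using n R by (simp add: K_def kappa_def R_def[symmetric] field_simps add_pos_nonneg)
    have "L2_set (mv {..<n} (\<lambda>p. T p - A p \<omega>) x) {..<n} \<le> n * \<tau> * 1"
      using mv_entry_bound[of n "\<lambda>p. T p - A p \<omega>" \<tau> x] close \<tau> x1 by (simp add: abs_minus_commute)
    also have "\<dots> \<le> N * \<tau>" using n \<tau> by simp
    also have "\<dots> = K / 2" using n by (simp add: \<tau>_def tol_def K_def)
    finally have err: "L2_set (mv {..<n} (\<lambda>p. T p - A p \<omega>) x) {..<n} \<le> K / 2" .
    have "mv {..<n} T x = (\<lambda>i. mv {..<n} (\<lambda>p. A p \<omega>) x i + mv {..<n} (\<lambda>p. T p - A p \<omega>) x i)"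
      by (auto simp: mv_def sum.distrib[symmetric] algebra_simps)
    then have "L2_set (mv {..<n} T x) {..<n} \<le> L2_set (mv {..<n} (\<lambda>p. A p \<omega>) x) {..<n} + L2_set (mv {..<n} (\<lambda>p. T p - A p \<omega>) x) {..<n}"
      by (metis L2_set_triangle_ineq)
    then have "K / 2 \<le> L2_set (mv {..<n} (\<lambda>p. A p \<omega>) x) {..<n}" using KT err by linarith
    also have "\<dots> < t / sqrt n" by (rule x(2))
    also have "\<dots> \<le> (K / 2) / sqrt n" using t by (intro divide_right_mono) (auto simp: K_def)
    also have "\<dots> \<le> (K / 2) / 1" using K n by (intro divide_left_mono) auto
    finally show False by simp
  qed
  moreover have "prob (space M - E) \<le> 1 - Q ^ (N * N)" using PE E by (simp add: prob_compl)
  ultimately show ?thesis using E unfolding Q_def \<tau>_def by (intro bexI[of _ "space M - E"]) auto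
qed

section \<open>The constants\<close>

definition cut_dim :: "real \<Rightarrow> nat" where "cut_dim b = nat \<lceil>dim1 b\<rceil>"
text \<open>The second summand makes the claim trivial in small dimensions as soon as
  \<open>t\<close> exceeds \<open>kappa (cut_dim b) b / 2\<close>.\<close>

definition lead_C :: "real \<Rightarrow> real" where "lead_C b = big_C b + 2 / kappa (cut_dim b) b"
definition small_Q :: "real \<Rightarrow> real" where
  "small_Q b = atom_prob b (tol (cut_dim b) b) ^ (cut_dim b * cut_dim b)"
definition decay :: "real \<Rightarrow> real" where "decay b = exp (- rate b / 2)"
text \<open>In dimensions up to \<open>cut_dim b\<close> only the fixed probability
  \<open>small_Q b\<close> of invertibility is available. By Bernoulli's inequality, the power
  \<open>n\<close> of this base is still at least \<open>1 - small_Q b\<close> there.\<close>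

definition small_decay :: "real \<Rightarrow> real" where "small_decay b = max (decay b) (1 - small_Q b / cut_dim b)"

lemma final_const_bounds:
  assumes b: "b \<ge> 1"
  shows "cut_dim b \<ge> 2" "kappa (cut_dim b) b > 0" "lead_C b > 0" "0 < small_Q b" "small_Q b \<le> 1"
    "0 < decay b" "decay b < 1" "0 < small_decay b" "small_decay b < 1"
proof -
  note c = const_bounds[OF b] const_bounds'[OF b] spread_bounds[OF b]
  have d: "dim1 b \<ge> 2" using c by linarith
  then show N: "cut_dim b \<ge> 2" unfolding cut_dim_def by linarith
  have R: "trunc_R b > 0" using b c by (simp add: trunc_R_def)
  then have pos: "4 * real (cut_dim b) * (1 + 4 * real (cut_dim b) * trunc_R b) > 0"
    using N by (intro mult_pos_pos add_pos_nonneg) auto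
  then show k: "kappa (cut_dim b) b > 0" by (simp add: kappa_def)
  then show "lead_C b > 0" using c by (simp add: lead_C_def add_pos_pos)
  have \<tau>: "tol (cut_dim b) b > 0" using k N by (simp add: tol_def)
  define m where "m = \<lceil>trunc_R b / tol (cut_dim b) b\<rceil>"
  have "0 < trunc_R b / tol (cut_dim b) b" using R \<tau> by simp
  then have m: "m \<ge> 1" unfolding m_def by linarith
  have ap: "atom_prob b (tol (cut_dim b) b) = spread b / 2 / (2 * (m + 1) + 1)\<^sup>2" by (simp add: atom_prob_def m_def)
  have m1: "1 \<le> (real_of_int (2 * (m + 1) + 1))\<^sup>2" using m by (intro one_le_power) simp
  have ap0: "atom_prob b (tol (cut_dim b) b) > 0" unfolding ap using c m by simp
  have "spread b / 2 / (real_of_int (2 * (m + 1) + 1))\<^sup>2 \<le> 1 / 1" using c m1 by (intro frac_le) auto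
  then have ap1: "atom_prob b (tol (cut_dim b) b) \<le> 1" unfolding ap by simp
  show Q: "0 < small_Q b" "small_Q b \<le> 1" unfolding small_Q_def using ap0 ap1 by (auto intro: power_le_one)
  show "0 < decay b" "decay b < 1" using c by (auto simp: decay_def)
  then show "0 < small_decay b" "small_decay b < 1" using Q N by (auto simp: small_decay_def)
qed

lemma (in prob_space) small_sv_bound:
  assumes b: "b \<ge> 1" and n: "n \<ge> 1" and t: "t > 0"
    and ind: "indep_matrix M {..<n} {..<n} A" and sg: "\<And>p. p \<in> {..<n} \<times> {..<n} \<Longrightarrow> sg_var M b (A p)"
    and law: "\<And>j. j < n \<Longrightarrow> \<exists>\<nu>. \<forall>i<n. distr M borel (A (i, j)) = \<nu>"
  shows "\<exists>W\<in>events. prob W \<le> lead_C b * t + small_decay b ^ n \<and>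
    (dim1 b \<le> n \<longrightarrow> prob W \<le> lead_C b * t + decay b ^ n) \<and>
    (\<forall>\<omega>\<in>space M. small_sv n t (\<lambda>p. A p \<omega>) \<longrightarrow> \<omega> \<in> W)"
proof -
  note f = final_const_bounds[OF b]
  note c = const_bounds[OF b] const_bounds'[OF b]
  show ?thesis
  proof (cases "dim1 b \<le> n")
    case True
    obtain W where W: "W \<in> events" "prob W \<le> big_C b * t + exp (- rate b / 2) ^ n"
      "\<And>\<omega>. \<omega> \<in> space M \<Longrightarrow> small_sv n t (\<lambda>p. A p \<omega>) \<Longrightarrow> \<omega> \<in> W"
      using small_sv_large_dim[OF b True t ind sg law] by blast
    have "big_C b * t \<le> lead_C b * t" using f t by (intro mult_right_mono) (auto simp: lead_C_def)
    then have 1: "prob W \<le> lead_C b * t + decay b ^ n" using W(2) by (simp add: decay_def)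
    have "decay b ^ n \<le> small_decay b ^ n" using f by (intro power_mono) (auto simp: small_decay_def)
    then show ?thesis using 1 W by (intro bexI[of _ W]) auto
  next
    case False
    then have nN: "n \<le> cut_dim b" unfolding cut_dim_def by linarith
    show ?thesis
    proof (cases "t \<le> kappa (cut_dim b) b / 2")
      case True
      obtain W where W: "W \<in> events" "prob W \<le> 1 - small_Q b"
        "\<And>\<omega>. \<omega> \<in> space M \<Longrightarrow> small_sv n t (\<lambda>p. A p \<omega>) \<Longrightarrow> \<omega> \<in> W"
        using small_sv_small_dim[OF b n nN True ind sg law] unfolding small_Q_def by blast
      have "real n * (small_Q b / cut_dim b) \<le> cut_dim b * (small_Q b / cut_dim b)"
        using nN f by (intro mult_right_mono) auto
      also have "\<dots> = small_Q b" using f(1) by simp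
      finally have "1 - small_Q b \<le> 1 + real n * (- small_Q b / cut_dim b)" by simp
      also have "\<dots> \<le> (1 + - small_Q b / cut_dim b) ^ n"
      proof (rule Bernoulli_inequality)
        have "small_Q b / cut_dim b \<le> 1" using f(1,5) by simp
        then show "- 1 \<le> - small_Q b / cut_dim b" by simp
      qed
      also have "\<dots> \<le> small_decay b ^ n"
      proof (rule power_mono)
        have "small_Q b / cut_dim b \<le> 1" using f(1,5) by simp
        then show "0 \<le> 1 + - small_Q b / cut_dim b" by simp
      qed (simp add: small_decay_def)
      finally have "prob W \<le> small_decay b ^ n" using W(2) by linarith
      moreover have "0 \<le> lead_C b * t" using f t by simp
      ultimately have "prob W \<le> lead_C b * t + small_decay b ^ n" by linarith
      then show ?thesis using W False by (intro bexI[of _ W]) auto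
    next
      case F: False
      have "1 \<le> 2 / kappa (cut_dim b) b * t" using F f by (simp add: field_simps)
      also have "\<dots> \<le> lead_C b * t" using t c by (intro mult_right_mono) (auto simp: lead_C_def)
      finally have "1 \<le> lead_C b * t + small_decay b ^ n" using f by (intro add_increasing2) auto
      then show ?thesis using False by (intro bexI[of _ "space M"]) (auto simp: prob_space)
    qed
  qed
qed

section \<open>Polynomial growth of the constants\<close>

lemma polynomially_bounded_mono:
  "polynomially_bounded g \<Longrightarrow> (\<And>B. B > 0 \<Longrightarrow> f B \<le> g B) \<Longrightarrow> polynomially_bounded f"
  unfolding polynomially_bounded_def by (meson order_trans)

lemma polynomially_bounded_const: "polynomially_bounded (\<lambda>_. c)"
  unfolding polynomially_bounded_def by (intro exI[of _ "[:c:]"]) simp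

lemma polynomially_bounded_succ: "polynomially_bounded (\<lambda>B. B + 1)"
  unfolding polynomially_bounded_def by (intro exI[of _ "[:1, 1:]"]) simp

lemma polynomially_bounded_add:
  assumes "polynomially_bounded f" "polynomially_bounded g"
  shows "polynomially_bounded (\<lambda>B. f B + g B)"
proof -
  obtain p q where "\<forall>B>0. f B \<le> poly p B" "\<forall>B>0. g B \<le> poly q B"
    using assms by (auto simp: polynomially_bounded_def)
  then show ?thesis unfolding polynomially_bounded_def by (intro exI[of _ "p + q"]) (auto intro: add_mono)
qed

lemma polynomially_bounded_mult:
  assumes "polynomially_bounded f" "polynomially_bounded g" "\<And>B. B > 0 \<Longrightarrow> 0 \<le> f B" "\<And>B. B > 0 \<Longrightarrow> 0 \<le> g B"
  shows "polynomially_bounded (\<lambda>B. f B * g B)"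
proof -
  obtain p q where "\<forall>B>0. f B \<le> poly p B" "\<forall>B>0. g B \<le> poly q B"
    using assms by (auto simp: polynomially_bounded_def)
  then show ?thesis unfolding polynomially_bounded_def using assms(3,4)
    by (intro exI[of _ "p * q"]) (auto intro!: mult_mono intro: order_trans)
qed

lemma polynomially_bounded_power:
  assumes "polynomially_bounded f" "\<And>B. B > 0 \<Longrightarrow> 0 \<le> f B"
  shows "polynomially_bounded (\<lambda>B. f B ^ k)"
proof (induction k)
  case 0
  show ?case using polynomially_bounded_const[of 1] by simp
next
  case (Suc k)
  then show ?case using polynomially_bounded_mult[OF assms(1) Suc] assms(2) by simp
qed

lemmas pb_intros = polynomially_bounded_const polynomially_bounded_succ polynomially_bounded_add
  polynomially_bounded_mult polynomially_bounded_power

text \<open>The constants are followed in the order of their definitions; for those that tend to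
  zero it is the reciprocal that is bounded. The exponent \<open>cut_dim b * cut_dim b\<close> in
  \<open>small_Q\<close> is the reason why \<open>small_decay\<close> is absent here.\<close>

lemma constants_polynomially_bounded:
  shows "polynomially_bounded (\<lambda>B. dim1 (B + 1))" "polynomially_bounded (\<lambda>B. lead_C (B + 1))"
    "polynomially_bounded (\<lambda>B. 1 / (1 - decay (B + 1)))"
proof -
  have b: "B + 1 \<ge> 1" if "B > 0" for B :: real using that by simp
  note c = const_bounds[OF b] and c' = const_bounds'[OF b] and p = spread_bounds[OF b] and f = final_const_bounds[OF b]
  have pos: "B > 0 \<Longrightarrow> 0 \<le> K_const (B + 1)" "B > 0 \<Longrightarrow> 0 \<le> 1 / spread (B + 1)" "B > 0 \<Longrightarrow> 0 \<le> 1 / sqrt (spread (B + 1))"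
    "B > 0 \<Longrightarrow> 0 \<le> 1 / rho (B + 1)" "B > 0 \<Longrightarrow> 0 \<le> 1 / del (B + 1)" "B > 0 \<Longrightarrow> 0 \<le> L_const (B + 1)"
    "B > 0 \<Longrightarrow> 0 \<le> N_const (B + 1)" "B > 0 \<Longrightarrow> 0 \<le> 1 / mu (B + 1)" "B > 0 \<Longrightarrow> 0 \<le> 1 / rate (B + 1)"
    "B > 0 \<Longrightarrow> 0 \<le> H_const (B + 1)" "B > 0 \<Longrightarrow> 0 \<le> dim1 (B + 1)" "B > 0 \<Longrightarrow> 0 \<le> trunc_R (B + 1)"
    "B > 0 \<Longrightarrow> 0 \<le> F_const (B + 1)" "B > 0 \<Longrightarrow> 0 \<le> big_C (B + 1)" for B
    using c[of B] c'[of B] p[of B] by (auto simp: trunc_R_def)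
  have sp: "polynomially_bounded (\<lambda>B. 1 / spread (B + 1))"
    proof (rule polynomially_bounded_mono)
      show "polynomially_bounded (\<lambda>B. 4096 * exp 22 * (B + 1) ^ 4)" by (intro pb_intros) auto
    qed (simp add: spread_def)
  \<comment> \<open>On the unit interval \<open>x \<le> sqrt x\<close>, so a reciprocal square root
    is at most the reciprocal.\<close>
  have ssp: "polynomially_bounded (\<lambda>B. 1 / sqrt (spread (B + 1)))"
  proof (rule polynomially_bounded_mono[OF sp])
    fix B :: real assume B: "B > 0"
    have "spread (B + 1) * 1 \<le> sqrt (spread (B + 1))"
      using p[OF B] real_le_rsqrt[of "spread (B + 1)" "spread (B + 1)"] by (simp add: power2_eq_square mult_left_le)
    then show "1 / sqrt (spread (B + 1)) \<le> 1 / spread (B + 1)" using p[OF B] by (intro divide_left_mono) auto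
  qed
  have K: "polynomially_bounded (\<lambda>B. K_const (B + 1))" unfolding K_const_def by (intro pb_intros) auto
  have rho: "polynomially_bounded (\<lambda>B. 1 / rho (B + 1))"
    proof (rule polynomially_bounded_mono)
      show "polynomially_bounded (\<lambda>B. 48 * K_const (B + 1) * (1 / sqrt (spread (B + 1))))" by (intro pb_intros K ssp pos mult_nonneg_nonneg) auto
    qed (simp add: rho_def)
  have del: "polynomially_bounded (\<lambda>B. 1 / del (B + 1))"
    proof (rule polynomially_bounded_mono)
      show "polynomially_bounded (\<lambda>B. 2112 * (1 / spread (B + 1)) ^ 2 * (1 / rho (B + 1)))" by (intro pb_intros sp rho pos mult_nonneg_nonneg zero_le_power) auto
    qed (simp add: del_def power_divide)
  have L: "polynomially_bounded (\<lambda>B. L_const (B + 1))"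
    proof (rule polynomially_bounded_mono)
      show "polynomially_bounded (\<lambda>B. 128 * (1 / rho (B + 1)) * (1 / sqrt (spread (B + 1))))" by (intro pb_intros ssp rho pos mult_nonneg_nonneg) auto
    qed (simp add: L_const_def)
  have N: "polynomially_bounded (\<lambda>B. N_const (B + 1))"
  proof (rule polynomially_bounded_mono[of "\<lambda>B. 6 + 2 * (1 / del (B + 1))"])
    show "polynomially_bounded (\<lambda>B. 6 + 2 * (1 / del (B + 1)))" by (intro pb_intros del pos) auto
    fix B :: real assume B: "B > 0"
    have "del (B + 1) \<le> sqrt (del (B + 1))"
      using c[OF B] real_le_rsqrt[of "del (B + 1)" "del (B + 1)"] by (simp add: power2_eq_square mult_left_le)
    then have "2 / sqrt (del (B + 1)) \<le> 2 / del (B + 1)" using c[OF B] by (intro divide_left_mono) auto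
    then show "N_const (B + 1) \<le> 6 + 2 * (1 / del (B + 1))" by (simp add: N_const_def)
  qed
  have mu: "polynomially_bounded (\<lambda>B. 1 / mu (B + 1))"
    proof (rule polynomially_bounded_mono)
      show "polynomially_bounded (\<lambda>B. exp 6 * (12 * N_const (B + 1) * L_const (B + 1) * K_const (B + 1)))" by (intro pb_intros N L K pos mult_nonneg_nonneg) auto
    qed (simp add: mu_def exp_minus field_simps)
  have rate: "polynomially_bounded (\<lambda>B. 1 / rate (B + 1))"
    proof (rule polynomially_bounded_mono)
      show "polynomially_bounded (\<lambda>B. (1 / spread (B + 1)) * (1 / mu (B + 1)) ^ 2)" by (intro pb_intros sp mu pos zero_le_power) auto
    qed (simp add: rate_def power_divide)
  have d0: "polynomially_bounded (\<lambda>B. dim0 (B + 1))"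
  proof (rule polynomially_bounded_mono[of "\<lambda>B. 2 + 4 * (1 / del (B + 1)) + (1 / mu (B + 1)) ^ 2"])
    show "polynomially_bounded (\<lambda>B. 2 + 4 * (1 / del (B + 1)) + (1 / mu (B + 1)) ^ 2)"
      by (intro pb_intros del mu pos) auto
    fix B :: real assume B: "B > 0"
    have "1 * mu (B + 1) \<le> 4 * K_const (B + 1) * mu (B + 1)" using c[OF B] by (intro mult_right_mono) auto
    then have "1 / (4 * K_const (B + 1) * mu (B + 1)) \<le> 1 / mu (B + 1)" using c[OF B] by (intro divide_left_mono mult_pos_pos) auto
    then have "(1 / (4 * K_const (B + 1) * mu (B + 1)))\<^sup>2 \<le> (1 / mu (B + 1))\<^sup>2"
      using c[OF B] by (intro power_mono) auto
    then show "dim0 (B + 1) \<le> 2 + 4 * (1 / del (B + 1)) + (1 / mu (B + 1)) ^ 2" by (simp add: dim0_def power_divide)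
  qed
  have F: "polynomially_bounded (\<lambda>B. F_const (B + 1))" unfolding F_const_def by (intro pb_intros N L pos) auto
  have H: "polynomially_bounded (\<lambda>B. H_const (B + 1))"
    proof (rule polynomially_bounded_mono)
      show "polynomially_bounded (\<lambda>B. 2 + F_const (B + 1) * (1 / del (B + 1)))" by (intro pb_intros F del pos) auto
    qed (simp add: H_const_def)
  show d1: "polynomially_bounded (\<lambda>B. dim1 (B + 1))"
    proof (rule polynomially_bounded_mono)
      show "polynomially_bounded (\<lambda>B. dim0 (B + 1) + 2 * H_const (B + 1) * (1 / rate (B + 1)))" by (intro pb_intros d0 H rate pos mult_nonneg_nonneg) auto
    qed (simp add: dim1_def)
  have C: "polynomially_bounded (\<lambda>B. big_C (B + 1))"
    proof (rule polynomially_bounded_mono)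
      show "polynomially_bounded (\<lambda>B. 2 * L_const (B + 1) * (1 / del (B + 1)) * (1 / rho (B + 1)) + 24 * (1 / sqrt (spread (B + 1))))" by (intro pb_intros L del rho ssp pos mult_nonneg_nonneg) auto
    qed (simp add: big_C_def)
  have R: "polynomially_bounded (\<lambda>B. trunc_R (B + 1))"
    proof (rule polynomially_bounded_mono)
      show "polynomially_bounded (\<lambda>B. 8 * (B + 1) * (1 / spread (B + 1)))" by (intro pb_intros sp pos mult_nonneg_nonneg) auto
    qed (simp add: trunc_R_def)
  have cut: "polynomially_bounded (\<lambda>B. real (cut_dim (B + 1)))"
  proof (rule polynomially_bounded_mono[of "\<lambda>B. dim1 (B + 1) + 1"])
    show "polynomially_bounded (\<lambda>B. dim1 (B + 1) + 1)" by (intro pb_intros d1)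
    fix B :: real assume B: "B > 0"
    show "real (cut_dim (B + 1)) \<le> dim1 (B + 1) + 1" using pos(11)[OF B] unfolding cut_dim_def by linarith
  qed
  show "polynomially_bounded (\<lambda>B. lead_C (B + 1))"
    proof (rule polynomially_bounded_mono)
      show "polynomially_bounded (\<lambda>B. big_C (B + 1) + 2 * (4 * real (cut_dim (B + 1)) * (1 + 4 * real (cut_dim (B + 1)) * trunc_R (B + 1))))" by (intro pb_intros C cut R pos mult_nonneg_nonneg add_nonneg_nonneg) auto
    qed (simp add: lead_C_def kappa_def)
  show "polynomially_bounded (\<lambda>B. 1 / (1 - decay (B + 1)))"
  proof (rule polynomially_bounded_mono[of "\<lambda>B. 1 + 2 * (1 / rate (B + 1))"])
    show "polynomially_bounded (\<lambda>B. 1 + 2 * (1 / rate (B + 1)))" by (intro pb_intros rate pos) auto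
    fix B :: real assume B: "B > 0"
    define r where "r = rate (B + 1) / 2"
    have r: "r > 0" using c[OF B] by (simp add: r_def)
    have "exp (- r) * (1 + r) \<le> exp (- r) * exp r" by (intro mult_left_mono exp_ge_add_one_self) auto
    then have e: "exp (- r) * (1 + r) \<le> 1" by (simp flip: exp_add)
    have l: "exp (- r) < 1" using r by simp
    have "1 / (1 - exp (- r)) \<le> 1 + 1 / r" using e l r by (simp add: field_simps)
    then show "1 / (1 - decay (B + 1)) \<le> 1 + 2 * (1 / rate (B + 1))" by (simp add: decay_def r_def)
  qed
qed

section \<open>Transfer to the matrix model\<close>

text \<open>Independence of all entries is checked on products of Borel sets: such an event is an
  intersection of row events, which factorizes by independence of the rows, and each row event
  factorizes after transfer to the law of \<xi>.\<close>

lemma matrix_entries: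
  assumes N: "prob_space N" and M: "prob_space M" and \<xi>: "prob_space.indep_vars N (\<lambda>_. borel) \<xi> {..<n}"
    and copies: "rows_independent_copies M n A N \<xi>" and n: "n > 0"
  shows entry_measurable: "\<And>i j. i < n \<Longrightarrow> j < n \<Longrightarrow> (\<lambda>\<omega>. A \<omega> $$ (i, j)) \<in> borel_measurable M"
    and entry_law: "\<And>i j. i < n \<Longrightarrow> j < n \<Longrightarrow> distr M borel (\<lambda>\<omega>. A \<omega> $$ (i, j)) = distr N borel (\<xi> j)"
    and entries_indep: "indep_matrix M {..<n} {..<n} (\<lambda>p \<omega>. A \<omega> $$ p)"
proof -
  interpret N: prob_space N by fact
  interpret M: prob_space M by fact
  have rows: "M.indep_vars (\<lambda>_. borel_vec n) (row_vector n A) {..<n}"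
    and law: "\<And>i. i < n \<Longrightarrow> distr M (borel_vec n) (row_vector n A i) = distr N (borel_vec n) (rv_vector n \<xi>)"
    using copies by (auto simp: rows_independent_copies_def)
  have rowm: "row_vector n A i \<in> measurable M (borel_vec n)" if "i < n" for i
    using rows that by (auto simp: M.indep_vars_def)
  have \<xi>m: "\<xi> j \<in> borel_measurable N" if "j < n" for j using \<xi> that by (auto simp: N.indep_vars_def)
  have rvm: "rv_vector n \<xi> \<in> measurable N (borel_vec n)"
    unfolding rv_vector_def by (intro measurable_restrict \<xi>m) auto
  have ent: "A \<omega> $$ (i, j) = row_vector n A i \<omega> j" if "j < n" for i j \<omega> using that by (simp add: row_vector_def)
  show em: "(\<lambda>\<omega>. A \<omega> $$ (i, j)) \<in> borel_measurable M" if "i < n" "j < n" for i j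
    unfolding ent[OF that(2)] using that rowm[OF that(1)]
    by (intro measurable_compose[OF rowm[OF that(1)] measurable_component_singleton]) auto
  show el: "distr M borel (\<lambda>\<omega>. A \<omega> $$ (i, j)) = distr N borel (\<xi> j)" if "i < n" "j < n" for i j
  proof -
    have c: "(\<lambda>v. v j) \<in> measurable (borel_vec n) (borel :: real measure)" using that by (intro measurable_component_singleton) auto
    have "distr M borel (\<lambda>\<omega>. A \<omega> $$ (i, j)) = distr (distr M (borel_vec n) (row_vector n A i)) borel (\<lambda>v. v j)"
      unfolding ent[OF that(2)] by (subst distr_distr[OF c rowm[OF that(1)]]) (simp add: comp_def)
    also have "\<dots> = distr N borel (\<lambda>\<omega>. rv_vector n \<xi> \<omega> j)"
      unfolding law[OF that(1)] by (subst distr_distr[OF c rvm]) (simp add: comp_def)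
    also have "\<dots> = distr N borel (\<xi> j)" using that by (simp add: rv_vector_def)
    finally show ?thesis .
  qed
  have prob_eq: "M.prob ((\<lambda>\<omega>. A \<omega> $$ (i, j)) -` B \<inter> space M) = N.prob (\<xi> j -` B \<inter> space N)"
    if "i < n" "j < n" "B \<in> sets borel" for i j B
    using arg_cong[OF el[OF that(1,2)], of "\<lambda>m. measure m B"] that em \<xi>m by (simp add: measure_distr)
  let ?I = "{..<n}"
  have "(0, 0) \<in> ?I \<times> ?I" using n by auto
  then have ne: "?I \<times> ?I \<noteq> {}" "?I \<noteq> {}" by blast+
  show "indep_matrix M ?I ?I (\<lambda>p \<omega>. A \<omega> $$ p)"
  proof (subst M.indep_vars_finite[where E = "\<lambda>_. sets borel", OF ne(1)])
    show "\<forall>B\<in>?I \<times> ?I \<rightarrow> sets borel. M.prob (\<Inter>p\<in>?I \<times> ?I. (\<lambda>\<omega>. A \<omega> $$ p) -` B p \<inter> space M) =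
      (\<Prod>p\<in>?I \<times> ?I. M.prob ((\<lambda>\<omega>. A \<omega> $$ p) -` B p \<inter> space M))"
    proof
      fix B :: "nat \<times> nat \<Rightarrow> real set" assume "B \<in> ?I \<times> ?I \<rightarrow> sets borel"
      then have B: "B (i, j) \<in> sets borel" if "i < n" "j < n" for i j using that by auto
      define C where "C i = PiE ?I (\<lambda>j. B (i, j))" for i
      have Cm: "C i \<in> sets (borel_vec n)" if "i < n" for i
        unfolding C_def using B[OF that] by (intro sets_PiM_I_finite) auto
      have "(\<Inter>p\<in>?I \<times> ?I. (\<lambda>\<omega>. A \<omega> $$ p) -` B p \<inter> space M) = (\<Inter>i\<in>?I. row_vector n A i -` C i \<inter> space M)"
        using ne by (auto simp: C_def row_vector_def PiE_iff)
      then have "M.prob (\<Inter>p\<in>?I \<times> ?I. (\<lambda>\<omega>. A \<omega> $$ p) -` B p \<inter> space M) = (\<Prod>i\<in>?I. M.prob (row_vector n A i -` C i \<inter> space M))"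
        using M.indep_varsD_finite[OF rows ne(2), of C] Cm by simp
      also have "\<dots> = (\<Prod>i\<in>?I. \<Prod>j\<in>?I. N.prob (\<xi> j -` B (i, j) \<inter> space N))"
      proof (intro prod.cong refl)
        fix i assume i: "i \<in> ?I"
        have "M.prob (row_vector n A i -` C i \<inter> space M) = measure (distr M (borel_vec n) (row_vector n A i)) (C i)"
          using i Cm rowm by (simp add: measure_distr)
        also have "\<dots> = N.prob (rv_vector n \<xi> -` C i \<inter> space N)"
          using i Cm rvm law[of i] by (simp add: measure_distr)
        also have "rv_vector n \<xi> -` C i \<inter> space N = (\<Inter>j\<in>?I. \<xi> j -` B (i, j) \<inter> space N)"
          using ne by (auto simp: C_def rv_vector_def PiE_iff)
        also have "N.prob \<dots> = (\<Prod>j\<in>?I. N.prob (\<xi> j -` B (i, j) \<inter> space N))"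
          using i B by (intro N.indep_varsD_finite[OF \<xi> ne(2)]) auto
        finally show "M.prob (row_vector n A i -` C i \<inter> space M) = (\<Prod>j\<in>?I. N.prob (\<xi> j -` B (i, j) \<inter> space N))" .
      qed
      also have "\<dots> = (\<Prod>i\<in>?I. \<Prod>j\<in>?I. M.prob ((\<lambda>\<omega>. A \<omega> $$ (i, j)) -` B (i, j) \<inter> space M))"
        using B by (intro prod.cong refl prob_eq[symmetric]) auto
      also have "\<dots> = (\<Prod>p\<in>?I \<times> ?I. M.prob ((\<lambda>\<omega>. A \<omega> $$ p) -` B p \<inter> space M))"
        by (subst prod.cartesian_product) (auto intro!: prod.cong)
      finally show "M.prob (\<Inter>p\<in>?I \<times> ?I. (\<lambda>\<omega>. A \<omega> $$ p) -` B p \<inter> space M) =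
        (\<Prod>p\<in>?I \<times> ?I. M.prob ((\<lambda>\<omega>. A \<omega> $$ p) -` B p \<inter> space M))" .
    qed
    show "sets borel = sigma_sets (space borel) (sets (borel :: real measure))"
      by (metis sets.sigma_sets_eq)
    show "Int_stable (sets (borel :: real measure))" by (rule sets.Int_stable)
  qed (use em sets.space_closed in auto)
qed

text \<open>The infimum need not be attained, but some admissible value lies strictly below
  \<open>B + 1\<close>, and the tail bound weakens as its parameter grows.\<close>

lemma subgaussian_moment_bound:
  assumes sg: "subgaussian M X" and le: "subgaussian_moment M X \<le> B"
  shows "subgaussian_bound M X (B + 1)"
proof -
  have "Inf {B. subgaussian_bound M X B} < B + 1" using le by (simp add: subgaussian_moment_def)
  then obtain B' where B': "subgaussian_bound M X B'" "B' < B + 1"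
    using sg cInf_lessD[of "{B. subgaussian_bound M X B}"] by (auto simp: subgaussian_def)
  have pos: "0 < B'" using B' by (simp add: subgaussian_bound_def)
  have "measure M {\<omega> \<in> space M. t < \<bar>X \<omega>\<bar>} \<le> 2 * exp (- t\<^sup>2 / (B + 1)\<^sup>2)" if t: "t > 0" for t
  proof -
    have "t\<^sup>2 / (B + 1)\<^sup>2 \<le> t\<^sup>2 / B'\<^sup>2" using pos B'(2) by (intro divide_left_mono power_mono) auto
    then have "2 * exp (- t\<^sup>2 / B'\<^sup>2) \<le> 2 * exp (- t\<^sup>2 / (B + 1)\<^sup>2)" by simp
    moreover have "measure M {\<omega> \<in> space M. t < \<bar>X \<omega>\<bar>} \<le> 2 * exp (- t\<^sup>2 / B'\<^sup>2)"
      using B'(1) t by (auto simp: subgaussian_bound_def)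
    ultimately show ?thesis by linarith
  qed
  then show ?thesis using pos B'(2) by (auto simp: subgaussian_bound_def)
qed

text \<open>The strict inequality provides a unit vector directly from the infimum, without a
  compactness argument. The first unit vector shows that the set is nonempty.\<close>

lemma small_sv_of_smallest_singular_value:
  assumes A: "A \<in> carrier_mat n n" and n: "n > 0" and le: "smallest_singular_value A < t / sqrt n"
  shows "small_sv n t (\<lambda>p. A $$ p)"
proof -
  let ?S = "{x \<in> carrier_vec n. vec_norm2 x = 1}"
  have "unit_vec n 0 \<in> ?S"
    using n by (auto simp: vec_norm2_def L2_set_def unit_vec_def if_distrib[of "\<lambda>x. x\<^sup>2"] cong: if_cong)
  then have ne: "(\<lambda>x. vec_norm2 (A *\<^sub>v x)) ` ?S \<noteq> {}" by blast
  have "Inf ((\<lambda>x. vec_norm2 (A *\<^sub>v x)) ` ?S) < t / sqrt n"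
    using le A by (simp add: smallest_singular_value_def)
  from cInf_lessD[OF ne this] obtain x where x: "x \<in> carrier_vec n" "vec_norm2 x = 1" "vec_norm2 (A *\<^sub>v x) < t / sqrt n"
    by auto
  have "(\<Sum>i<n. (x $ i)\<^sup>2) = 1"
    using x(1,2) by (auto simp: vec_norm2_def L2_set_def)
  moreover have "L2_set (mv {..<n} (\<lambda>p. A $$ p) (\<lambda>i. x $ i)) {..<n} = vec_norm2 (A *\<^sub>v x)"
    unfolding vec_norm2_def using A x(1)
    by (intro L2_set_cong) (auto simp: mv_def scalar_prod_def lessThan_atLeast0 mult.commute intro!: sum.cong)
  ultimately show ?thesis unfolding small_sv_def using x(3) by (intro exI[of _ "\<lambda>i. x $ i"]) auto
qed

theorem theorem1p2:
  shows "\<exists>C c c' n0 :: real \<Rightarrow> real.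
    (\<forall>B>0. C B > 0 \<and> 0 < c B \<and> c B < 1 \<and> 0 < c' B \<and> c' B < 1) \<and>
    polynomially_bounded C \<and>
    polynomially_bounded (\<lambda>B. 1 / (1 - c' B)) \<and>
    polynomially_bounded n0 \<and>
    (\<forall>B>0. \<forall>n>0. \<forall>(N :: 'b measure) (\<xi> :: nat \<Rightarrow> 'b \<Rightarrow> real)
        (M :: 'a measure) (A :: 'a \<Rightarrow> real mat).
      prob_space N \<and>
      prob_space.indep_vars N (\<lambda>_. borel) \<xi> {..<n} \<and>
      (\<forall>j<n. prob_space.expectation N (\<xi> j) = 0 \<and>
             prob_space.variance N (\<xi> j) \<ge> 1 \<and>
             subgaussian N (\<xi> j) \<and> subgaussian_moment N (\<xi> j) \<le> B) \<and>
      prob_space M \<and>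
      rows_independent_copies M n A N \<xi> \<longrightarrow>
      (\<forall>\<epsilon>\<ge>0.
        measure M {\<omega> \<in> space M. smallest_singular_value (A \<omega>) \<le> \<epsilon> * real n powr (-1/2)}
          \<le> C B * \<epsilon> + c B ^ n \<and>
        (real n \<ge> n0 B \<longrightarrow>
          measure M {\<omega> \<in> space M. smallest_singular_value (A \<omega>) \<le> \<epsilon> * real n powr (-1/2)}
            \<le> C B * \<epsilon> + c' B ^ n)))"
proof (intro exI conjI allI impI)
  show "polynomially_bounded (\<lambda>B. lead_C (B + 1))" "polynomially_bounded (\<lambda>B. 1 / (1 - decay (B + 1)))"
    "polynomially_bounded (\<lambda>B. dim1 (B + 1))"
    by (rule constants_polynomially_bounded)+
  fix B :: real assume B: "B > 0"
  define b where "b = B + 1"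
  have b: "b \<ge> 1" using B by (simp add: b_def)
  note f = final_const_bounds[OF b]
  show "lead_C (B + 1) > 0" "0 < small_decay (B + 1)" "small_decay (B + 1) < 1" "0 < decay (B + 1)" "decay (B + 1) < 1"
    using f by (auto simp: b_def)
  fix n :: nat and N :: "'b measure" and \<xi> :: "nat \<Rightarrow> 'b \<Rightarrow> real" and M :: "'a measure" and A :: "'a \<Rightarrow> real mat" and \<epsilon> :: real
  assume n: "0 < n" and hyp: "prob_space N \<and>
      prob_space.indep_vars N (\<lambda>_. borel) \<xi> {..<n} \<and>
      (\<forall>j<n. prob_space.expectation N (\<xi> j) = 0 \<and>
             prob_space.variance N (\<xi> j) \<ge> 1 \<and>
             subgaussian N (\<xi> j) \<and> subgaussian_moment N (\<xi> j) \<le> B) \<and>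
      prob_space M \<and>
      rows_independent_copies M n A N \<xi>" and \<epsilon>: "0 \<le> \<epsilon>"
  interpret N: prob_space N using hyp by blast
  interpret M: prob_space M using hyp by blast
  have carrier: "A \<omega> \<in> carrier_mat n n" if "\<omega> \<in> space M" for \<omega>
    using hyp that by (auto simp: rows_independent_copies_def)
  have NM: "prob_space N" "prob_space M" "N.indep_vars (\<lambda>_. borel) \<xi> {..<n}" "rows_independent_copies M n A N \<xi>"
    using hyp by auto
  note entries = matrix_entries[OF NM n]
  define a where "a p \<omega> = A \<omega> $$ p" for p \<omega>
  have law: "\<exists>\<nu>. \<forall>i<n. distr M borel (a (i, j)) = \<nu>" if "j < n" for j
    using entries(2)[OF _ that] by (auto simp: a_def[abs_def])
  have sg: "sg_var M b (a p)" if p: "p \<in> {..<n} \<times> {..<n}" for p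
  proof -
    obtain i j where ij: "p = (i, j)" "i < n" "j < n" using p by auto
    have \<xi>m: "\<xi> j \<in> borel_measurable N" using NM(3) ij by (auto simp: N.indep_vars_def)
    have j: "N.expectation (\<xi> j) = 0" "1 \<le> N.variance (\<xi> j)" "subgaussian N (\<xi> j)" "subgaussian_moment N (\<xi> j) \<le> B"
      using hyp ij(3) by auto
    have "sg_var N b (\<xi> j)"
      using j \<xi>m subgaussian_moment_bound[OF j(3,4)] by (simp add: sg_var_def b_def)
    then have "sg_var (distr M borel (a p)) b (\<lambda>x. x)"
      using sg_var_distr[OF \<xi>m] entries(2)[OF ij(2,3)] by (simp add: a_def[abs_def] ij(1))
    then show ?thesis
      using sg_var_distr[OF entries(1)[OF ij(2,3)], of b] by (simp add: a_def[abs_def] ij(1))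
  qed
  have ind: "indep_matrix M {..<n} {..<n} a" using entries(3) by (simp add: a_def[abs_def])
  let ?S = "{\<omega> \<in> space M. smallest_singular_value (A \<omega>) \<le> \<epsilon> * real n powr (-1/2)}"
  \<comment> \<open>A parameter strictly above \<epsilon> turns the inequality \<open>\<le>\<close>
    of the event into the strict one of \<open>small_sv\<close>, and it is positive even when
    \<epsilon> is zero.\<close>
  have key: "M.prob ?S \<le> lead_C b * t + small_decay b ^ n \<and> (dim1 b \<le> n \<longrightarrow> M.prob ?S \<le> lead_C b * t + decay b ^ n)"
    if t: "t > \<epsilon>" for t
  proof -
    have t0: "t > 0" using t \<epsilon> by linarith
    obtain W where W: "W \<in> M.events" "M.prob W \<le> lead_C b * t + small_decay b ^ n"
      "dim1 b \<le> n \<Longrightarrow> M.prob W \<le> lead_C b * t + decay b ^ n"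
      "\<And>\<omega>. \<omega> \<in> space M \<Longrightarrow> small_sv n t (\<lambda>p. a p \<omega>) \<Longrightarrow> \<omega> \<in> W"
      using M.small_sv_bound[OF b _ t0 ind sg law] n by auto
    have "?S \<subseteq> W"
    proof
      fix \<omega> assume \<omega>: "\<omega> \<in> ?S"
      have "real n powr (-1/2) = 1 / sqrt n" using n by (simp add: powr_minus powr_half_sqrt inverse_eq_divide)
      then have "smallest_singular_value (A \<omega>) \<le> \<epsilon> / sqrt n" using \<omega> by simp
      also have "\<dots> < t / sqrt n" using t n by (intro divide_strict_right_mono) auto
      finally have "small_sv n t (\<lambda>p. A \<omega> $$ p)"
        using \<omega> carrier n by (intro small_sv_of_smallest_singular_value) auto
      then show "\<omega> \<in> W" using W(4) \<omega> by (simp add: a_def)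
    qed
    \<comment> \<open>Monotonicity asks for measurability of the larger set only.\<close>
    then have "M.prob ?S \<le> M.prob W" using W(1) by (rule M.finite_measure_mono)
    then show ?thesis using W(2,3) by (auto intro: order_trans)
  qed
  \<comment> \<open>The right-hand side is continuous in \<open>t\<close>, so \<open>t\<close> may
    decrease to \<epsilon>.\<close>
  have lim: "x \<le> lead_C b * \<epsilon> + y" if "\<And>t. t > \<epsilon> \<Longrightarrow> x \<le> lead_C b * t + y" for x y
  proof (rule field_le_epsilon)
    fix e :: real assume e: "e > 0"
    have "x \<le> lead_C b * (\<epsilon> + e / lead_C b) + y" using e f(3) by (intro that) auto
    then show "x \<le> lead_C b * \<epsilon> + y + e" using f(3) by (simp add: ring_distribs)
  qed
  show "M.prob ?S \<le> lead_C (B + 1) * \<epsilon> + small_decay (B + 1) ^ n"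
    using lim[of "M.prob ?S" "small_decay b ^ n"] key by (simp add: b_def)
  assume "dim1 (B + 1) \<le> real n"
  then show "M.prob ?S \<le> lead_C (B + 1) * \<epsilon> + decay (B + 1) ^ n"
    using lim[of "M.prob ?S" "decay b ^ n"] key by (simp add: b_def)
qed

end
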